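(* Fix one of the three clause types $k$-SAT, $k$-NAESAT, $k$-XORSAT, and let $F(n,\alpha)$ be the corresponding random planted formula. For every $k\ge 2$ there exist a countable set $\mathcal D$ and a function $\phi_s:[0,\infty)\to[0,1]$ such that for every $\alpha\in[0,\infty)\setminus\mathcal D$ and every $\epsilon>0$, $$\lim_{n\to\infty} Q_n(\alpha,\phi_s(\alpha)-\epsilon)=0 \qquad\text{and}\qquad \lim_{n\to\infty} Q_n(\alpha,\phi_s(\alpha)+\epsilon)=1 .$$
   Context: Let $V=\{v_1,\dots,v_n\}$ be Boolean variables and $k\ge 2$ an integer. A $k$-clause consists of an edge $e$ (a $k$-element subset of $V$, read in some fixed order) together with a clause function $\chi_e:\{0,1\}^k\to\{0,1\}$ of the following form, according to the problem type (the type is the same for all clauses). Here $y[e]\in\{0,1\}^k$ denotes the restriction to $e$ of an assignment $y\in\{0,1\}^n$. - $k$-SAT: $\chi_e(y[e])=1\iff y[e]\ne x_e$, for some $x_e\in\{0,1\}^k$. - $k$-NAESAT: $\chi_e(y[e])=1\iff y[e]\notin\{x_e,\overline{x_e}\}$, for some $x_e\in\{0,1\}^k$, where $\overline{x_e}$ flips every component of $x_e$. - $k$-XORSAT: $\chi_e(y[e])=1\iff \bigoplus_{i\in e} y_i=x_e$, for some $x_e\in\{0,1\}$. $C_k(n)$ is the set of all possible $k$-clauses of the given type on $V$, and $N=|C_k(n)|$ (for example $N=\binom nk 2^k$ for $k$-SAT). A formula is a subset of $C_k(n)$ (several clauses may share the same edge). An assignment $y$ satisfies a formula $F$ if $\chi_e(y[e])=1$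 for all its clauses, and $Z(F)$ is the number of $y\in\{0,1\}^n$ satisfying $F$. Random planted formula $F(n,\alpha)$: sample $v^0\in\{0,1\}^n$ uniformly at random; then include in $F(n,\alpha)$ each $k$-clause of $C_k(n)$ satisfied by $v^0$, independently with probability $p=\alpha n/N$ (for fixed $\alpha$ this is at most $1$ for all large $n$). For real $\phi$, $Q_n(\alpha,\phi):=\mathbb P[Z(F(n,\alpha))<2^{n\phi}]$. *)

theory Defs
  imports "HOL-Probability.Probability"
begin

datatype clause_type = SAT | NAESAT | XORSAT

definition cube :: "nat \<Rightarrow> bool list set" where
  "cube n = {y. length y = n}"

definition xor_list :: "bool list \<Rightarrow> bool" where
  "xor_list z = foldr (\<noteq>) z False"

text \<open>
  Clause functions are functions on \<^term>\<open>cube k\<close>, made extensional by restriction. Hence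
  distinct parameters that yield the same function (\<^term>\<open>x\<close> and its complement
  for \<^const>\<open>NAESAT\<close>) yield the same clause.
\<close>
fun clause_functions :: "clause_type \<Rightarrow> nat \<Rightarrow> (bool list \<Rightarrow> bool) set" where
  "clause_functions SAT k = {(\<lambda>z\<in>cube k. z \<noteq> x) | x. x \<in> cube k}"
| "clause_functions NAESAT k = {(\<lambda>z\<in>cube k. z \<notin> {x, map Not x}) | x. x \<in> cube k}"
| "clause_functions XORSAT k = {(\<lambda>z\<in>cube k. xor_list z = b) | b. b \<in> UNIV}"

type_synonym clause = "nat set \<times> (bool list \<Rightarrow> bool)"

definition clauses :: "clause_type \<Rightarrow> nat \<Rightarrow> nat \<Rightarrow> clause set" where
  "clauses t k n = {e. e \<subseteq> {..<n} \<and> card e = k} \<times> clause_functions t k"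

text \<open>
  The variables are the positions \<^term>\<open>{..<n}\<close> of an assignment \<^term>\<open>y \<in> cube n\<close>; edges are
  read in increasing order, so the restriction of \<^term>\<open>y\<close> to \<^term>\<open>e\<close> is \<^term>\<open>nths y e\<close>.
\<close>
definition satisfies_clause :: "bool list \<Rightarrow> clause \<Rightarrow> bool" where
  "satisfies_clause y c \<longleftrightarrow> snd c (nths y (fst c))"

definition satisfies :: "bool list \<Rightarrow> clause set \<Rightarrow> bool" where
  "satisfies y F \<longleftrightarrow> (\<forall>c\<in>F. satisfies_clause y c)"

definition num_solutions :: "nat \<Rightarrow> clause set \<Rightarrow> nat" where
  "num_solutions n F = card {y \<in> cube n. satisfies y F}"

text \<open>
  For the finitely many \<^term>\<open>n\<close> for which \<^term>\<open>\<alpha> * real n / real (card (clauses t k n))\<close>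
  exceeds 1, \<^const>\<open>bernoulli_pmf\<close> truncates its parameter to 1; for \<^term>\<open>n < k\<close> there are
  no clauses.
\<close>
definition planted_formula :: "clause_type \<Rightarrow> nat \<Rightarrow> nat \<Rightarrow> real \<Rightarrow> clause set pmf" where
  "planted_formula t k n \<alpha> = do {
     v \<leftarrow> pmf_of_set (cube n);
     X \<leftarrow> Pi_pmf {c \<in> clauses t k n. satisfies_clause v c} False
            (\<lambda>_. bernoulli_pmf (\<alpha> * real n / real (card (clauses t k n))));
     return_pmf {c. X c}
   }"

definition Q :: "clause_type \<Rightarrow> nat \<Rightarrow> nat \<Rightarrow> real \<Rightarrow> real \<Rightarrow> real" where
  "Q t k n \<alpha> \<phi> =
     measure_pmf.prob (planted_formula t k n \<alpha>)
       {F. real (num_solutions n F) < 2 powr (real n * \<phi>)}"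

end

theory Submission
  imports Defs "HOL-Real_Asymp.Real_Asymp"
begin


text \<open>
  Write \<open>Z\<close> for the number of solutions of the planted formula on \<open>n\<close> variables. The theorem follows
  from two facts: \<open>ln Z\<close> deviates from its mean by \<open>O(sqrt n)\<close>, and this mean divided by \<open>n\<close> converges for
  every \<open>\<alpha>\<close>. Both rest on the observation that every assignment satisfies the same number of
  clauses. Hence the hidden assignment is uniform on the solutions once the formula is
  known, the mean of \<open>ln Z\<close> is the conditional entropy of the hidden assignment, and a further planted
  clause that keeps a fraction \<open>x\<close> of the solutions occurs with probability proportional to \<open>x\<close>. In
  particular a clause costs a bounded amount of entropy in the mean, although it may destroy
  almost all solutions.

  Concentration (\<open>planted_variance_le\<close>) is the Efron-Stein inequality. A clause present with
  probability of order \<open>x\<close> changes \<open>ln Z\<close> by \<open>ln x\<close>, and \<open>x (ln x)^2\<close> is bounded, so each of the \<open>O(n)\<close>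
  clauses contributes \<open>O(1)\<close> to the variance. The inequality is applied for a fixed hidden
  assignment; a symmetry shows that the distribution of \<open>Z\<close> does not depend on it.

  Convergence (\<open>ent_rate_comparison\<close>) is an interpolation in the manner of Guerra and Toninelli. The
  variables are divided into blocks of length \<open>l\<close>, and clauses on arbitrary edges are replaced one by one
  by clauses on edges inside a random block. If no replacement lowers the entropy, the entropy of the
  whole is at most the sum of the entropies of the blocks; up to error terms the entropy
  per variable is then bounded by its value for each smaller \<open>l\<close>, and it converges to the infimum. For
  SAT and NAESAT (\<open>ent_interpolation_SAT_NAESAT\<close>) the entropy cost of a clause is expanded in a
  power series whose \<open>j\<close>-th term counts the agreement of \<open>j\<close> independent solutions. For an edge with
  independent entries it becomes the \<open>k\<close>-th power of a fraction of common literals, which is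
  convex because fractions are nonnegative.

  For XORSAT (\<open>interpolation_XORSAT\<close>) the corresponding quantity is the overlap of two solutions, which
  may be negative, and for odd \<open>k\<close> convexity fails. There the values of a few random variables are
  revealed as well. By linearity, two variables that are not determined by the formula are either
  independent or tied together, and revealing one of a tied pair determines the other. Since
  only \<open>n\<close> variables can become determined, few tied pairs remain after most numbers of reveals. Then
  the overlap in a block is close to the fraction of determined variables, which is nonnegative.

  All these models differ only in the set of edges, and a random planted clause acts on functionals of
  the solution set by an averaging operator, see \<open>edge_op\<close>. The operators commute, and
  comparing models is comparing operators. The formula with independently chosen clauses is
  exactly a Poisson number of independent clauses with repetitions ignored (\<open>planted_ent_sums\<close>).
\<close>
section \<open>Planted clauses as averaging operators\<close>

definition ent :: "'a set \<Rightarrow> real" where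
  "ent S = real (card S) * ln (real (card S))"

definition clause_sols :: "nat list \<Rightarrow> (bool list \<Rightarrow> bool) \<Rightarrow> bool list set" where
  "clause_sols js \<sigma> = {y. \<sigma> (map ((!) y) js)}"

text \<open>
  Let the hidden assignment be uniform on \<open>S\<close> and reveal a uniformly random clause on the edge
  \<open>js\<close> among those that it satisfies. If \<open>g S = |S| * f S\<close>, then \<open>edge_avg t k js g S / |S|\<close> is the
  mean of \<open>f\<close> at the new set of candidates. The denominator is the number of clause functions that
  an assignment satisfies: exactly one is violated, whatever the assignment and the type.
  Edges are lists, possibly with repetitions, because independent entries make the mean over
  all edges factorize.
\<close>
definition edge_avg ::
  "clause_type \<Rightarrow> nat \<Rightarrow> nat list \<Rightarrow> (bool list set \<Rightarrow> real) \<Rightarrow> bool list set \<Rightarrow> real" where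
  "edge_avg t k js g S =
     (\<Sum>\<sigma>\<in>clause_functions t k. g (S \<inter> clause_sols js \<sigma>)) / (real (card (clause_functions t k)) - 1)"

definition edge_op ::
  "clause_type \<Rightarrow> nat \<Rightarrow> nat list set \<Rightarrow> (bool list set \<Rightarrow> real) \<Rightarrow> bool list set \<Rightarrow> real" where
  "edge_op t k D g S = (\<Sum>js\<in>D. edge_avg t k js g S) / real (card D)"

text \<open>
  Unary XORSAT clauses are admitted, as they reveal single variables. Unary NAESAT has only one
  clause function, which nothing satisfies.
\<close>
definition valid_arity :: "clause_type \<Rightarrow> nat \<Rightarrow> bool" where
  "valid_arity t k \<longleftrightarrow> 1 \<le> k \<and> (t = NAESAT \<longrightarrow> 2 \<le> k)"

lemma cube_lists: "cube n = {y. set y \<subseteq> UNIV \<and> length y = n}"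
  by (simp add: cube_def)

lemma finite_cube [simp]: "finite (cube n)"
  unfolding cube_lists by (rule finite_lists_length_eq) simp

lemma card_cube [simp]: "card (cube n) = 2 ^ n"
  unfolding cube_lists by (subst card_lists_length_eq) auto

lemma cube_nonempty [simp]: "cube n \<noteq> {}"
  using card_cube[of n] by (metis card.empty power_not_zero zero_neq_numeral)

definition sat_fun :: "nat \<Rightarrow> bool list \<Rightarrow> bool list \<Rightarrow> bool" where
  "sat_fun k x = (\<lambda>z\<in>cube k. z \<noteq> x)"
definition nae_fun :: "nat \<Rightarrow> bool list \<Rightarrow> bool list \<Rightarrow> bool" where
  "nae_fun k x = (\<lambda>z\<in>cube k. z \<notin> {x, map Not x})"
definition xor_fun :: "nat \<Rightarrow> bool \<Rightarrow> bool list \<Rightarrow> bool" where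
  "xor_fun k b = (\<lambda>z\<in>cube k. xor_list z = b)"

lemma clause_functions_image:
  "clause_functions SAT k = sat_fun k ` cube k"
  "clause_functions NAESAT k = nae_fun k ` cube k"
  "clause_functions XORSAT k = xor_fun k ` UNIV"
  by (auto simp: sat_fun_def nae_fun_def xor_fun_def)

lemma finite_clause_functions [simp]: "finite (clause_functions t k)"
  by (cases t) (simp_all only: clause_functions_image, auto)

lemma map_Not_Not [simp]: "map Not (map Not x) = x"
  by (simp add: o_def)

lemma map_Not_in_cube [simp]: "map Not x \<in> cube k \<longleftrightarrow> x \<in> cube k"
  by (simp add: cube_def)

lemma map_Not_neq: "x \<in> cube k \<Longrightarrow> 1 \<le> k \<Longrightarrow> map Not x \<noteq> x"
  by (cases x) (auto simp: cube_def)

lemma nae_fun_eq_iff: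
  assumes "x \<in> cube k" "x' \<in> cube k"
  shows "nae_fun k x = nae_fun k x' \<longleftrightarrow> x' = x \<or> x' = map Not x"
proof
  assume "nae_fun k x = nae_fun k x'"
  then have "nae_fun k x x' = nae_fun k x' x'" by simp
  then show "x' = x \<or> x' = map Not x" using assms by (auto simp: nae_fun_def)
next
  assume "x' = x \<or> x' = map Not x"
  then have "{x', map Not x'} = {x, map Not x}"
    by (metis insert_commute map_Not_Not)
  then show "nae_fun k x = nae_fun k x'" unfolding nae_fun_def by simp
qed

text \<open>
  The sets of violating inputs of the clause functions are a partition of the cube: points for
  SAT, antipodal pairs for NAESAT, the two parity classes for XORSAT. This is what the three
  types have in common. It makes the number of clauses satisfied by an assignment constant, so
  that the hidden assignment is uniform on the solutions of the planted formula.
\<close>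
lemma unique_violation:
  assumes z: "z \<in> cube k" and "1 \<le> k"
  shows "\<exists>!\<sigma>. \<sigma> \<in> clause_functions t k \<and> \<not> \<sigma> z"
proof (cases t)
  case SAT
  show ?thesis unfolding SAT clause_functions_image
    by (rule ex1I[of _ "sat_fun k z"]) (use z in \<open>auto simp: sat_fun_def\<close>)
next
  case NAESAT
  show ?thesis unfolding NAESAT clause_functions_image
  proof (rule ex1I[of _ "nae_fun k z"])
    fix \<sigma> assume "\<sigma> \<in> nae_fun k ` cube k \<and> \<not> \<sigma> z"
    then obtain x where x: "x \<in> cube k" "\<sigma> = nae_fun k x" "z = x \<or> z = map Not x"
      using z by (auto simp: nae_fun_def)
    then show "\<sigma> = nae_fun k z" using nae_fun_eq_iff[OF x(1) z] by simp
  qed (use z in \<open>auto simp: nae_fun_def\<close>)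
next
  case XORSAT
  show ?thesis unfolding XORSAT clause_functions_image
    by (rule ex1I[of _ "xor_fun k (\<not> xor_list z)"]) (use z in \<open>auto simp: xor_fun_def\<close>)
qed

lemma card_violated:
  assumes "z \<in> cube k" and "1 \<le> k"
  shows "card {\<sigma> \<in> clause_functions t k. \<not> \<sigma> z} = 1"
proof -
  obtain \<sigma> where s: "\<sigma> \<in> clause_functions t k \<and> \<not> \<sigma> z"
    and u: "\<And>\<tau>. \<tau> \<in> clause_functions t k \<and> \<not> \<tau> z \<Longrightarrow> \<tau> = \<sigma>"
    using unique_violation[OF assms, of t] by (elim ex1E) blast
  have "{\<sigma> \<in> clause_functions t k. \<not> \<sigma> z} = {\<sigma>}" using s u by blast
  then show ?thesis by simp
qed

lemma card_SAT: "card (clause_functions SAT k) = 2 ^ k"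
  unfolding clause_functions_image
  by (subst card_image) (auto simp: inj_on_def sat_fun_def fun_eq_iff restrict_def split: if_splits)

lemma inj_xor_fun: "1 \<le> k \<Longrightarrow> inj (xor_fun k)"
proof (rule injI)
  fix b c :: bool
  assume "1 \<le> k" and eq: "xor_fun k b = xor_fun k c"
  have "replicate k False \<in> cube k" by (simp add: cube_def)
  with fun_cong[OF eq, of "replicate k False"] show "b = c"
    by (auto simp: xor_fun_def)
qed

lemma card_XORSAT: "1 \<le> k \<Longrightarrow> card (clause_functions XORSAT k) = 2"
  unfolding clause_functions_image by (subst card_image[OF inj_xor_fun]) auto

lemma card_clause_functions_ge_2:
  assumes "valid_arity t k"
  shows "2 \<le> card (clause_functions t k)"
proof (cases t)
  case SAT
  then show ?thesis using assms unfolding SAT card_SAT valid_arity_def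
    by (metis One_nat_def power_increasing power_one_right one_le_numeral)
next
  case NAESAT
  with assms have k: "2 \<le> k" by (simp add: valid_arity_def)
  let ?x = "replicate k False" and ?x' = "replicate (k - 1) False @ [True]"
  have x: "?x \<in> cube k" "?x' \<in> cube k" using k by (auto simp: cube_def)
  have "?x' \<noteq> ?x"
    by (metis in_set_conv_decomp in_set_replicate)
  moreover have "?x' \<noteq> map Not ?x"
    using k by (cases k; cases "k - 1") auto
  ultimately have "nae_fun k ?x \<noteq> nae_fun k ?x'"
    using nae_fun_eq_iff[OF x] by blast
  then have "card {nae_fun k ?x, nae_fun k ?x'} = 2" by simp
  moreover have "{nae_fun k ?x, nae_fun k ?x'} \<subseteq> clause_functions NAESAT k"
    using x unfolding clause_functions_image by blast
  ultimately show ?thesis using NAESAT by (metis card_mono finite_clause_functions)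
next
  case XORSAT
  then show ?thesis using assms by (simp add: card_XORSAT valid_arity_def del: clause_functions.simps)
qed

lemma card_violating_sum:
  assumes "finite S" "length js = k" "1 \<le> k"
  shows "(\<Sum>\<sigma>\<in>clause_functions t k. real (card (S - clause_sols js \<sigma>))) = real (card S)"
proof -
  have "(\<Sum>\<sigma>\<in>clause_functions t k. real (card (S - clause_sols js \<sigma>)))
      = (\<Sum>\<sigma>\<in>clause_functions t k. \<Sum>y\<in>S. if y \<in> clause_sols js \<sigma> then 0 else 1)"
  proof (rule sum.cong)
    fix \<sigma>
    have "{y\<in>S. y \<notin> clause_sols js \<sigma>} = S - clause_sols js \<sigma>" by auto
    then show "real (card (S - clause_sols js \<sigma>)) = (\<Sum>y\<in>S. if y \<in> clause_sols js \<sigma> then 0 else 1)"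
      using assms(1) by (simp add: sum.If_cases Int_def Diff_eq)
  qed simp
  also have "\<dots> = (\<Sum>y\<in>S. \<Sum>\<sigma>\<in>clause_functions t k. if y \<in> clause_sols js \<sigma> then 0 else 1)"
    by (rule sum.swap)
  also have "\<dots> = (\<Sum>y\<in>S. real (card {\<sigma> \<in> clause_functions t k. \<not> \<sigma> (map ((!) y) js)}))"
    by (intro sum.cong refl) (simp add: sum.If_cases clause_sols_def Int_def)
  also have "\<dots> = real (card S)"
    using card_violated[of "map ((!) _) js" k t] assms by (simp add: cube_def)
  finally show ?thesis .
qed

lemma card_split_clause:
  assumes "finite S"
  shows "real (card (S \<inter> A)) = real (card S) - real (card (S - A))"
proof -
  have "card S = card (S \<inter> A) + card (S - A)"
    using card_Un_disjoint[of "S \<inter> A" "S - A"] assms by (simp add: Int_Diff_Un Int_Diff_disjoint)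
  then show ?thesis by simp
qed

lemma edge_avg_card:
  assumes "finite S" "length js = k" "valid_arity t k"
  shows "edge_avg t k js (\<lambda>S. real (card S)) S = real (card S)"
proof -
  let ?X = "clause_functions t k"
  have "(\<Sum>\<sigma>\<in>?X. real (card (S \<inter> clause_sols js \<sigma>))) =
        real (card ?X) * real (card S) - real (card S)"
    using card_violating_sum[of S js k t] assms
    by (simp add: card_split_clause sum_subtractf valid_arity_def)
  also have "\<dots> = real (card S) * (real (card ?X) - 1)" by (simp add: algebra_simps)
  finally show ?thesis
    using card_clause_functions_ge_2[OF assms(3)] by (simp add: edge_avg_def)
qed

text \<open>
  The tangent line of \<open>w ln w\<close> at \<open>1\<close> bounds the entropy that a clause can cost.
\<close>
lemma mult_ln_lower:
  fixes w :: real
  assumes "0 \<le> w"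
  shows "w - 1 \<le> w * ln w"
proof (cases "w = 0")
  case False
  with assms have w: "0 < w" by simp
  have "ln (1 / w) \<le> 1 / w - 1" by (rule ln_le_minus_one) (use w in simp)
  then have "- ln w \<le> 1 / w - 1" using w by (simp add: ln_div)
  then have "w * (- ln w) \<le> w * (1 / w - 1)" using w by (intro mult_left_mono) auto
  also have "\<dots> = 1 - w" using w by (simp add: right_diff_distrib)
  finally show ?thesis by simp
qed simp
text \<open>
  A clause that a uniform solution violates with probability \<open>v\<close> contributes \<open>(1 - v) ln (1 - v)\<close> to
  the change of entropy. The linear part of this is split off, because its total over the
  clauses of an edge is constant and all Taylor coefficients of the remainder are nonnegative.
\<close>
definition log_loss :: "real \<Rightarrow> real" where
  "log_loss v = (1 - v) * ln (1 - v) + v"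

lemma log_loss_nonneg: "v \<le> 1 \<Longrightarrow> 0 \<le> log_loss v"
  using mult_ln_lower[of "1 - v"] by (simp add: log_loss_def)

definition violation :: "nat list \<Rightarrow> (bool list \<Rightarrow> bool) \<Rightarrow> bool list set \<Rightarrow> real" where
  "violation js \<sigma> S = real (card (S - clause_sols js \<sigma>)) / real (card S)"

lemma violation_le_1: "finite S \<Longrightarrow> violation js \<sigma> S \<le> 1"
  using card_mono[of S "S - clause_sols js \<sigma>"] by (auto simp: violation_def divide_le_eq_1 card_gt_0_iff)

lemma sum_violation:
  assumes "finite S" "S \<noteq> {}" "length js = k" "1 \<le> k"
  shows "(\<Sum>\<sigma>\<in>clause_functions t k. violation js \<sigma> S) = 1"
  using card_violating_sum[OF assms(1,3,4), of t] assms(1,2)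
  by (simp add: violation_def sum_divide_distrib[symmetric])

text \<open>
  Expand \<open>ent (S \<inter> A)\<close> with \<open>|S \<inter> A| = |S| (1 - v)\<close>; the violation probabilities \<open>v\<close> of the clauses on
  one edge add up to \<open>1\<close>. Only the sum of the losses depends on the edge, and the comparison of
  edge distributions is a comparison of its mean.
\<close>
lemma edge_avg_ent:
  assumes "finite S" "length js = k" "valid_arity t k"
  shows "edge_avg t k js ent S = ent S - real (card S) / (real (card (clause_functions t k)) - 1)
          * (1 - (\<Sum>\<sigma>\<in>clause_functions t k. log_loss (violation js \<sigma> S)))"
proof (cases "S = {}")
  case True
  then show ?thesis by (simp add: edge_avg_def ent_def)
next
  case False
  let ?X = "clause_functions t k" and ?s = "real (card S)"
  have s: "?s > 0" using False assms by (simp add: card_gt_0_iff)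
  have k: "1 \<le> k" using assms by (simp add: valid_arity_def)
  have "ent (S \<inter> clause_sols js \<sigma>) = ln ?s * real (card (S \<inter> clause_sols js \<sigma>))
      + ?s * (log_loss (violation js \<sigma> S) - violation js \<sigma> S)" for \<sigma>
  proof -
    let ?v = "violation js \<sigma> S"
    have c: "real (card (S \<inter> clause_sols js \<sigma>)) = ?s * (1 - ?v)"
      using s by (simp add: card_split_clause assms violation_def field_simps)
    show ?thesis
    proof (cases "?v = 1")
      case True
      then show ?thesis using c by (simp add: ent_def log_loss_def)
    next
      case False
      then have "1 - ?v > 0" using violation_le_1[OF assms(1), of js \<sigma>] by simp
      then have "ln (?s * (1 - ?v)) = ln ?s + ln (1 - ?v)" using s by (simp add: ln_mult)
      then show ?thesis unfolding ent_def c log_loss_def by (simp add: algebra_simps)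
    qed
  qed
  then have "(\<Sum>\<sigma>\<in>?X. ent (S \<inter> clause_sols js \<sigma>)) =
     ln ?s * (\<Sum>\<sigma>\<in>?X. real (card (S \<inter> clause_sols js \<sigma>)))
      + ?s * ((\<Sum>\<sigma>\<in>?X. log_loss (violation js \<sigma> S)) - (\<Sum>\<sigma>\<in>?X. violation js \<sigma> S))"
    by (simp add: sum.distrib sum_distrib_left sum_subtractf right_diff_distrib)
  then have "edge_avg t k js ent S = ln ?s * edge_avg t k js (\<lambda>S. real (card S)) S
      + ?s / (real (card ?X) - 1) * ((\<Sum>\<sigma>\<in>?X. log_loss (violation js \<sigma> S)) - 1)"
    using sum_violation[OF assms(1) False assms(2) k, of t]
    by (simp add: edge_avg_def add_divide_distrib)
  then show ?thesis by (simp add: edge_avg_card assms ent_def algebra_simps)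
qed

lemma edge_avg_ent_lower:
  assumes "finite S" "length js = k" "valid_arity t k"
  shows "ent S - real (card S) \<le> edge_avg t k js ent S"
proof -
  let ?X = "clause_functions t k"
  have X: "real (card ?X) - 1 \<ge> 1" using card_clause_functions_ge_2[OF assms(3)] by simp
  have "0 \<le> (\<Sum>\<sigma>\<in>?X. log_loss (violation js \<sigma> S))"
    by (intro sum_nonneg log_loss_nonneg violation_le_1 assms)
  then have "real (card S) / (real (card ?X) - 1) * (1 - (\<Sum>\<sigma>\<in>?X. log_loss (violation js \<sigma> S)))
     \<le> real (card S) / (real (card ?X) - 1) * 1"
    using X by (intro mult_left_mono) auto
  also have "\<dots> \<le> real (card S) / 1 * 1"
    using X by (intro mult_right_mono divide_left_mono) auto
  finally have "real (card S) / (real (card ?X) - 1) * (1 - (\<Sum>\<sigma>\<in>?X. log_loss (violation js \<sigma> S)))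
     \<le> real (card S)" by simp
  then show ?thesis using edge_avg_ent[OF assms] by simp
qed

text \<open>
  A planted clause keeps the hidden assignment and only shrinks the set of candidates, so it
  cannot raise the mean of a quantity that is monotone in this set.
\<close>
lemma edge_avg_card_mult_le:
  assumes "finite S" "length js = k" "valid_arity t k"
    and mono: "\<And>A B. A \<subseteq> B \<Longrightarrow> B \<subseteq> S \<Longrightarrow> A \<noteq> {} \<Longrightarrow> f A \<le> f B"
  shows "edge_avg t k js (\<lambda>S. real (card S) * f S) S \<le> real (card S) * f S"
proof -
  let ?X = "clause_functions t k"
  have "(\<Sum>\<sigma>\<in>?X. real (card (S \<inter> clause_sols js \<sigma>)) * f (S \<inter> clause_sols js \<sigma>))
     \<le> (\<Sum>\<sigma>\<in>?X. real (card (S \<inter> clause_sols js \<sigma>)) * f S)"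
  proof (rule sum_mono)
    fix \<sigma>
    show "real (card (S \<inter> clause_sols js \<sigma>)) * f (S \<inter> clause_sols js \<sigma>) \<le> real (card (S \<inter> clause_sols js \<sigma>)) * f S"
      by (cases "S \<inter> clause_sols js \<sigma> = {}") (auto intro!: mult_left_mono mono)
  qed
  then have "edge_avg t k js (\<lambda>S. real (card S) * f S) S \<le> edge_avg t k js (\<lambda>S. real (card S)) S * f S"
    using card_clause_functions_ge_2[OF assms(3)]
    by (simp add: edge_avg_def divide_right_mono sum_distrib_right)
  then show ?thesis by (simp add: edge_avg_card assms)
qed

lemma ent_eq: "ent = (\<lambda>S. real (card S) * ln (real (card S)))"
  by (simp add: fun_eq_iff ent_def)

lemma edge_avg_ent_upper:
  assumes "finite S" "length js = k" "valid_arity t k"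
  shows "edge_avg t k js ent S \<le> ent S"
  unfolding ent_eq
proof (rule edge_avg_card_mult_le[OF assms])
  fix A B assume "A \<subseteq> B" "B \<subseteq> S" "A \<noteq> {}"
  then have "finite B" using assms(1) by (meson finite_subset)
  then have "0 < card A" "card A \<le> card B" using \<open>A \<subseteq> B\<close> \<open>A \<noteq> {}\<close>
    by (auto simp: card_gt_0_iff intro: card_mono finite_subset)
  then show "ln (real (card A)) \<le> ln (real (card B))" by simp
qed

lemma edge_avg_linear:
  "edge_avg t k js (\<lambda>S. a * g S + b * h S) S = a * edge_avg t k js g S + b * edge_avg t k js h S"
  by (simp add: edge_avg_def sum.distrib sum_distrib_left[symmetric] add_divide_distrib)

lemma edge_op_linear:
  "edge_op t k D (\<lambda>S. a * g S + b * h S) S = a * edge_op t k D g S + b * edge_op t k D h S"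
  by (simp add: edge_op_def edge_avg_linear sum.distrib sum_distrib_left[symmetric] add_divide_distrib)

lemma edge_avg_commute:
  "edge_avg t k js (edge_avg t' k' js' g) S = edge_avg t' k' js' (edge_avg t k js g) S"
proof -
  have "edge_avg t k js (edge_avg t' k' js' g) S =
    (\<Sum>\<sigma>\<in>clause_functions t k. \<Sum>\<tau>\<in>clause_functions t' k'. g (S \<inter> clause_sols js \<sigma> \<inter> clause_sols js' \<tau>)) /
     ((real (card (clause_functions t' k')) - 1) * (real (card (clause_functions t k)) - 1))"
    by (simp add: edge_avg_def sum_divide_distrib[symmetric])
  also have "\<dots> = (\<Sum>\<tau>\<in>clause_functions t' k'. \<Sum>\<sigma>\<in>clause_functions t k. g (S \<inter> clause_sols js' \<tau> \<inter> clause_sols js \<sigma>)) /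
     ((real (card (clause_functions t k)) - 1) * (real (card (clause_functions t' k')) - 1))"
    by (subst sum.swap) (simp only: Int_assoc Int_commute[of "clause_sols js _"] mult.commute)
  also have "\<dots> = edge_avg t' k' js' (edge_avg t k js g) S"
    by (simp add: edge_avg_def sum_divide_distrib[symmetric])
  finally show ?thesis .
qed

lemma edge_avg_sum:
  "edge_avg t k js (\<lambda>S. (\<Sum>i\<in>D. g i S) / c) S = (\<Sum>i\<in>D. edge_avg t k js (g i) S) / c"
proof -
  have "(\<Sum>\<sigma>\<in>X. (\<Sum>i\<in>D. h i \<sigma>) / c) / d = (\<Sum>i\<in>D. (\<Sum>\<sigma>\<in>X. h i \<sigma>) / d) / c"
    for X :: "(bool list \<Rightarrow> bool) set" and h and d :: real
  proof -
    have "(\<Sum>\<sigma>\<in>X. (\<Sum>i\<in>D. h i \<sigma>) / c) / d = (\<Sum>\<sigma>\<in>X. \<Sum>i\<in>D. h i \<sigma>) / c / d"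
      by (simp only: sum_divide_distrib)
    also have "\<dots> = (\<Sum>i\<in>D. \<Sum>\<sigma>\<in>X. h i \<sigma>) / d / c"
      by (subst sum.swap) (simp add: divide_divide_eq_left mult.commute)
    also have "\<dots> = (\<Sum>i\<in>D. (\<Sum>\<sigma>\<in>X. h i \<sigma>) / d) / c"
      by (simp only: sum_divide_distrib)
    finally show ?thesis .
  qed
  then show ?thesis unfolding edge_avg_def .
qed

text \<open>
  The order in which independent clauses are revealed does not matter. This allows one kind of
  clause to be exchanged for another at any place of a sequence.
\<close>
lemma edge_op_commute:
  "edge_op t k D (edge_op t' k' D' g) = edge_op t' k' D' (edge_op t k D g)"
proof
  fix S
  let ?e = "\<lambda>js js'. edge_avg t k js (edge_avg t' k' js' g) S"
  have 1: "edge_op t k D (edge_op t' k' D' g) S =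
     (\<Sum>js\<in>D. (\<Sum>js'\<in>D'. ?e js js') / real (card D')) / real (card D)"
    unfolding edge_op_def by (simp only: edge_avg_sum)
  have 2: "edge_op t' k' D' (edge_op t k D g) S =
     (\<Sum>js'\<in>D'. (\<Sum>js\<in>D. ?e js js') / real (card D)) / real (card D')"
    unfolding edge_op_def by (simp only: edge_avg_sum edge_avg_commute[of t k])
  have "(\<Sum>js\<in>D. (\<Sum>js'\<in>D'. ?e js js') / real (card D')) / real (card D)
     = (\<Sum>js\<in>D. \<Sum>js'\<in>D'. ?e js js') / real (card D') / real (card D)"
    by (simp only: sum_divide_distrib)
  also have "\<dots> = (\<Sum>js'\<in>D'. \<Sum>js\<in>D. ?e js js') / real (card D) / real (card D')"
    by (subst sum.swap) (simp add: divide_divide_eq_left mult.commute)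
  also have "\<dots> = (\<Sum>js'\<in>D'. (\<Sum>js\<in>D. ?e js js') / real (card D)) / real (card D')"
    by (simp only: sum_divide_distrib)
  finally show "edge_op t k D (edge_op t' k' D' g) S = edge_op t' k' D' (edge_op t k D g) S"
    unfolding 1 2 .
qed




section \<open>Solution sets and the hybrid argument\<close>

definition xor3 :: "bool list \<Rightarrow> bool list \<Rightarrow> bool list \<Rightarrow> bool list" where
  "xor3 a b c = map2 (\<noteq>) a (map2 (\<noteq>) b c)"

text \<open>
  The closure properties of solution sets on which the comparison of edge distributions relies:
  a NAESAT formula is invariant under negation of the assignment, and a system of linear
  equations over the field with two elements has an affine solution set.
\<close>
fun shape :: "clause_type \<Rightarrow> bool list set \<Rightarrow> bool" where
  "shape SAT S \<longleftrightarrow> True"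
| "shape NAESAT S \<longleftrightarrow> (\<forall>y\<in>S. map Not y \<in> S)"
| "shape XORSAT S \<longleftrightarrow> (\<forall>a\<in>S. \<forall>b\<in>S. \<forall>c\<in>S. xor3 a b c \<in> S)"

definition sol_class :: "clause_type \<Rightarrow> nat \<Rightarrow> bool list set \<Rightarrow> bool" where
  "sol_class t n S \<longleftrightarrow> S \<subseteq> cube n \<and> shape t S"

lemma length_xor3: "length a = n \<Longrightarrow> length b = n \<Longrightarrow> length c = n \<Longrightarrow> length (xor3 a b c) = n"
  by (simp add: xor3_def)

lemma nth_xor3:
  "i < n \<Longrightarrow> length a = n \<Longrightarrow> length b = n \<Longrightarrow> length c = n \<Longrightarrow>
   xor3 a b c ! i = (a ! i \<noteq> (b ! i \<noteq> c ! i))"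
  by (simp add: xor3_def)

lemma xor_list_simps [simp]:
  "xor_list [] = False" "xor_list (b # z) = (b \<noteq> xor_list z)"
  by (simp_all add: xor_list_def)

lemma xor_list_xor3:
  assumes "set js \<subseteq> {..<n}" "length a = n" "length b = n" "length c = n"
  shows "xor_list (map ((!) (xor3 a b c)) js) =
    (xor_list (map ((!) a) js) \<noteq> (xor_list (map ((!) b) js) \<noteq> xor_list (map ((!) c) js)))"
  using assms(1) by (induction js) (auto simp: nth_xor3 assms(2-))

lemma map_nth_Not:
  assumes "set js \<subseteq> {..<n}" "length y = n"
  shows "map ((!) (map Not y)) js = map Not (map ((!) y) js)"
  using assms by auto

lemma sol_class_cube: "sol_class t n (cube n)"
  by (cases t) (auto simp: sol_class_def cube_def length_xor3)

lemma sol_class_finite: "sol_class t n S \<Longrightarrow> finite S"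
  unfolding sol_class_def using finite_cube finite_subset by blast

lemma sol_class_Int:
  assumes S: "sol_class t n S" and js: "set js \<subseteq> {..<n}" "length js = k"
    and \<sigma>: "\<sigma> \<in> clause_functions t k"
  shows "sol_class t n (S \<inter> clause_sols js \<sigma>)"
proof (cases t)
  case SAT
  then show ?thesis using S by (auto simp: sol_class_def)
next
  case NAESAT
  then obtain x where x: "x \<in> cube k" "\<sigma> = nae_fun k x"
    using \<sigma> by (auto simp: clause_functions_image simp del: clause_functions.simps)
  have "map Not y \<in> clause_sols js \<sigma>" if "y \<in> S" "y \<in> clause_sols js \<sigma>" for y
  proof -
    have y: "length y = n" using that S by (auto simp: sol_class_def cube_def)
    let ?z = "map ((!) y) js"
    have z: "?z \<in> cube k" using js by (simp add: cube_def)
    have "?z \<notin> {x, map Not x}" using that z by (simp add: clause_sols_def x nae_fun_def)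
    then have "map Not ?z \<notin> {x, map Not x}" by (metis insert_iff map_Not_Not singletonD)
    moreover have "map Not ?z \<in> cube k" using z by (simp add: cube_def)
    ultimately show ?thesis
      unfolding clause_sols_def x nae_fun_def mem_Collect_eq map_nth_Not[OF js(1) y] by simp
  qed
  then show ?thesis using S NAESAT by (auto simp: sol_class_def)
next
  case XORSAT
  then obtain b where b: "\<sigma> = xor_fun k b"
    using \<sigma> by (auto simp: clause_functions_image simp del: clause_functions.simps)
  have iff: "y \<in> clause_sols js \<sigma> \<longleftrightarrow> xor_list (map ((!) y) js) = b" for y
    using js by (simp add: clause_sols_def b xor_fun_def cube_def)
  have "xor3 u v w \<in> clause_sols js \<sigma>"
    if "u \<in> S" "v \<in> S" "w \<in> S" "u \<in> clause_sols js \<sigma>" "v \<in> clause_sols js \<sigma>" "w \<in> clause_sols js \<sigma>" for u v w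
  proof -
    have l: "length u = n" "length v = n" "length w = n"
      using that S by (auto simp: sol_class_def cube_def)
    show ?thesis using that(4-6) unfolding iff xor_list_xor3[OF js(1) l] by auto
  qed
  then show ?thesis using S XORSAT by (auto simp: sol_class_def)
qed

text \<open>
  The abstract properties of the operators \<open>edge_op t k D\<close> and of their iterates. The
  predicate \<open>P\<close> is a class of sets that contains all sets of candidates that occur; inequalities
  between functionals are only available there.
\<close>
definition averaging ::
  "('a set \<Rightarrow> bool) \<Rightarrow> (('a set \<Rightarrow> real) \<Rightarrow> 'a set \<Rightarrow> real) \<Rightarrow> bool" where
  "averaging P T \<longleftrightarrow>
     (\<forall>g h. (\<forall>S. P S \<longrightarrow> g S \<le> h S) \<longrightarrow> (\<forall>S. P S \<longrightarrow> T g S \<le> T h S)) \<and>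
     (\<forall>a b g h S. T (\<lambda>S. a * g S + b * h S) S = a * T g S + b * T h S) \<and>
     (\<forall>S. P S \<longrightarrow> T (\<lambda>S. real (card S)) S = real (card S))"

lemma averaging_mono:
  "averaging P T \<Longrightarrow> (\<And>S. P S \<Longrightarrow> g S \<le> h S) \<Longrightarrow> P S \<Longrightarrow> T g S \<le> T h S"
  unfolding averaging_def by blast

lemma averaging_linear:
  "averaging P T \<Longrightarrow> T (\<lambda>S. a * g S + b * h S) S = a * T g S + b * T h S"
  unfolding averaging_def by blast

lemma averaging_card:
  "averaging P T \<Longrightarrow> P S \<Longrightarrow> T (\<lambda>S. real (card S)) S = real (card S)"
  unfolding averaging_def by blast

lemma averaging_cong:
  "averaging P T \<Longrightarrow> (\<And>S. P S \<Longrightarrow> g S = h S) \<Longrightarrow> P S \<Longrightarrow> T g S = T h S"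
  by (rule antisym; rule averaging_mono[of P]) auto

lemma averaging_add: "averaging P T \<Longrightarrow> T (\<lambda>S. g S + h S) S = T g S + T h S"
  using averaging_linear[of P T 1 g 1 h S] by simp

lemma averaging_scale: "averaging P T \<Longrightarrow> T (\<lambda>S. a * g S) S = a * T g S"
  using averaging_linear[of P T a g 0 "\<lambda>_. 0" S] by simp

lemma averaging_zero: "averaging P T \<Longrightarrow> T (\<lambda>S. 0) S = 0"
  using averaging_scale[of P T 0 "\<lambda>_. 0" S] by simp

lemma averaging_sum:
  assumes "averaging P T"
  shows "T (\<lambda>S. \<Sum>i\<in>I. g i S) S = (\<Sum>i\<in>I. T (g i) S)"
proof (induction I rule: infinite_finite_induct)
  case (insert x F)
  then show ?case using averaging_add[OF assms, of "g x" "\<lambda>S. \<Sum>i\<in>F. g i S" S] by simp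
qed (auto simp: averaging_zero[OF assms])

lemma averaging_id: "averaging P id"
  by (simp add: averaging_def)

lemma averaging_comp:
  assumes "averaging P T" "averaging P T'"
  shows "averaging P (T \<circ> T')"
proof -
  have "T (T' (\<lambda>S. a * g S + b * h S)) S = a * T (T' g) S + b * T (T' h) S" for a b g h S
  proof -
    have "T' (\<lambda>S. a * g S + b * h S) = (\<lambda>S. a * T' g S + b * T' h S)"
      using averaging_linear[OF assms(2)] by blast
    then show ?thesis using averaging_linear[OF assms(1)] by simp
  qed
  moreover have "T (T' (\<lambda>S. real (card S))) S = real (card S)" if "P S" for S
    using averaging_cong[OF assms(1), of "T' (\<lambda>S. real (card S))" "\<lambda>S. real (card S)" S]
      averaging_card[OF assms(2)] averaging_card[OF assms(1)] that by simp
  moreover have "T (T' g) S \<le> T (T' h) S" if "\<And>S. P S \<Longrightarrow> g S \<le> h S" "P S" for g h S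
    by (intro averaging_mono[OF assms(1)] averaging_mono[OF assms(2)] that)
  ultimately show ?thesis unfolding averaging_def by simp
qed

lemma averaging_funpow: "averaging P T \<Longrightarrow> averaging P (T ^^ m)"
  by (induction m) (auto simp: averaging_id averaging_comp)

lemma funpow_commute_op:
  assumes "\<And>g. T (T' g) = T' (T g)"
  shows "(T ^^ m) (T' g) = T' ((T ^^ m) g)"
  by (induction m) (auto simp: assms)

text \<open>
  Replace \<open>T\<close> by \<open>T'\<close> one factor at a time. Since the operators commute, the factor to be replaced can
  be moved next to \<open>g\<close>, where the one-step comparison applies; the remaining factors are monotone
  and carry the error along.
\<close>
lemma hybrid:
  assumes T: "averaging P T" and T': "averaging P T'"
    and comm: "\<And>g. T (T' g) = T' (T g)"
    and step: "\<And>S. P S \<Longrightarrow> T g S \<le> T' g S + e S"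
    and S: "P S"
  shows "(T ^^ m) g S \<le> (T' ^^ m) g S + (\<Sum>i<m. (T ^^ i) ((T' ^^ (m - 1 - i)) e) S)"
  using S
proof (induction m arbitrary: S)
  case (Suc m)
  have T'm: "averaging P (T' ^^ m)" by (rule averaging_funpow[OF T'])
  have "(T ^^ Suc m) g S = T ((T ^^ m) g) S" by simp
  also have "\<dots> \<le> T (\<lambda>S. (T' ^^ m) g S + (\<Sum>i<m. (T ^^ i) ((T' ^^ (m - 1 - i)) e) S)) S"
    using Suc by (intro averaging_mono[OF T]) auto
  also have "\<dots> = T ((T' ^^ m) g) S + (\<Sum>i<m. T ((T ^^ i) ((T' ^^ (m - 1 - i)) e)) S)"
    by (simp add: averaging_add[OF T] averaging_sum[OF T])
  also have "T ((T' ^^ m) g) = (T' ^^ m) (T g)"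
    using funpow_commute_op[of T' T m g] comm by simp
  also have "(T' ^^ m) (T g) S \<le> (T' ^^ m) (\<lambda>S. T' g S + e S) S"
    using Suc.prems step by (intro averaging_mono[OF T'm]) auto
  also have "\<dots> = (T' ^^ Suc m) g S + (T' ^^ m) e S"
    by (simp add: averaging_add[OF T'm] funpow_swap1)
  finally have "(T ^^ Suc m) g S \<le> (T' ^^ Suc m) g S + ((T' ^^ m) e S +
      (\<Sum>i<m. T ((T ^^ i) ((T' ^^ (m - 1 - i)) e)) S))" by simp
  then show ?case by (subst sum.lessThan_Suc_shift) simp
qed simp

lemma hybrid_const:
  assumes T: "averaging P T" and T': "averaging P T'"
    and comm: "\<And>g. T (T' g) = T' (T g)"
    and step: "\<And>S. P S \<Longrightarrow> T g S \<le> T' g S + c * real (card S)"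
    and S: "P S"
  shows "(T ^^ m) g S \<le> (T' ^^ m) g S + real m * c * real (card S)"
proof -
  have "(T ^^ i) ((T' ^^ j) (\<lambda>S. c * real (card S))) S = c * real (card S)" for i j
  proof -
    have "averaging P ((T ^^ i) \<circ> (T' ^^ j))"
      by (intro averaging_comp averaging_funpow T T')
    from averaging_scale[OF this, of c "\<lambda>S. real (card S)" S] averaging_card[OF this S]
    show ?thesis by simp
  qed
  then show ?thesis using hybrid[OF T T' comm step S, of m] by (simp add: algebra_simps)
qed

definition edge_set :: "nat \<Rightarrow> nat \<Rightarrow> nat list set \<Rightarrow> bool" where
  "edge_set n k D \<longleftrightarrow> finite D \<and> D \<noteq> {} \<and> (\<forall>js\<in>D. length js = k \<and> set js \<subseteq> {..<n})"

lemma edge_set_card_pos: "edge_set n k D \<Longrightarrow> real (card D) > 0"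
  by (simp add: edge_set_def card_gt_0_iff)

lemma edge_op_const:
  assumes "edge_set n k D" "\<And>js. js \<in> D \<Longrightarrow> edge_avg t k js g S = c"
  shows "edge_op t k D g S = c"
  using edge_set_card_pos[OF assms(1)] assms(2) by (simp add: edge_op_def)

lemma edge_op_le:
  assumes "edge_set n k D" "\<And>js. js \<in> D \<Longrightarrow> edge_avg t k js g S \<le> c"
  shows "edge_op t k D g S \<le> c"
  using edge_set_card_pos[OF assms(1)] sum_bounded_above[of D "\<lambda>js. edge_avg t k js g S" c, OF assms(2)]
  by (simp add: edge_op_def field_simps)

lemma edge_op_ge:
  assumes "edge_set n k D" "\<And>js. js \<in> D \<Longrightarrow> c \<le> edge_avg t k js g S"
  shows "c \<le> edge_op t k D g S"
  using edge_set_card_pos[OF assms(1)] sum_bounded_below[of D c "\<lambda>js. edge_avg t k js g S", OF assms(2)]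
  by (simp add: edge_op_def field_simps)

lemma averaging_edge_op:
  assumes "valid_arity t k" "edge_set n k D"
  shows "averaging (sol_class t n) (edge_op t k D)"
proof -
  have "edge_op t k D g S \<le> edge_op t k D h S"
    if gh: "\<forall>S. sol_class t n S \<longrightarrow> g S \<le> h S" and S: "sol_class t n S" for g h S
  proof -
    have "edge_avg t k js g S \<le> edge_avg t k js h S" if "js \<in> D" for js
      unfolding edge_avg_def
      using gh S that assms card_clause_functions_ge_2[OF assms(1)]
      by (intro divide_right_mono sum_mono) (auto simp: edge_set_def intro!: sol_class_Int)
    then show ?thesis unfolding edge_op_def
      by (intro divide_right_mono sum_mono) auto
  qed
  moreover have "edge_op t k D (\<lambda>S. real (card S)) S = real (card S)" if "sol_class t n S" for S
    using assms that
    by (intro edge_op_const[OF assms(2)] edge_avg_card) (auto simp: edge_set_def sol_class_finite)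
  ultimately show ?thesis unfolding averaging_def using edge_op_linear by blast
qed

lemma edge_op_ent_bounds:
  assumes "valid_arity t k" "edge_set n k D" "finite S"
  shows "ent S - real (card S) \<le> edge_op t k D ent S" "edge_op t k D ent S \<le> ent S"
  using assms by (auto simp: edge_set_def intro!: edge_op_ge[OF assms(2)] edge_op_le[OF assms(2)]
      edge_avg_ent_lower edge_avg_ent_upper)

text \<open>
  The larger this sum, the smaller the drop of entropy caused by a random planted clause on the
  edge; the drop is \<open>1 - log_gain\<close> up to normalization.
\<close>
definition log_gain :: "clause_type \<Rightarrow> nat \<Rightarrow> nat list \<Rightarrow> bool list set \<Rightarrow> real" where
  "log_gain t k js S = (\<Sum>\<sigma>\<in>clause_functions t k. log_loss (violation js \<sigma> S))"

lemma edge_op_ent: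
  assumes "valid_arity t k" "edge_set n k D" "finite S"
  shows "edge_op t k D ent S = ent S - real (card S) / (real (card (clause_functions t k)) - 1)
          * (1 - (\<Sum>js\<in>D. log_gain t k js S) / real (card D))"
proof -
  have d: "real (card D) > 0" by (rule edge_set_card_pos[OF assms(2)])
  have "(\<Sum>js\<in>D. edge_avg t k js ent S) = (\<Sum>js\<in>D. ent S - real (card S) / (real (card (clause_functions t k)) - 1)
          * (1 - log_gain t k js S))"
    using assms by (intro sum.cong) (auto simp: edge_avg_ent log_gain_def edge_set_def simp del: clause_functions.simps)
  also have "\<dots> = real (card D) * ent S - real (card S) / (real (card (clause_functions t k)) - 1)
          * (real (card D) - (\<Sum>js\<in>D. log_gain t k js S))"
    by (simp add: sum_subtractf flip: sum_distrib_left sum_divide_distrib)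
  finally have "(\<Sum>js\<in>D. edge_avg t k js ent S) = real (card D) * (ent S - real (card S) / (real (card (clause_functions t k)) - 1)
          * (1 - (\<Sum>js\<in>D. log_gain t k js S) / real (card D)))"
    using d by (simp add: right_diff_distrib)
  then show ?thesis using d by (simp add: edge_op_def)
qed




section \<open>Edges within blocks of variables\<close>

definition all_edges :: "nat \<Rightarrow> nat set \<Rightarrow> nat list set" where
  "all_edges k U = {js. set js \<subseteq> U \<and> length js = k}"

definition block :: "nat \<Rightarrow> nat \<Rightarrow> nat set" where
  "block l b = {b * l..<Suc b * l}"

definition block_edges :: "nat \<Rightarrow> nat \<Rightarrow> nat \<Rightarrow> nat list set" where
  "block_edges k q l = (\<Union>b<q. all_edges k (block l b))"

lemma finite_all_edges: "finite U \<Longrightarrow> finite (all_edges k U)"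
  unfolding all_edges_def by (rule finite_lists_length_eq)

lemma card_all_edges: "finite U \<Longrightarrow> card (all_edges k U) = card U ^ k"
  unfolding all_edges_def by (rule card_lists_length_eq)

lemma card_block [simp]: "card (block l b) = l"
  by (simp add: block_def)

lemma finite_block [simp]: "finite (block l b)"
  by (simp add: block_def)

lemma in_block_iff: "0 < l \<Longrightarrow> i \<in> block l b \<longleftrightarrow> i div l = b"
proof -
  assume "0 < l"
  then have "i div l = b \<longleftrightarrow> b * l \<le> i \<and> i < Suc b * l"
    by (metis div_less_iff_less_mult less_Suc_eq_le less_eq_div_iff_mult_less_eq order_antisym order_refl)
  then show ?thesis by (auto simp: block_def)
qed

lemma block_disjoint: "b \<noteq> c \<Longrightarrow> block l b \<inter> block l c = {}"
  by (cases "l = 0") (auto simp: in_block_iff, auto simp: block_def)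

lemma Union_block: "(\<Union>b<q. block l b) = {..<q * l}"
proof (cases "l = 0")
  case False
  then show ?thesis by (auto simp: in_block_iff less_mult_imp_div_less div_less_iff_less_mult)
qed (auto simp: block_def)

lemma sum_block: "(\<Sum>v<q * l. f v) = (\<Sum>b<q. \<Sum>v\<in>block l b. f v :: real)"
  unfolding Union_block[symmetric]
  by (rule sum.UNION_disjoint) (auto dest: block_disjoint)

lemma all_edges_disjoint:
  assumes "1 \<le> k" "U \<inter> W = {}"
  shows "all_edges k U \<inter> all_edges k W = {}"
proof -
  have False if "js \<in> all_edges k U" "js \<in> all_edges k W" for js
    using that assms by (cases js) (auto simp: all_edges_def)
  then show ?thesis by blast
qed

lemma sum_block_edges:
  assumes "1 \<le> k"
  shows "(\<Sum>js\<in>block_edges k q l. f js) = (\<Sum>b<q. \<Sum>js\<in>all_edges k (block l b). f js :: real)"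
  unfolding block_edges_def
  by (rule sum.UNION_disjoint) (simp_all add: finite_all_edges all_edges_disjoint[OF assms block_disjoint])

lemma card_block_edges:
  assumes "1 \<le> k"
  shows "real (card (block_edges k q l)) = real q * real l ^ k"
  using sum_block_edges[OF assms, of "\<lambda>_. 1" q l] by (simp add: card_all_edges)

lemma block_edges_subset: "block_edges k q l \<subseteq> all_edges k {..<q * l}"
  unfolding block_edges_def all_edges_def Union_block[symmetric] by blast

lemma edge_set_all_edges:
  assumes "finite U" "U \<noteq> {}" "U \<subseteq> {..<n}"
  shows "edge_set n k (all_edges k U)"
proof -
  have "0 < card (all_edges k U)" using assms by (simp add: card_all_edges card_gt_0_iff)
  then have "finite (all_edges k U)" "all_edges k U \<noteq> {}" unfolding card_gt_0_iff by blast+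
  then show ?thesis using assms(3) by (auto simp: edge_set_def all_edges_def)
qed

lemma edge_set_subset:
  assumes "edge_set n k D" "D' \<subseteq> D" "D' \<noteq> {}"
  shows "edge_set n k D'"
  using assms finite_subset unfolding edge_set_def by blast

lemma edge_set_block_edges:
  assumes "0 < q" "0 < l" "q * l \<le> n"
  shows "edge_set n k (block_edges k q l)"
proof -
  have "block l 0 \<noteq> {}" "block l 0 \<subseteq> {..<l}" using assms(2) by (auto simp: block_def)
  then have "all_edges k (block l 0) \<noteq> {}"
    using edge_set_all_edges[of "block l 0" l k] unfolding edge_set_def by simp
  then have ne: "block_edges k q l \<noteq> {}" using assms(1) unfolding block_edges_def by blast
  have "edge_set n k (all_edges k {..<q * l})"
    using assms by (intro edge_set_all_edges) (auto simp: lessThan_empty_iff)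
  then show ?thesis by (rule edge_set_subset[OF _ block_edges_subset ne])
qed

section \<open>Convexity for SAT and NAESAT\<close>

text \<open>
  The Taylor coefficients of \<open>log_loss\<close> at \<open>0\<close>.
\<close>
definition loss_coeff :: "nat \<Rightarrow> real" where
  "loss_coeff j = 1 / (real (Suc j) * real (Suc (Suc j)))"

lemma log_loss_sums:
  assumes "0 \<le> v" "v \<le> 1"
  shows "(\<lambda>j. loss_coeff j * v ^ Suc (Suc j)) sums log_loss v"
proof (cases "v = 1")
  case True
  \<comment> \<open>At the boundary of the disc of convergence the series telescopes.\<close>
  have "(\<lambda>j. 1 / real (Suc j)) \<longlonglongrightarrow> 0"
    by (rule LIMSEQ_inverse_real_of_nat[unfolded inverse_eq_divide])
  from telescope_sums'[OF this]
  have "(\<lambda>j. 1 / real (Suc j) - 1 / real (Suc (Suc j))) sums 1" by simp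
  moreover have "1 / real (Suc j) - 1 / real (Suc (Suc j)) = loss_coeff j" for j
    unfolding loss_coeff_def by (subst diff_divide_eq_iff) (auto simp: divide_simps)
  ultimately show ?thesis using True by (simp add: log_loss_def)
next
  case False
  with assms have "\<bar>- v\<bar> < 1" by simp
  from ln_series'[OF this] have "(\<lambda>j. - (v ^ j / real j)) sums ln (1 - v)" by simp
  then have ln: "(\<lambda>j. v ^ j / real j) sums - ln (1 - v)" using sums_minus by fastforce
  then have a: "(\<lambda>j. v ^ Suc j / real (Suc j)) sums - ln (1 - v)"
    by (subst sums_Suc_iff) simp
  then have b: "(\<lambda>j. v ^ Suc (Suc j) / real (Suc (Suc j))) sums (- ln (1 - v) - v)"
    by (subst sums_Suc_iff) simp
  \<comment> \<open>\<open>- ln (1 - v)\<close> is a power series; multiply it by \<open>v\<close>, and subtract it without its linear term.\<close>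
  have "(\<lambda>j. v * (v ^ Suc j / real (Suc j)) - v ^ Suc (Suc j) / real (Suc (Suc j))) sums
      (v * (- ln (1 - v)) - (- ln (1 - v) - v))"
    by (intro sums_diff sums_mult a b)
  moreover have "v * (v ^ Suc j / real (Suc j)) - v ^ Suc (Suc j) / real (Suc (Suc j)) = loss_coeff j * v ^ Suc (Suc j)" for j
  proof -
    have "v * (x / a) - (v * x) / b = 1 / (a * b) * (v * x)" if "b = a + 1" "a > 0" for x a b :: real
      using that by (simp add: field_simps)
    from this[of "real (Suc (Suc j))" "real (Suc j)" "v ^ Suc j"] show ?thesis
      by (simp add: loss_coeff_def)
  qed
  ultimately show ?thesis by (simp add: log_loss_def algebra_simps)
qed

definition agree :: "nat list \<Rightarrow> bool list \<Rightarrow> bool list set \<Rightarrow> nat" where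
  "agree js x S = card {y \<in> S. map ((!) y) js = x}"

definition common_literals :: "nat set \<Rightarrow> bool list list \<Rightarrow> (nat \<times> bool) set" where
  "common_literals U ys = {(v, b). v \<in> U \<and> (\<forall>y\<in>set ys. y ! v = b)}"

text \<open>
  An edge together with the values that it is to read is a list of \<open>k\<close> literals. The assignments
  \<open>ys\<close> agree on all of these values if and only if every literal is common to them.
\<close>
lemma card_common_edges:
  assumes "finite U"
  shows "card {(js, x). js \<in> all_edges k U \<and> x \<in> cube k \<and> (\<forall>y\<in>set ys. map ((!) y) js = x)}
    = card (common_literals U ys) ^ k" (is "card ?A = _")
proof -
  let ?W = "common_literals U ys"
  have "bij_betw (\<lambda>(js, x). zip js x) ?A {zs. set zs \<subseteq> ?W \<and> length zs = k}"
  proof (rule bij_betw_byWitness[where f' = "\<lambda>zs. (map fst zs, map snd zs)"])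
    show "(\<lambda>(js, x). zip js x) ` ?A \<subseteq> {zs. set zs \<subseteq> ?W \<and> length zs = k}"
    proof clarsimp
      fix js x assume js: "js \<in> all_edges k U" "x \<in> cube k" "\<forall>y\<in>set ys. map ((!) y) js = x"
      then have l: "length js = k" "length x = k" by (auto simp: all_edges_def cube_def)
      have "(v, b) \<in> ?W" if "(v, b) \<in> set (zip js x)" for v b
      proof -
        obtain i where i: "i < k" "v = js ! i" "b = x ! i"
          using \<open>(v, b) \<in> set (zip js x)\<close> l by (auto simp: set_zip)
        have "y ! v = b" if "y \<in> set ys" for y
          using js(3) that i l by (metis nth_map)
        moreover have "v \<in> U" using js(1) i l by (auto simp: all_edges_def)
        ultimately show ?thesis by (simp add: common_literals_def)
      qed
      then show "set (zip js x) \<subseteq> ?W \<and> min (length js) (length x) = k" using l by auto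
    qed
    show "(\<lambda>zs. (map fst zs, map snd zs)) ` {zs. set zs \<subseteq> ?W \<and> length zs = k} \<subseteq> ?A"
      by (fastforce simp: all_edges_def cube_def common_literals_def)
  qed (auto simp: all_edges_def cube_def zip_map_fst_snd)
  then have "card ?A = card {zs. set zs \<subseteq> ?W \<and> length zs = k}" by (rule bij_betw_same_card)
  also have "finite ?W" by (rule finite_subset[of _ "U \<times> UNIV"]) (auto simp: common_literals_def assms)
  then have "card {zs. set zs \<subseteq> ?W \<and> length zs = k} = card ?W ^ k" by (rule card_lists_length_eq)
  finally show ?thesis .
qed

text \<open>
  The \<open>j\<close>-th power of a number of solutions counts \<open>j\<close>-tuples of solutions (replicas). For fixed
  replicas the entries of the edge are independent, and the sum becomes the \<open>k\<close>-th power of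
  the number of common literals.
\<close>
lemma sum_agree_power:
  assumes "finite U" "finite S"
  shows "(\<Sum>js\<in>all_edges k U. \<Sum>x\<in>cube k. real (agree js x S) ^ j) =
    (\<Sum>ys | set ys \<subseteq> S \<and> length ys = j. real (card (common_literals U ys)) ^ k)"
proof -
  let ?R = "{ys. set ys \<subseteq> S \<and> length ys = j}" and ?E = "all_edges k U \<times> cube k"
  have R: "finite ?R" using assms by (intro finite_lists_length_eq)
  have E: "finite ?E" using assms by (simp add: finite_all_edges)
  let ?ind = "\<lambda>e ys. if \<forall>y\<in>set ys. map ((!) y) (fst e) = snd e then 1 else (0::real)"
  have 1: "real (agree (fst e) (snd e) S) ^ j = (\<Sum>ys\<in>?R. ?ind e ys)" for e
  proof -
    have "agree (fst e) (snd e) S ^ j =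
      card {ys. set ys \<subseteq> {y \<in> S. map ((!) y) (fst e) = snd e} \<and> length ys = j}"
      unfolding agree_def using assms(2) by (subst card_lists_length_eq) auto
    also have "{ys. set ys \<subseteq> {y \<in> S. map ((!) y) (fst e) = snd e} \<and> length ys = j}
        = ?R \<inter> {ys. \<forall>y\<in>set ys. map ((!) y) (fst e) = snd e}" by auto
    finally show ?thesis using R by (simp add: sum.If_cases flip: of_nat_power)
  qed
  have 2: "(\<Sum>e\<in>?E. ?ind e ys) = real (card (common_literals U ys)) ^ k" for ys
  proof -
    have "?E \<inter> {e. \<forall>y\<in>set ys. map ((!) y) (fst e) = snd e} =
        {(js, x). js \<in> all_edges k U \<and> x \<in> cube k \<and> (\<forall>y\<in>set ys. map ((!) y) js = x)}" by auto
    then show ?thesis using E card_common_edges[OF assms(1), of k ys]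
      by (simp add: sum.If_cases flip: of_nat_power)
  qed
  have "(\<Sum>js\<in>all_edges k U. \<Sum>x\<in>cube k. real (agree js x S) ^ j)
      = (\<Sum>e\<in>?E. real (agree (fst e) (snd e) S) ^ j)"
    by (simp add: sum.cartesian_product case_prod_unfold)
  also have "\<dots> = (\<Sum>e\<in>?E. \<Sum>ys\<in>?R. ?ind e ys)" by (simp only: 1)
  also have "\<dots> = (\<Sum>ys\<in>?R. \<Sum>e\<in>?E. ?ind e ys)" by (rule sum.swap)
  finally show ?thesis by (simp only: 2)
qed

lemma convex_on_power_nonneg: "convex_on {0::real..} (\<lambda>x. x ^ k)"
  by (cases "even k")
    (auto intro: convex_power_odd convex_on_subset[OF convex_power_even])

lemma power_mean:
  assumes "0 < q" "\<And>b. b < q \<Longrightarrow> 0 \<le> z b"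
  shows "((\<Sum>b<q. z b) / real q) ^ k \<le> (\<Sum>b<q. z b ^ k) / real q"
proof -
  have "(\<Sum>b<q. (1 / real q) *\<^sub>R z b) ^ k \<le> (\<Sum>b<q. (1 / real q) * z b ^ k)"
    by (rule convex_on_sum[OF _ _ convex_on_power_nonneg]) (use assms in auto)
  then show ?thesis by (simp add: sum_divide_distrib)
qed

lemma card_common_literals:
  "finite U \<Longrightarrow> real (card (common_literals U ys)) = (\<Sum>v\<in>U. real (card {b. \<forall>y\<in>set ys. y ! v = b}))"
proof -
  assume "finite U"
  have "common_literals U ys = (SIGMA v:U. {b. \<forall>y\<in>set ys. y ! v = b})"
    by (auto simp: common_literals_def)
  with \<open>finite U\<close> show ?thesis by simp
qed

text \<open>
  For fixed replicas, the fraction of common literals among all variables is the mean of the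
  fractions within the blocks. These are nonnegative, so that convexity of the \<open>k\<close>-th power applies
  for every \<open>k\<close>, odd or even.
\<close>
lemma agree_power_interpolation:
  assumes "finite S" "0 < q" "0 < l" "1 \<le> k"
  shows "(\<Sum>js\<in>all_edges k {..<q * l}. \<Sum>x\<in>cube k. real (agree js x S) ^ j) / real (card (all_edges k {..<q * l}))
    \<le> (\<Sum>js\<in>block_edges k q l. \<Sum>x\<in>cube k. real (agree js x S) ^ j) / real (card (block_edges k q l))"
proof -
  let ?R = "{ys. set ys \<subseteq> S \<and> length ys = j}"
  let ?a = "\<lambda>U ys. real (card (common_literals U ys))"
  have pt: "?a {..<q * l} ys ^ k / real (q * l) ^ k \<le> (\<Sum>b<q. ?a (block l b) ys ^ k) / (real q * real l ^ k)" for ys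
  proof -
    have "?a {..<q * l} ys = (\<Sum>b<q. ?a (block l b) ys)"
      by (simp add: card_common_literals sum_block)
    then have "?a {..<q * l} ys ^ k / real (q * l) ^ k = ((\<Sum>b<q. ?a (block l b) ys) / real q) ^ k / real l ^ k"
      by (simp add: power_divide power_mult_distrib)
    also have "\<dots> \<le> (\<Sum>b<q. ?a (block l b) ys ^ k) / real q / real l ^ k"
      by (intro divide_right_mono power_mean) (use assms in auto)
    finally show ?thesis by simp
  qed
  have "(\<Sum>js\<in>all_edges k {..<q * l}. \<Sum>x\<in>cube k. real (agree js x S) ^ j) / real (card (all_edges k {..<q * l}))
     = (\<Sum>ys\<in>?R. ?a {..<q * l} ys ^ k / real (q * l) ^ k)"
    by (simp add: sum_agree_power assms card_all_edges sum_divide_distrib)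
  also have "\<dots> \<le> (\<Sum>ys\<in>?R. (\<Sum>b<q. ?a (block l b) ys ^ k) / (real q * real l ^ k))"
    by (intro sum_mono pt)
  also have "\<dots> = (\<Sum>ys\<in>?R. \<Sum>b<q. ?a (block l b) ys ^ k) / (real q * real l ^ k)"
    by (simp only: sum_divide_distrib)
  also have "(\<Sum>ys\<in>?R. \<Sum>b<q. ?a (block l b) ys ^ k) = (\<Sum>b<q. \<Sum>ys\<in>?R. ?a (block l b) ys ^ k)"
    by (rule sum.swap)
  also have "\<dots> = (\<Sum>js\<in>block_edges k q l. \<Sum>x\<in>cube k. real (agree js x S) ^ j)"
    by (simp only: sum_agree_power[OF finite_block assms(1)] sum_block_edges[OF assms(4)])
  finally show ?thesis by (simp only: card_block_edges[OF assms(4)])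
qed

text \<open>
  Sum the comparison of powers over the Taylor series of \<open>log_loss\<close>, whose coefficients are
  nonnegative.
\<close>
lemma log_loss_interpolation:
  assumes "finite S" "0 < q" "0 < l" "1 \<le> k" "0 \<le> a"
    and le1: "\<And>js x. js \<in> all_edges k {..<q * l} \<Longrightarrow> x \<in> cube k \<Longrightarrow> a * real (agree js x S) \<le> 1"
  shows "(\<Sum>js\<in>all_edges k {..<q * l}. \<Sum>x\<in>cube k. log_loss (a * real (agree js x S))) / real (card (all_edges k {..<q * l}))
    \<le> (\<Sum>js\<in>block_edges k q l. \<Sum>x\<in>cube k. log_loss (a * real (agree js x S))) / real (card (block_edges k q l))"
proof -
  have sums: "(\<lambda>j. (\<Sum>js\<in>D. \<Sum>x\<in>cube k. loss_coeff j * (a * real (agree js x S)) ^ Suc (Suc j)) / c) sums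
      ((\<Sum>js\<in>D. \<Sum>x\<in>cube k. log_loss (a * real (agree js x S))) / c)"
    if "D \<subseteq> all_edges k {..<q * l}" for D c
    by (intro sums_divide sums_sum log_loss_sums le1) (use that assms in auto)
  have eq: "(\<Sum>js\<in>D. \<Sum>x\<in>cube k. loss_coeff j * (a * real (agree js x S)) ^ Suc (Suc j)) / c
     = loss_coeff j * a ^ Suc (Suc j) * ((\<Sum>js\<in>D. \<Sum>x\<in>cube k. real (agree js x S) ^ Suc (Suc j)) / c)" for D c j
    by (simp only: power_mult_distrib sum_distrib_left mult.assoc times_divide_eq_right)
  show ?thesis
  proof (rule sums_le[OF _ sums sums])
    fix j
    show "(\<Sum>js\<in>all_edges k {..<q * l}. \<Sum>x\<in>cube k. loss_coeff j * (a * real (agree js x S)) ^ Suc (Suc j)) / real (card (all_edges k {..<q * l}))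
      \<le> (\<Sum>js\<in>block_edges k q l. \<Sum>x\<in>cube k. loss_coeff j * (a * real (agree js x S)) ^ Suc (Suc j)) / real (card (block_edges k q l))"
      unfolding eq using assms(5)
      by (intro mult_left_mono agree_power_interpolation assms) (simp add: loss_coeff_def)
  qed (auto simp: block_edges_subset)
qed

lemma violation_SAT:
  assumes "length js = k" "x \<in> cube k"
  shows "violation js (sat_fun k x) S = real (agree js x S) / real (card S)"
proof -
  have "S - clause_sols js (sat_fun k x) = {y \<in> S. map ((!) y) js = x}"
    using assms by (auto simp: clause_sols_def sat_fun_def cube_def)
  then show ?thesis by (simp add: violation_def agree_def)
qed

lemma log_gain_SAT:
  assumes "length js = k"
  shows "log_gain SAT k js S = (\<Sum>x\<in>cube k. log_loss (1 / real (card S) * real (agree js x S)))"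
proof -
  have "inj_on (sat_fun k) (cube k)"
    by (auto simp: inj_on_def sat_fun_def fun_eq_iff restrict_def split: if_splits)
  then show ?thesis unfolding log_gain_def clause_functions_image
    by (simp add: sum.reindex violation_SAT[OF assms])
qed

text \<open>
  Negation maps the solutions that read \<open>x\<close> on the edge to those that read the negation of \<open>x\<close>. Hence
  both values violating the clause are equally frequent, and NAESAT reduces to the count for SAT.
\<close>
lemma violation_NAESAT:
  assumes "length js = k" "x \<in> cube k" "1 \<le> k" "sol_class NAESAT n S" "set js \<subseteq> {..<n}"
  shows "violation js (nae_fun k x) S = 2 / real (card S) * real (agree js x S)"
proof -
  let ?A = "\<lambda>x. {y \<in> S. map ((!) y) js = x}"
  have S: "finite S" "\<And>y. y \<in> S \<Longrightarrow> length y = n" "\<And>y. y \<in> S \<Longrightarrow> map Not y \<in> S"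
    using sol_class_finite[OF assms(4)] assms(4) by (auto simp: sol_class_def cube_def)
  have "bij_betw (map Not) (?A x) (?A (map Not x))"
    by (rule bij_betw_byWitness[where f' = "map Not"])
      (auto simp: S map_nth_Not[OF assms(5) S(2)] o_def simp del: map_map)
  from bij_betw_same_card[OF this] have flip: "card (?A (map Not x)) = card (?A x)" by (rule sym)
  have "S - clause_sols js (nae_fun k x) = ?A x \<union> ?A (map Not x)"
    using assms by (auto simp: clause_sols_def nae_fun_def cube_def)
  also have "card \<dots> = card (?A x) + card (?A (map Not x))"
    using S(1) map_Not_neq[OF assms(2,3)] by (intro card_Un_disjoint) auto
  also have "\<dots> = 2 * card (?A x)" by (simp only: flip)
  finally show ?thesis by (simp add: violation_def agree_def)
qed

lemma log_gain_NAESAT: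
  assumes "length js = k" "1 \<le> k" "sol_class NAESAT n S" "set js \<subseteq> {..<n}"
  shows "log_gain NAESAT k js S = (\<Sum>x\<in>cube k. log_loss (2 / real (card S) * real (agree js x S))) / 2"
proof -
  \<comment> \<open>Every clause function arises from \<open>x\<close> and from its negation, whence the factor 1/2.\<close>
  have "(\<Sum>x\<in>cube k. log_loss (violation js (nae_fun k x) S)) =
     (\<Sum>\<sigma>\<in>nae_fun k ` cube k. \<Sum>x | x \<in> cube k \<and> nae_fun k x = \<sigma>. log_loss (violation js (nae_fun k x) S))"
    by (rule sum.image_gen[OF finite_cube])
  also have "\<dots> = (\<Sum>\<sigma>\<in>nae_fun k ` cube k. 2 * log_loss (violation js \<sigma> S))"
  proof (rule sum.cong)
    fix \<sigma> assume "\<sigma> \<in> nae_fun k ` cube k"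
    then obtain x where x: "x \<in> cube k" "\<sigma> = nae_fun k x" by blast
    have "{x'. x' \<in> cube k \<and> nae_fun k x' = \<sigma>} = {x, map Not x}"
    proof (intro set_eqI iffI)
      fix z assume "z \<in> {x'. x' \<in> cube k \<and> nae_fun k x' = \<sigma>}"
      then have z: "z \<in> cube k" "nae_fun k x = nae_fun k z" using x(2) by simp_all
      then show "z \<in> {x, map Not x}" using nae_fun_eq_iff[OF x(1) z(1)] by blast
    next
      fix z assume z: "z \<in> {x, map Not x}"
      then have zc: "z \<in> cube k" using x(1) by auto
      have "nae_fun k x = nae_fun k z" using nae_fun_eq_iff[OF x(1) zc] z by blast
      then show "z \<in> {x'. x' \<in> cube k \<and> nae_fun k x' = \<sigma>}" using zc x(2) by simp
    qed
    then have "card {x'. x' \<in> cube k \<and> nae_fun k x' = \<sigma>} = 2"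
      using map_Not_neq[OF x(1) assms(2)] by auto
    then show "(\<Sum>x | x \<in> cube k \<and> nae_fun k x = \<sigma>. log_loss (violation js (nae_fun k x) S)) = 2 * log_loss (violation js \<sigma> S)"
      by simp
  qed simp
  finally show ?thesis
    unfolding log_gain_def clause_functions_image
    by (simp add: violation_NAESAT[OF assms(1) _ assms(2-4)] flip: sum_distrib_left)
qed

lemma edge_op_ent_le:
  assumes "valid_arity t k" "edge_set n k D" "edge_set n k D'" "finite S"
    and le: "(\<Sum>js\<in>D. log_gain t k js S) / real (card D)
      \<le> (\<Sum>js\<in>D'. log_gain t k js S) / real (card D') + e"
  shows "edge_op t k D ent S \<le> edge_op t k D' ent S
      + real (card S) / (real (card (clause_functions t k)) - 1) * e"
proof -
  let ?c = "real (card S) / (real (card (clause_functions t k)) - 1)"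
  have "?c \<ge> 0" using card_clause_functions_ge_2[OF assms(1)] by simp
  from mult_left_mono[OF le this] show ?thesis
    unfolding edge_op_ent[OF assms(1,2,4)] edge_op_ent[OF assms(1,3,4)]
    by (simp add: algebra_simps)
qed

text \<open>
  A random clause on all variables costs at least as much entropy as a random clause inside a
  random block.
\<close>
lemma ent_interpolation_SAT_NAESAT:
  assumes t: "t = SAT \<or> t = NAESAT" and k: "valid_arity t k"
    and "0 < q" "0 < l" "q * l \<le> n" "sol_class t n S"
  shows "edge_op t k (all_edges k {..<q * l}) ent S \<le> edge_op t k (block_edges k q l) ent S"
proof -
  let ?D = "all_edges k {..<q * l}" and ?D' = "block_edges k q l"
  have D: "edge_set n k ?D" using assms by (intro edge_set_all_edges) (auto simp: lessThan_empty_iff)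
  have D': "edge_set n k ?D'" using assms by (intro edge_set_block_edges) auto
  have S: "finite S" using assms by (simp add: sol_class_finite)
  have k1: "1 \<le> k" using k by (simp add: valid_arity_def)
  have "(\<Sum>js\<in>?D. log_gain t k js S) / real (card ?D) \<le> (\<Sum>js\<in>?D'. log_gain t k js S) / real (card ?D') + 0"
    using t
  proof
    assume t: "t = SAT"
    have "1 / real (card S) * real (agree js x S) \<le> 1" if "js \<in> ?D" "x \<in> cube k" for js x
      using violation_SAT[of js k x S] that violation_le_1[OF S, of js "sat_fun k x"] by (simp add: all_edges_def)
    from log_loss_interpolation[OF S assms(3,4) k1 _ this]
    show ?thesis using D D' by (simp add: t log_gain_SAT edge_set_def cong: sum.cong)
  next
    assume t: "t = NAESAT"
    have sub: "set js \<subseteq> {..<n}" "length js = k" if "js \<in> ?D" for js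
      using that assms(5) by (auto simp: all_edges_def)
    have S': "sol_class NAESAT n S" using assms t by simp
    have "2 / real (card S) * real (agree js x S) \<le> 1" if "js \<in> ?D" "x \<in> cube k" for js x
      using violation_NAESAT[OF sub(2)[OF that(1)] that(2) k1 S' sub(1)[OF that(1)]]
        violation_le_1[OF S, of js "nae_fun k x"] by simp
    from log_loss_interpolation[OF S assms(3,4) k1 _ this]
    have le: "(\<Sum>js\<in>?D. \<Sum>x\<in>cube k. log_loss (2 / real (card S) * real (agree js x S))) / real (card ?D)
      \<le> (\<Sum>js\<in>?D'. \<Sum>x\<in>cube k. log_loss (2 / real (card S) * real (agree js x S))) / real (card ?D')" by simp
    have eq: "(\<Sum>js\<in>E. log_gain t k js S) / real (card E) =
       (\<Sum>js\<in>E. \<Sum>x\<in>cube k. log_loss (2 / real (card S) * real (agree js x S))) / real (card E) / 2"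
      if "E \<subseteq> ?D" for E
    proof -
      have "(\<Sum>js\<in>E. log_gain t k js S) = (\<Sum>js\<in>E. (\<Sum>x\<in>cube k. log_loss (2 / real (card S) * real (agree js x S))) / 2)"
        using that sub by (intro sum.cong refl) (auto simp: t log_gain_NAESAT[OF _ k1 S'])
      also have "\<dots> = (\<Sum>js\<in>E. \<Sum>x\<in>cube k. log_loss (2 / real (card S) * real (agree js x S))) / 2"
        by (simp only: sum_divide_distrib)
      finally show ?thesis by (simp only: divide_divide_eq_left mult.commute)
    qed
    show ?thesis unfolding eq[OF order_refl] eq[OF block_edges_subset]
      using divide_right_mono[OF le, of 2] by simp
  qed
  from edge_op_ent_le[OF k D D' S this] show ?thesis by simp
qed




section \<open>Overlaps of XORSAT solutions\<close>

definition sg :: "bool \<Rightarrow> real" where "sg b = (if b then -1 else 1)"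

lemma sg_simps [simp]: "sg True = -1" "sg False = 1"
  by (simp_all add: sg_def)

lemma sg_xor_list: "sg (xor_list z) = prod_list (map sg z)"
  by (induction z) (auto simp: sg_def)

lemma sg_parity: "sg (xor_list (map ((!) y) js)) = (\<Prod>j\<leftarrow>js. sg (y ! j))"
  by (simp add: sg_xor_list o_def)

text \<open>
  The Fourier coefficient at \<open>js\<close> of the uniform distribution on \<open>S\<close>.
\<close>
definition bias :: "nat list \<Rightarrow> bool list set \<Rightarrow> real" where
  "bias js S = (\<Sum>y\<in>S. \<Prod>j\<leftarrow>js. sg (y ! j)) / real (card S)"

lemma parity_sum:
  assumes "finite S"
  shows "(\<Sum>y\<in>S. sg (p y)) = real (card {y\<in>S. \<not> p y}) - real (card {y\<in>S. p y})"
proof -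
  have "(\<Sum>y\<in>S. sg (p y)) = (\<Sum>y\<in>S. (if p y then -1 else 1))" by (simp add: sg_def)
  also have "\<dots> = - real (card {y\<in>S. p y}) + real (card {y\<in>S. \<not> p y})"
    using assms by (simp add: sum.If_cases Int_def Compl_eq)
  finally show ?thesis by simp
qed

text \<open>
  If a parity takes both values on an affine set, at \<open>a\<close> and \<open>c\<close> say, then translation by \<open>a + c\<close> is
  an involution that exchanges its values.
\<close>
lemma parity_trichotomy:
  fixes js
  defines "p \<equiv> \<lambda>y. xor_list (map ((!) y) js)"
  assumes S: "sol_class XORSAT n S" and js: "set js \<subseteq> {..<n}"
  shows "{y\<in>S. p y} = {} \<or> {y\<in>S. \<not> p y} = {} \<or> card {y\<in>S. p y} = card {y\<in>S. \<not> p y}"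
proof (rule ccontr)
  assume neg: "\<not> ?thesis"
  then obtain a c where a: "a \<in> S" "p a" and c: "c \<in> S" "\<not> p c" by blast
  have len: "length y = n" if "y \<in> S" for y using S that by (auto simp: sol_class_def cube_def)
  have x: "xor3 y a c \<in> S" "p (xor3 y a c) \<longleftrightarrow> \<not> p y" "xor3 (xor3 y a c) a c = y" if "y \<in> S" for y
  proof -
    show "xor3 y a c \<in> S" using S that a c by (simp add: sol_class_def)
    show "p (xor3 y a c) \<longleftrightarrow> \<not> p y"
      unfolding p_def using a(2) c(2) len a(1) c(1) that
      by (subst xor_list_xor3[OF js]) (auto simp: p_def)
    have l: "length (xor3 y a c) = n" using that a c len by (simp add: length_xor3)
    show "xor3 (xor3 y a c) a c = y"
      by (rule nth_equalityI) (use that a c len l in \<open>auto simp: length_xor3 nth_xor3[where n = n]\<close>)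
  qed
  have "bij_betw (\<lambda>y. xor3 y a c) {y\<in>S. p y} {y\<in>S. \<not> p y}"
    by (rule bij_betw_byWitness[where f' = "\<lambda>y. xor3 y a c"]) (auto simp: x)
  then have "card {y\<in>S. p y} = card {y\<in>S. \<not> p y}" by (rule bij_betw_same_card)
  with neg show False by blast
qed

lemma bias_eq:
  assumes "finite S"
  shows "bias js S = (real (card {y\<in>S. \<not> xor_list (map ((!) y) js)})
     - real (card {y\<in>S. xor_list (map ((!) y) js)})) / real (card S)"
  using parity_sum[OF assms, of "\<lambda>y. xor_list (map ((!) y) js)"]
  by (simp add: bias_def sg_parity)

lemma card_parity_split:
  assumes "finite S"
  shows "real (card {y\<in>S. \<not> p y}) + real (card {y\<in>S. p y}) = real (card S)"
proof -
  have "card ({y\<in>S. \<not> p y} \<union> {y\<in>S. p y}) = card {y\<in>S. \<not> p y} + card {y\<in>S. p y}"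
    using assms by (intro card_Un_disjoint) auto
  moreover have "{y\<in>S. \<not> p y} \<union> {y\<in>S. p y} = S" by blast
  ultimately show ?thesis by simp
qed

text \<open>
  A planted parity constraint is implied by the previous ones or halves the solution set,
  according as the squared bias is \<open>1\<close> or \<open>0\<close>.
\<close>
lemma log_gain_XORSAT:
  assumes S: "sol_class XORSAT n S" "S \<noteq> {}" and js: "set js \<subseteq> {..<n}" "length js = k" "1 \<le> k"
  shows "log_gain XORSAT k js S = 1 - ln 2 * (1 - (bias js S)\<^sup>2)"
    and "(bias js S)\<^sup>2 = 0 \<or> (bias js S)\<^sup>2 = 1"
proof -
  let ?p = "\<lambda>y. xor_list (map ((!) y) js)"
  let ?t = "real (card {y\<in>S. ?p y})" and ?f = "real (card {y\<in>S. \<not> ?p y})" and ?s = "real (card S)"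
  have fin: "finite S" using S by (simp add: sol_class_finite)
  have s: "?s > 0" using S fin by (simp add: card_gt_0_iff)
  have sum: "?f + ?t = ?s" by (rule card_parity_split[OF fin])
  have "S - clause_sols js (xor_fun k b) = {y\<in>S. ?p y \<noteq> b}" for b
    using js by (auto simp: clause_sols_def xor_fun_def cube_def)
  then have v: "violation js (xor_fun k True) S = ?f / ?s" "violation js (xor_fun k False) S = ?t / ?s"
    by (simp_all add: violation_def)
  have "log_gain XORSAT k js S = log_loss (?f / ?s) + log_loss (?t / ?s)"
    unfolding log_gain_def clause_functions_image
    using inj_xor_fun[OF js(3)] v by (subst sum.reindex) (auto simp: UNIV_bool)
  moreover have "bias js S = (?f - ?t) / ?s" by (rule bias_eq[OF fin])
  moreover have "?t = 0 \<or> ?f = 0 \<or> ?t = ?f"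
    using parity_trichotomy[OF S(1) js(1)] by (elim disjE) (simp_all only: card.empty of_nat_0 simp_thms)
  moreover have "log_loss 0 = 0" "log_loss 1 = 1" by (simp_all add: log_loss_def)
  moreover have "log_loss (1 / 2) + log_loss (1 / 2) = 1 - ln 2"
    by (simp add: log_loss_def ln_div)
  ultimately have "log_gain XORSAT k js S = 1 - ln 2 * (1 - (bias js S)\<^sup>2) \<and> ((bias js S)\<^sup>2 = 0 \<or> (bias js S)\<^sup>2 = 1)"
  proof (elim disjE)
    assume eq: "?t = ?f" and a: "log_gain XORSAT k js S = log_loss (?f / ?s) + log_loss (?t / ?s)"
      "bias js S = (?f - ?t) / ?s" "log_loss (1 / 2) + log_loss (1 / 2) = 1 - ln 2"
    have "?f / ?s = 1 / 2" using sum s eq by (simp add: field_simps)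
    then show ?thesis using a eq by simp
  next
    assume z: "?t = 0" and a: "log_gain XORSAT k js S = log_loss (?f / ?s) + log_loss (?t / ?s)"
      "bias js S = (?f - ?t) / ?s" "log_loss 0 = 0" "log_loss 1 = 1"
    have "?f / ?s = 1" using sum s z by simp
    then show ?thesis using a z by simp
  next
    assume z: "?f = 0" and a: "log_gain XORSAT k js S = log_loss (?f / ?s) + log_loss (?t / ?s)"
      "bias js S = (?f - ?t) / ?s" "log_loss 0 = 0" "log_loss 1 = 1"
    have "?t / ?s = 1" using sum s z by simp
    moreover from this have "(?f - ?t) / ?s = -1" using z by (simp add: diff_divide_distrib)
    ultimately show ?thesis using a z by simp
  qed
  then show "log_gain XORSAT k js S = 1 - ln 2 * (1 - (bias js S)\<^sup>2)"
    "(bias js S)\<^sup>2 = 0 \<or> (bias js S)\<^sup>2 = 1" by blast+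
qed

definition pair_avg :: "bool list set \<Rightarrow> (bool list \<Rightarrow> bool list \<Rightarrow> real) \<Rightarrow> real" where
  "pair_avg S f = (\<Sum>y\<in>S. \<Sum>z\<in>S. f y z) / (real (card S))\<^sup>2"

lemma pair_avg_add: "pair_avg S (\<lambda>y z. f y z + g y z) = pair_avg S f + pair_avg S g"
  by (simp add: pair_avg_def sum.distrib add_divide_distrib)

lemma pair_avg_scale: "pair_avg S (\<lambda>y z. c * f y z) = c * pair_avg S f"
  by (simp add: pair_avg_def sum_distrib_left)

lemma pair_avg_sum: "pair_avg S (\<lambda>y z. \<Sum>i\<in>I. f i y z) = (\<Sum>i\<in>I. pair_avg S (f i))"
proof (induction I rule: infinite_finite_induct)
  case (insert x F)
  then show ?case using pair_avg_add[of S "f x" "\<lambda>y z. \<Sum>i\<in>F. f i y z"] by simp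
qed (simp_all add: pair_avg_def)

lemma pair_avg_mono: "(\<And>y z. f y z \<le> g y z) \<Longrightarrow> pair_avg S f \<le> pair_avg S g"
  unfolding pair_avg_def by (intro divide_right_mono sum_mono) auto

lemma pair_avg_const: "finite S \<Longrightarrow> S \<noteq> {} \<Longrightarrow> pair_avg S (\<lambda>y z. c) = c"
  by (simp add: pair_avg_def power2_eq_square)

lemma prod_list_mult_sg: "(\<Prod>j\<leftarrow>js. sg (y ! j) * sg (z ! j)) = (\<Prod>j\<leftarrow>js. sg (y ! j)) * (\<Prod>j\<leftarrow>js. sg (z ! j))"
  by (induction js) auto

text \<open>
  Two replicas suffice for XORSAT, as the squared bias is the only quantity that matters.
\<close>
lemma pair_avg_bias: "pair_avg S (\<lambda>y z. \<Prod>j\<leftarrow>js. sg (y ! j) * sg (z ! j)) = (bias js S)\<^sup>2"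
  by (simp add: pair_avg_def bias_def prod_list_mult_sg power2_eq_square sum_product)

definition overlap :: "nat set \<Rightarrow> bool list \<Rightarrow> bool list \<Rightarrow> real" where
  "overlap U y z = (\<Sum>v\<in>U. sg (y ! v) * sg (z ! v)) / real (card U)"

lemma abs_overlap_le_1: "\<bar>overlap U y z\<bar> \<le> 1"
proof (cases "card U = 0")
  case False
  have "\<bar>\<Sum>v\<in>U. sg (y ! v) * sg (z ! v)\<bar> \<le> (\<Sum>v\<in>U. 1)"
    by (rule order_trans[OF sum_abs sum_mono]) (simp add: sg_def)
  then show ?thesis using False by (simp add: overlap_def)
qed (simp add: overlap_def)

lemma sum_prod_list_all_edges:
  assumes "finite U"
  shows "(\<Sum>js\<in>all_edges k U. \<Prod>j\<leftarrow>js. f j) = (\<Sum>v\<in>U. f v :: real) ^ k"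
proof (induction k)
  case 0
  have "all_edges 0 U = {[]}" by (auto simp: all_edges_def)
  then show ?case by simp
next
  case (Suc k)
  have eq: "all_edges (Suc k) U = (\<lambda>(v, js). v # js) ` (U \<times> all_edges k U)"
    by (auto simp: all_edges_def length_Suc_conv image_iff)
  have "(\<Sum>js\<in>all_edges (Suc k) U. \<Prod>j\<leftarrow>js. f j) = (\<Sum>(v, js)\<in>U \<times> all_edges k U. f v * (\<Prod>j\<leftarrow>js. f j))"
    unfolding eq by (subst sum.reindex) (auto simp: inj_on_def case_prod_unfold)
  also have "\<dots> = (\<Sum>v\<in>U. f v) * (\<Sum>js\<in>all_edges k U. \<Prod>j\<leftarrow>js. f j)"
    by (simp add: sum.cartesian_product[symmetric] sum_product)
  finally show ?case by (simp add: Suc)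
qed

text \<open>
  For fixed replicas the entries of a random edge are independent.
\<close>
lemma sum_bias_all_edges:
  assumes "finite U"
  shows "(\<Sum>js\<in>all_edges k U. (bias js S)\<^sup>2) / real (card U) ^ k = pair_avg S (\<lambda>y z. overlap U y z ^ k)"
proof -
  have "(\<Sum>js\<in>all_edges k U. (bias js S)\<^sup>2) = pair_avg S (\<lambda>y z. (\<Sum>v\<in>U. sg (y ! v) * sg (z ! v)) ^ k)"
    by (simp add: pair_avg_bias[symmetric] pair_avg_sum[symmetric] sum_prod_list_all_edges[OF assms])
  then show ?thesis
    by (simp add: overlap_def power_divide pair_avg_def flip: sum_divide_distrib)
qed

text \<open>
  The fraction of the variables in \<open>U\<close> with the same value in all solutions. It is the mean
  overlap of two solutions, hence this mean is nonnegative.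
\<close>
definition frozen :: "nat set \<Rightarrow> bool list set \<Rightarrow> real" where
  "frozen U S = (\<Sum>v\<in>U. (bias [v] S)\<^sup>2) / real (card U)"

definition overlap_var :: "nat set \<Rightarrow> bool list set \<Rightarrow> real" where
  "overlap_var U S = pair_avg S (\<lambda>y z. (overlap U y z - frozen U S)\<^sup>2)"

lemma pair_avg_overlap: "pair_avg S (overlap U) = frozen U S"
proof -
  have "pair_avg S (overlap U) = pair_avg S (\<lambda>y z. \<Sum>v\<in>U. sg (y ! v) * sg (z ! v)) / real (card U)"
    using pair_avg_scale[of S "1 / real (card U)" "\<lambda>y z. \<Sum>v\<in>U. sg (y ! v) * sg (z ! v)"]
    by (simp add: overlap_def[abs_def])
  moreover have "pair_avg S (\<lambda>y z. sg (y ! v) * sg (z ! v)) = (bias [v] S)\<^sup>2" for v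
    using pair_avg_bias[of S "[v]"] by simp
  ultimately show ?thesis by (simp add: pair_avg_sum frozen_def)
qed

lemma overlap_var_eq:
  assumes "finite S" "S \<noteq> {}"
  shows "overlap_var U S = (\<Sum>v\<in>U. \<Sum>w\<in>U. (bias [v, w] S)\<^sup>2 - (bias [v] S)\<^sup>2 * (bias [w] S)\<^sup>2) / (real (card U))\<^sup>2"
proof -
  let ?f = "frozen U S"
  have "overlap_var U S = pair_avg S (\<lambda>y z. (overlap U y z)\<^sup>2 + (- 2 * ?f) * overlap U y z + ?f\<^sup>2)"
    unfolding overlap_var_def by (simp add: power2_diff algebra_simps)
  also have "\<dots> = pair_avg S (\<lambda>y z. (overlap U y z)\<^sup>2) - ?f\<^sup>2"
    unfolding pair_avg_add pair_avg_scale pair_avg_overlap pair_avg_const[OF assms]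
    by (simp add: power2_eq_square)
  also have "pair_avg S (\<lambda>y z. (overlap U y z)\<^sup>2) =
      pair_avg S (\<lambda>y z. 1 / (real (card U))\<^sup>2 * (\<Sum>v\<in>U. \<Sum>w\<in>U. \<Prod>j\<leftarrow>[v, w]. sg (y ! j) * sg (z ! j)))"
    by (simp add: overlap_def power2_eq_square sum_product)
  also have "\<dots> = (\<Sum>v\<in>U. \<Sum>w\<in>U. (bias [v, w] S)\<^sup>2) / (real (card U))\<^sup>2"
    unfolding pair_avg_scale pair_avg_sum pair_avg_bias by simp
  also have "?f\<^sup>2 = (\<Sum>v\<in>U. \<Sum>w\<in>U. (bias [v] S)\<^sup>2 * (bias [w] S)\<^sup>2) / (real (card U))\<^sup>2"
    by (simp add: frozen_def power_divide power2_eq_square[of "\<Sum>v\<in>U. _ v"] sum_product)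
  finally show ?thesis by (simp add: sum_subtractf diff_divide_distrib)
qed

lemma frozen_bounds:
  assumes "sol_class XORSAT n S" "S \<noteq> {}" "U \<subseteq> {..<n}"
  shows "0 \<le> frozen U S" "frozen U S \<le> 1"
proof -
  have b: "(bias [v] S)\<^sup>2 \<le> 1" if "v \<in> U" for v
  proof -
    have "(bias [v] S)\<^sup>2 = 0 \<or> (bias [v] S)\<^sup>2 = 1"
      by (rule log_gain_XORSAT(2)[OF assms(1,2), of "[v]" 1]) (use that assms(3) in auto)
    then show ?thesis by linarith
  qed
  show "0 \<le> frozen U S" unfolding frozen_def by (intro divide_nonneg_nonneg sum_nonneg) auto
  have "(\<Sum>v\<in>U. (bias [v] S)\<^sup>2) \<le> (\<Sum>v\<in>U. 1)" by (intro sum_mono b)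
  then show "frozen U S \<le> 1" unfolding frozen_def by (cases "card U = 0") auto
qed

text \<open>
  An overlap may be negative, where the \<open>k\<close>-th power is not convex if \<open>k\<close> is odd. The remedy is to
  replace the overlaps \<open>z b\<close> by nearby nonnegative numbers \<open>f b\<close>, at a cost that is linear in the
  distances.
\<close>
lemma power_mean_near:
  assumes "0 < q" "\<And>b. b < q \<Longrightarrow> \<bar>z b\<bar> \<le> 1" "\<And>b. b < q \<Longrightarrow> 0 \<le> f b" "\<And>b. b < q \<Longrightarrow> f b \<le> 1"
    and \<delta>: "0 < \<delta>"
  shows "((\<Sum>b<q. z b) / real q) ^ k \<le> (\<Sum>b<q. z b ^ k) / real q
     + real k * (\<delta> + (\<Sum>b<q. (z b - f b)\<^sup>2) / real q / \<delta>)"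
proof -
  let ?d = "(\<Sum>b<q. \<bar>z b - f b\<bar>) / real q"
  let ?z = "(\<Sum>b<q. z b) / real q" and ?f = "(\<Sum>b<q. f b) / real q"
  have q: "real q > 0" using assms(1) by simp
  have pow: "\<bar>x ^ k - y ^ k\<bar> \<le> real k * \<bar>x - y\<bar>" if "\<bar>x\<bar> \<le> 1" "\<bar>y\<bar> \<le> 1" for x y :: real
    using norm_power_diff[of x y k] that by simp
  have avg: "\<bar>\<Sum>b<q. g b\<bar> \<le> real q" if "\<And>b. b < q \<Longrightarrow> \<bar>g b\<bar> \<le> 1" for g :: "nat \<Rightarrow> real"
    using order_trans[OF sum_abs sum_bounded_above[of "{..<q}" "\<lambda>b. \<bar>g b\<bar>" 1]] that by simp
  have "\<bar>\<Sum>b<q. z b\<bar> \<le> real q" "\<bar>\<Sum>b<q. f b\<bar> \<le> real q"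
    using assms(2-4) by (auto intro!: avg)
  then have "\<bar>?z\<bar> \<le> 1" "\<bar>?f\<bar> \<le> 1" using q by auto
  from pow[OF this] have 1: "?z ^ k \<le> ?f ^ k + real k * \<bar>?z - ?f\<bar>" by linarith
  have "\<bar>?z - ?f\<bar> = \<bar>\<Sum>b<q. z b - f b\<bar> / real q"
    using q by (simp add: sum_subtractf diff_divide_distrib[symmetric])
  also have "\<dots> \<le> ?d" using q by (intro divide_right_mono sum_abs) auto
  finally have 2: "real k * \<bar>?z - ?f\<bar> \<le> real k * ?d" by (intro mult_left_mono) auto
  have 3: "?f ^ k \<le> (\<Sum>b<q. f b ^ k) / real q" by (rule power_mean) (use assms in auto)
  have "f b ^ k \<le> z b ^ k + real k * \<bar>z b - f b\<bar>" if "b < q" for b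
    using pow[of "z b" "f b"] assms(2-4)[OF that] by fastforce
  then have "(\<Sum>b<q. f b ^ k) \<le> (\<Sum>b<q. z b ^ k + real k * \<bar>z b - f b\<bar>)" by (intro sum_mono) auto
  then have "(\<Sum>b<q. f b ^ k) / real q \<le> (\<Sum>b<q. z b ^ k + real k * \<bar>z b - f b\<bar>) / real q"
    using q by (intro divide_right_mono) auto
  also have "\<dots> = (\<Sum>b<q. z b ^ k) / real q + real k * ?d"
    by (simp add: sum.distrib sum_distrib_left[symmetric] add_divide_distrib)
  finally have 4: "?z ^ k \<le> (\<Sum>b<q. z b ^ k) / real q + real k * (2 * ?d)"
    using 1 2 3 unfolding mult_2 distrib_left by linarith
  \<comment> \<open>Pass from distances to squares, which are controlled by a variance.\<close>
  have young: "2 * \<bar>x\<bar> \<le> \<delta> + x\<^sup>2 / \<delta>" for x :: real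
  proof -
    have "0 \<le> (\<bar>x\<bar> - \<delta>)\<^sup>2 / \<delta>" using \<delta> by simp
    also have "\<dots> = x\<^sup>2 / \<delta> + \<delta> - 2 * \<bar>x\<bar>" using \<delta> by (simp add: power2_diff field_simps power2_eq_square)
    finally show ?thesis by simp
  qed
  have "2 * ?d = (\<Sum>b<q. 2 * \<bar>z b - f b\<bar>) / real q" by (simp add: sum_distrib_left)
  also have "\<dots> \<le> (\<Sum>b<q. \<delta> + (z b - f b)\<^sup>2 / \<delta>) / real q"
    using q by (intro divide_right_mono sum_mono young) auto
  also have "\<dots> = \<delta> + (\<Sum>b<q. (z b - f b)\<^sup>2) / real q / \<delta>"
    using q by (simp add: sum.distrib sum_divide_distrib[symmetric] add_divide_distrib mult.commute)
  finally have "real k * (2 * ?d) \<le> real k * (\<delta> + (\<Sum>b<q. (z b - f b)\<^sup>2) / real q / \<delta>)"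
    by (intro mult_left_mono) auto
  with 4 show ?thesis by linarith
qed

definition block_var :: "nat \<Rightarrow> nat \<Rightarrow> bool list set \<Rightarrow> real" where
  "block_var q l S = real (card S) * ((\<Sum>b<q. overlap_var (block l b) S) / real q)"

lemma block_subset: "b < q \<Longrightarrow> q * l \<le> n \<Longrightarrow> block l b \<subseteq> {..<n}"
proof -
  assume "b < q" "q * l \<le> n"
  then have "block l b \<subseteq> {..<q * l}" unfolding Union_block[symmetric] by (intro UN_upper) simp
  also have "\<dots> \<subseteq> {..<n}" using \<open>q * l \<le> n\<close> by simp
  finally show ?thesis .
qed

text \<open>
  The analogue of \<open>ent_interpolation_SAT_NAESAT\<close>, up to the variance of the overlaps within blocks.
\<close>
lemma ent_interpolation_XORSAT:
  assumes k: "1 \<le> k" and q: "0 < q" and l: "0 < l" and n: "q * l \<le> n"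
    and S: "sol_class XORSAT n S" and \<delta>: "0 < \<delta>"
  shows "edge_op XORSAT k (all_edges k {..<q * l}) ent S \<le> edge_op XORSAT k (block_edges k q l) ent S
    + real k * (\<delta> * real (card S) + block_var q l S / \<delta>)"
proof (cases "S = {}")
  case True
  then show ?thesis by (simp add: edge_op_def edge_avg_def ent_def block_var_def)
next
  case False
  let ?D = "all_edges k {..<q * l}" and ?D' = "block_edges k q l"
  have v: "valid_arity XORSAT k" using k by (simp add: valid_arity_def)
  have D: "edge_set n k ?D" using assms by (intro edge_set_all_edges) (auto simp: lessThan_empty_iff)
  have D': "edge_set n k ?D'" using assms by (intro edge_set_block_edges) auto
  have fin: "finite S" using S by (simp add: sol_class_finite)
  let ?V = "(\<Sum>b<q. overlap_var (block l b) S) / real q"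
  have gain: "(\<Sum>js\<in>E. log_gain XORSAT k js S) / real (card E) = 1 - ln 2 * (1 - (\<Sum>js\<in>E. (bias js S)\<^sup>2) / real (card E))"
    if "edge_set n k E" for E
  proof -
    have "(\<Sum>js\<in>E. log_gain XORSAT k js S) = (\<Sum>js\<in>E. 1 - ln 2 * (1 - (bias js S)\<^sup>2))"
      using that by (intro sum.cong refl log_gain_XORSAT(1)[OF S False _ _ k]) (auto simp: edge_set_def)
    also have "\<dots> = real (card E) - ln 2 * (real (card E) - (\<Sum>js\<in>E. (bias js S)\<^sup>2))"
      by (simp add: sum_subtractf sum_distrib_left[symmetric])
    finally show ?thesis using edge_set_card_pos[OF that] by (simp add: field_simps)
  qed
  have ov: "overlap {..<q * l} y z = (\<Sum>b<q. overlap (block l b) y z) / real q" for y z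
    using l by (simp add: overlap_def sum_block flip: sum_divide_distrib)
  have "(\<Sum>js\<in>?D. (bias js S)\<^sup>2) / real (card ?D) = pair_avg S (\<lambda>y z. overlap {..<q * l} y z ^ k)"
    using sum_bias_all_edges[where U = "{..<q * l}" and k = k and S = S] by (simp add: card_all_edges)
  also have "\<dots> \<le> pair_avg S (\<lambda>y z. (1 / real q) * (\<Sum>b<q. overlap (block l b) y z ^ k)
     + (real k * \<delta> + (real k / (real q * \<delta>)) * (\<Sum>b<q. (overlap (block l b) y z - frozen (block l b) S)\<^sup>2)))"
  proof (rule pair_avg_mono)
    fix y z
    show "overlap {..<q * l} y z ^ k \<le> (1 / real q) * (\<Sum>b<q. overlap (block l b) y z ^ k)
     + (real k * \<delta> + (real k / (real q * \<delta>)) * (\<Sum>b<q. (overlap (block l b) y z - frozen (block l b) S)\<^sup>2))"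
      using power_mean_near[OF q, of "\<lambda>b. overlap (block l b) y z" "\<lambda>b. frozen (block l b) S" \<delta> k]
        abs_overlap_le_1 frozen_bounds[OF S False block_subset[OF _ n]] \<delta>
      by (simp add: ov distrib_left)
  qed
  also have "\<dots> = (1 / real q) * (\<Sum>b<q. pair_avg S (\<lambda>y z. overlap (block l b) y z ^ k)) + (real k * \<delta> + real k / (real q * \<delta>) * (\<Sum>b<q. overlap_var (block l b) S))"
    unfolding pair_avg_add pair_avg_scale pair_avg_sum pair_avg_const[OF fin False] overlap_var_def ..
  also have "(\<Sum>b<q. pair_avg S (\<lambda>y z. overlap (block l b) y z ^ k)) = (\<Sum>js\<in>?D'. (bias js S)\<^sup>2) / real l ^ k"
    by (simp add: sum_bias_all_edges[symmetric] sum_block_edges[OF k] sum_divide_distrib)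
  also have "1 / real q * ((\<Sum>js\<in>?D'. (bias js S)\<^sup>2) / real l ^ k) = (\<Sum>js\<in>?D'. (bias js S)\<^sup>2) / real (card ?D')"
    unfolding card_block_edges[OF k] by simp
  also have "real k * \<delta> + real k / (real q * \<delta>) * (\<Sum>b<q. overlap_var (block l b) S) = real k * (\<delta> + ?V / \<delta>)"
    using \<delta> q by (simp add: field_simps)
  finally have main: "(\<Sum>js\<in>?D. (bias js S)\<^sup>2) / real (card ?D) \<le> (\<Sum>js\<in>?D'. (bias js S)\<^sup>2) / real (card ?D') + real k * (\<delta> + ?V / \<delta>)" .
  have V: "0 \<le> ?V" unfolding overlap_var_def pair_avg_def
    by (intro divide_nonneg_nonneg sum_nonneg) auto
  have "ln 2 * ((\<Sum>js\<in>?D. (bias js S)\<^sup>2) / real (card ?D)) \<le> ln 2 * ((\<Sum>js\<in>?D'. (bias js S)\<^sup>2) / real (card ?D') + real k * (\<delta> + ?V / \<delta>))"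
    by (intro mult_left_mono main) auto
  also have "\<dots> \<le> ln 2 * ((\<Sum>js\<in>?D'. (bias js S)\<^sup>2) / real (card ?D')) + 1 * (real k * (\<delta> + ?V / \<delta>))"
    unfolding distrib_left[of "ln 2" _ "real k * (\<delta> + ?V / \<delta>)"]
    using V \<delta> ln_2_less_1 by (intro add_left_mono mult_right_mono mult_nonneg_nonneg add_nonneg_nonneg divide_nonneg_nonneg[OF V]) auto
  finally have "(\<Sum>js\<in>?D. log_gain XORSAT k js S) / real (card ?D)
      \<le> (\<Sum>js\<in>?D'. log_gain XORSAT k js S) / real (card ?D') + real k * (\<delta> + ?V / \<delta>)"
    unfolding gain[OF D] gain[OF D'] by (simp add: algebra_simps)
  from edge_op_ent_le[OF v D D' fin this] show ?thesis
    unfolding card_XORSAT[OF k] block_var_def by (simp add: algebra_simps)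
qed




section \<open>Pinning and the interpolation inequality\<close>

text \<open>
  Revealing the value of a random variable is a unary XORSAT constraint.
\<close>
definition pin_op :: "nat \<Rightarrow> (bool list set \<Rightarrow> real) \<Rightarrow> bool list set \<Rightarrow> real" where
  "pin_op N = edge_op XORSAT 1 (all_edges 1 {..<N})"

text \<open>
  The number of variables that are not frozen, weighted by the number of solutions so that
  \<open>pin_op\<close> computes its mean after a pin. It is the potential that pays for the variance of
  the overlaps.
\<close>
definition unfrozen :: "nat \<Rightarrow> bool list set \<Rightarrow> real" where
  "unfrozen N S = real (card S) * (\<Sum>v<N. 1 - (bias [v] S)\<^sup>2)"

lemma bias_sq_cases:
  assumes "sol_class XORSAT n S" "S \<noteq> {}" "set js \<subseteq> {..<n}" "js \<noteq> []"
  shows "(bias js S)\<^sup>2 = 0 \<or> (bias js S)\<^sup>2 = 1"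
  by (rule log_gain_XORSAT(2)[OF assms(1,2,3) refl]) (use assms(4) in \<open>simp add: Suc_le_eq\<close>)

lemma pin_op_eq:
  "pin_op N g S = (\<Sum>w<N. g {y\<in>S. y ! w} + g {y\<in>S. \<not> y ! w}) / real N"
proof -
  have "all_edges 1 {..<N} = (\<lambda>w. [w]) ` {..<N}"
    by (auto simp: all_edges_def length_Suc_conv)
  moreover have "edge_avg XORSAT 1 [w] g S = g {y\<in>S. y ! w} + g {y\<in>S. \<not> y ! w}" for w
  proof -
    have "S \<inter> clause_sols [w] (xor_fun 1 b) = {y\<in>S. (y ! w) = b}" for b
      by (auto simp: clause_sols_def xor_fun_def cube_def)
    moreover have "(\<Sum>\<sigma>\<in>range (xor_fun 1). h \<sigma>) = h (xor_fun 1 True) + h (xor_fun 1 False)" for h :: "_ \<Rightarrow> real"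
      using inj_xor_fun[of 1] by (subst sum.reindex) (auto simp: UNIV_bool)
    moreover have "card (range (xor_fun 1)) = 2"
      using card_XORSAT[OF order_refl] unfolding clause_functions_image .
    ultimately show ?thesis
      unfolding edge_avg_def clause_functions_image by simp
  qed
  moreover have "inj_on (\<lambda>w. [w]) {..<N}" by (simp add: inj_on_def)
  ultimately show ?thesis
    unfolding pin_op_def edge_op_def by (simp add: sum.reindex card_image)
qed

lemma card_mult_bias_pinned:
  assumes "finite S"
  shows "real (card {y\<in>S. y ! w = b}) * bias [v] {y\<in>S. y ! w = b} =
     real (card S) * (bias [v] S + sg b * bias [v, w] S) / 2"
proof (cases "S = {}")
  case False
  then have s: "real (card S) \<noteq> 0" using assms by simp
  have ne: "real (card A) * (x / real (card A)) = x" if "finite A" "A = {} \<Longrightarrow> x = 0" for A :: "bool list set" and x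
    using that by (cases "A = {}") auto
  have "real (card {y\<in>S. y ! w = b}) * bias [v] {y\<in>S. y ! w = b} = (\<Sum>y | y \<in> S \<and> y ! w = b. sg (y ! v))"
    unfolding bias_def using assms by (subst ne) (simp, erule ssubst, simp_all)
  also have "\<dots> = (\<Sum>y\<in>S. if y ! w = b then sg (y ! v) else 0)"
    using assms by (simp add: sum.If_cases Int_def)
  also have "\<dots> = (\<Sum>y\<in>S. (sg (y ! v) + sg b * (sg (y ! v) * sg (y ! w))) / 2)"
    by (intro sum.cong refl) (simp add: sg_def)
  also have "\<dots> = ((\<Sum>y\<in>S. sg (y ! v)) + sg b * (\<Sum>y\<in>S. sg (y ! v) * sg (y ! w))) / 2"
    by (simp only: sum_divide_distrib[symmetric] sum.distrib sum_distrib_left)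
  also have "\<dots> = real (card S) * (bias [v] S + sg b * bias [v, w] S) / 2"
    using s by (simp add: bias_def distrib_left)
  finally show ?thesis .
qed (simp add: bias_def)

lemma bias_tied:
  assumes "finite S" "card {y\<in>S. y ! w = (\<not> b)} = 0"
  shows "bias [v, w] S = sg b * bias [v] S" "{y\<in>S. y ! w = b} = S"
proof -
  have "{y\<in>S. y ! w = (\<not> b)} = {}" using assms by simp
  then have b: "y ! w = b" if "y \<in> S" for y using that by blast
  then have "(\<Sum>y\<in>S. sg (y ! v) * sg (y ! w)) = (\<Sum>y\<in>S. sg b * sg (y ! v))" by (intro sum.cong) auto
  then show "bias [v, w] S = sg b * bias [v] S" by (simp add: bias_def sum_distrib_left[symmetric])
  show "{y\<in>S. y ! w = b} = S" using b by blast
qed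

text \<open>
  Pinning \<open>w\<close> freezes \<open>v\<close> if and only if neither was frozen and their sum was, that is, if \<open>v\<close> and \<open>w\<close> are
  correlated.
\<close>
lemma pin_unfrozen_pair:
  assumes S: "sol_class XORSAT n S" "S \<noteq> {}" and v: "v < n" and w: "w < n"
  defines "A \<equiv> \<lambda>b. {y\<in>S. y ! w = b}"
  shows "real (card (A True)) * (1 - (bias [v] (A True))\<^sup>2) + real (card (A False)) * (1 - (bias [v] (A False))\<^sup>2)
    = real (card S) * ((1 - (bias [v] S)\<^sup>2) - ((bias [v, w] S)\<^sup>2 - (bias [v] S)\<^sup>2 * (bias [w] S)\<^sup>2))"
proof -
  have fin: "finite S" using S by (simp add: sol_class_finite)
  let ?s = "real (card S)"
  have s: "?s > 0" using S fin by (simp add: card_gt_0_iff)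
  have tot: "real (card (A False)) + real (card (A True)) = ?s"
    using card_parity_split[OF fin, of "\<lambda>y. y ! w"] by (simp add: A_def)
  have bw: "bias [w] S = (real (card (A False)) - real (card (A True))) / ?s"
    using parity_sum[OF fin, of "\<lambda>y. y ! w"] by (simp add: bias_def A_def)
  have half: "real (card (A b)) * bias [v] (A b) = ?s * (bias [v] S + sg b * bias [v, w] S) / 2" for b
    unfolding A_def by (rule card_mult_bias_pinned[OF fin])
  have "card (A True) = 0 \<or> card (A False) = 0 \<or> card (A True) = card (A False)"
  proof -
    have "{y\<in>S. y ! w} = {} \<or> {y\<in>S. \<not> y ! w} = {} \<or> card {y\<in>S. y ! w} = card {y\<in>S. \<not> y ! w}"
      using parity_trichotomy[OF S(1), of "[w]"] w by simp
    then show ?thesis unfolding A_def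
      by (elim disjE) (simp_all only: card.empty simp_thms)
  qed
  then show ?thesis
  proof (elim disjE)
    assume z: "card (A True) = 0"
    with bias_tied(1)[OF fin, of w False v] bias_tied(2)[OF fin, of w False] have "bias [v, w] S = bias [v] S" "A False = S"
      by (simp_all add: A_def)
    moreover have "bias [w] S = 1" using bw z tot s by simp
    ultimately show ?thesis using z by simp
  next
    assume z: "card (A False) = 0"
    with bias_tied(1)[OF fin, of w True v] bias_tied(2)[OF fin, of w True] have "bias [v, w] S = - bias [v] S" "A True = S"
      by (simp_all add: A_def)
    moreover have "bias [w] S = - 1" using bw z tot s by simp
    ultimately show ?thesis using z by simp
  next
    assume eq: "card (A True) = card (A False)"
    then have c: "real (card (A b)) = ?s / 2" for b using tot by (cases b) auto
    have bv: "bias [v] (A b) = bias [v] S + sg b * bias [v, w] S" for b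
      using half[of b] s by (simp add: c)
    have bw: "bias [w] S = 0" using bw eq by simp
    show ?thesis unfolding c bv bw sg_simps by (simp add: power2_eq_square field_simps)
  qed
qed

lemma correlation_nonneg:
  assumes S: "sol_class XORSAT n S" "S \<noteq> {}" and v: "v < n" and w: "w < n"
  shows "0 \<le> (bias [v, w] S)\<^sup>2 - (bias [v] S)\<^sup>2 * (bias [w] S)\<^sup>2"
proof -
  have fin: "finite S" using S by (simp add: sol_class_finite)
  have s: "real (card S) > 0" using S fin by (simp add: card_gt_0_iff)
  have "(bias [v, w] S)\<^sup>2 = (bias [v] S)\<^sup>2" if "(bias [w] S)\<^sup>2 = 1"
  proof -
    let ?t = "real (card {y\<in>S. y ! w})" and ?f = "real (card {y\<in>S. \<not> y ! w})"
    have "bias [w] S = (?f - ?t) / (?f + ?t)"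
      using parity_sum[OF fin, of "\<lambda>y. y ! w"] card_parity_split[OF fin, of "\<lambda>y. y ! w"]
      by (simp add: bias_def)
    then have "(?f - ?t)\<^sup>2 = (?f + ?t)\<^sup>2"
      using that s card_parity_split[OF fin, of "\<lambda>y. y ! w"] by (simp add: power_divide)
    then have "?f * ?t = 0" by (simp add: power2_eq_square algebra_simps)
    then have "card {y\<in>S. y ! w = (\<not> True)} = 0 \<or> card {y\<in>S. y ! w = (\<not> False)} = 0"
      by (simp only: mult_eq_0_iff of_nat_eq_0_iff not_True_eq_False not_False_eq_True) simp
    then show ?thesis using bias_tied(1)[OF fin, of w _ v] by (elim disjE) (simp_all only: sg_simps, simp_all)
  qed
  then show ?thesis
    using bias_sq_cases[OF S, of "[w]"] w by fastforce
qed

lemma sum_pairs_blocks_le: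
  assumes "\<And>v w. v < q * l \<Longrightarrow> w < q * l \<Longrightarrow> 0 \<le> f v w"
  shows "(\<Sum>b<q. \<Sum>v\<in>block l b. \<Sum>w\<in>block l b. f v w) \<le> (\<Sum>v<q * l. \<Sum>w<q * l. f v w :: real)"
proof -
  have "(\<Sum>w\<in>block l b. f v w) \<le> (\<Sum>w<q * l. f v w)" if "b < q" "v \<in> block l b" for b v
    using block_subset[OF that(1) order_refl, of l] that(2) by (intro sum_mono2) (auto intro!: assms)
  then have "(\<Sum>b<q. \<Sum>v\<in>block l b. \<Sum>w\<in>block l b. f v w) \<le> (\<Sum>b<q. \<Sum>v\<in>block l b. \<Sum>w<q * l. f v w)"
    by (intro sum_mono) auto
  then show ?thesis by (simp only: sum_block)
qed

text \<open>
  The variance of the overlap within a block is the density of correlated pairs in the block, and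
  every correlated pair lowers the potential when one of its elements is pinned. Only pairs
  inside a block are needed; the other pairs contribute nonnegative terms.
\<close>
lemma block_var_le:
  assumes q: "0 < q" and l: "0 < l" and n: "q * l \<le> n" and S: "sol_class XORSAT n S"
  shows "real l * block_var q l S \<le> unfrozen (q * l) S - pin_op (q * l) (unfrozen (q * l)) S"
proof (cases "S = {}")
  case True
  then show ?thesis by (simp add: block_var_def unfrozen_def pin_op_eq)
next
  case False
  let ?N = "q * l" and ?s = "real (card S)"
  let ?c = "\<lambda>v w. (bias [v, w] S)\<^sup>2 - (bias [v] S)\<^sup>2 * (bias [w] S)\<^sup>2"
  have fin: "finite S" using S by (simp add: sol_class_finite)
  have N: "real ?N > 0" using q l by simp
  have pin: "unfrozen ?N {y\<in>S. y ! w} + unfrozen ?N {y\<in>S. \<not> y ! w} = unfrozen ?N S - ?s * (\<Sum>v<?N. ?c v w)"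
    if "w < ?N" for w
  proof -
    have "unfrozen ?N {y\<in>S. y ! w} + unfrozen ?N {y\<in>S. \<not> y ! w} = (\<Sum>v<?N. ?s * ((1 - (bias [v] S)\<^sup>2) - ?c v w))"
      unfolding unfrozen_def sum_distrib_left sum.distrib[symmetric]
    proof (rule sum.cong)
      fix v assume "v \<in> {..<?N}"
      then show "real (card {y\<in>S. y ! w}) * (1 - (bias [v] {y\<in>S. y ! w})\<^sup>2) + real (card {y\<in>S. \<not> y ! w}) * (1 - (bias [v] {y\<in>S. \<not> y ! w})\<^sup>2) = ?s * ((1 - (bias [v] S)\<^sup>2) - ?c v w)"
        using pin_unfrozen_pair[OF S False, of v w] that n by simp
    qed simp
    also have "\<dots> = unfrozen ?N S - ?s * (\<Sum>v<?N. ?c v w)"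
      by (simp only: unfrozen_def sum_distrib_left[symmetric] sum_subtractf right_diff_distrib)
    finally show ?thesis .
  qed
  have "pin_op ?N (unfrozen ?N) S = (\<Sum>w<?N. unfrozen ?N S - ?s * (\<Sum>v<?N. ?c v w)) / real ?N"
    unfolding pin_op_eq by (intro arg_cong2[where f = "(/)"] sum.cong pin refl) auto
  also have "\<dots> = unfrozen ?N S - ?s * (\<Sum>w<?N. \<Sum>v<?N. ?c v w) / real ?N"
    using N by (simp add: sum_subtractf sum_distrib_left[symmetric] diff_divide_distrib del: of_nat_mult)
  finally have drop: "unfrozen ?N S - pin_op ?N (unfrozen ?N) S = ?s * (\<Sum>w<?N. \<Sum>v<?N. ?c v w) / real ?N" by simp
  have "real l * block_var q l S = ?s * (\<Sum>b<q. \<Sum>v\<in>block l b. \<Sum>w\<in>block l b. ?c v w) / real ?N"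
    using l q by (simp add: block_var_def overlap_var_eq[OF fin False] sum_divide_distrib[symmetric] power2_eq_square)
  also have "\<dots> \<le> ?s * (\<Sum>v<?N. \<Sum>w<?N. ?c v w) / real ?N"
    using n by (intro divide_right_mono mult_left_mono sum_pairs_blocks_le correlation_nonneg[OF S False]) auto
  also have "(\<Sum>v<?N. \<Sum>w<?N. ?c v w) = (\<Sum>w<?N. \<Sum>v<?N. ?c v w)" by (rule sum.swap)
  finally show ?thesis unfolding drop .
qed

lemma unfrozen_bounds:
  assumes "sol_class XORSAT n S" "N \<le> n"
  shows "0 \<le> unfrozen N S" "unfrozen N S \<le> real N * real (card S)"
proof -
  have b: "0 \<le> 1 - (bias [v] S)\<^sup>2" if "v < N" "S \<noteq> {}" for v
    using bias_sq_cases[OF assms(1), of "[v]"] that assms(2) by auto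
  show "0 \<le> unfrozen N S"
    using b by (cases "S = {}") (auto simp: unfrozen_def intro!: mult_nonneg_nonneg sum_nonneg)
  have "(\<Sum>v<N. 1 - (bias [v] S)\<^sup>2) \<le> (\<Sum>v<N. 1)" by (intro sum_mono) simp
  from mult_left_mono[OF this, of "real (card S)"]
  show "unfrozen N S \<le> real N * real (card S)" by (simp add: unfrozen_def mult.commute)
qed

lemma averaging_pin_op:
  assumes "0 < N" "N \<le> n"
  shows "averaging (sol_class XORSAT n) (pin_op N)"
  unfolding pin_op_def
  by (intro averaging_edge_op edge_set_all_edges) (use assms in \<open>auto simp: valid_arity_def lessThan_empty_iff\<close>)

text \<open>
  The drops of the potential telescope. With \<open>T = c q\<close> the mean over \<open>t < T\<close> of the variance after \<open>t\<close> pins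
  is therefore at most \<open>1 / c\<close>, whatever the length and the number of the blocks.
\<close>
lemma sum_pinned_block_var_le:
  assumes q: "0 < q" and l: "0 < l" and n: "q * l \<le> n" and S: "sol_class XORSAT n S"
  shows "(\<Sum>t<T. (pin_op (q * l) ^^ t) (block_var q l) S) \<le> real q * real (card S)"
proof -
  let ?P = "pin_op (q * l)" and ?U = "unfrozen (q * l)"
  have P: "averaging (sol_class XORSAT n) (?P ^^ t)" for t
    using assms by (intro averaging_funpow averaging_pin_op) auto
  have step: "real l * (?P ^^ t) (block_var q l) S \<le> (?P ^^ t) ?U S - (?P ^^ Suc t) ?U S" for t
  proof -
    have "real l * (?P ^^ t) (block_var q l) S = (?P ^^ t) (\<lambda>S. real l * block_var q l S) S"
      by (simp only: averaging_scale[OF P])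
    also have "\<dots> \<le> (?P ^^ t) (\<lambda>S. 1 * ?U S + (-1) * ?P ?U S) S"
      using block_var_le[OF q l n] S by (intro averaging_mono[OF P]) auto
    also have "\<dots> = (?P ^^ t) ?U S - (?P ^^ Suc t) ?U S"
      unfolding averaging_linear[OF P] by (simp add: funpow_swap1)
    finally show ?thesis .
  qed
  have "real l * (\<Sum>t<T. (?P ^^ t) (block_var q l) S) \<le> (\<Sum>t<T. (?P ^^ t) ?U S - (?P ^^ Suc t) ?U S)"
    unfolding sum_distrib_left by (intro sum_mono step)
  also have "\<dots> = ?U S - (?P ^^ T) ?U S" by (induction T) auto
  also have "\<dots> \<le> ?U S"
    using averaging_mono[OF P, of "\<lambda>S. 0" ?U S T] unfrozen_bounds(1)[OF _ n] S
    by (simp add: averaging_zero[OF P])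
  also have "\<dots> \<le> real (q * l) * real (card S)" by (rule unfrozen_bounds(2)[OF S n])
  finally have "real l * (\<Sum>t<T. (?P ^^ t) (block_var q l) S) \<le> real l * (real q * real (card S))" by (simp add: mult_ac)
  then show ?thesis using l by simp
qed

lemma averaging_all_edges:
  assumes "valid_arity t k" "0 < N" "N \<le> n"
  shows "averaging (sol_class t n) (edge_op t k (all_edges k {..<N}))"
  using assms by (intro averaging_edge_op edge_set_all_edges) (auto simp: lessThan_empty_iff)

lemma averaging_block_edges:
  assumes "valid_arity t k" "0 < q" "0 < l" "q * l \<le> n"
  shows "averaging (sol_class t n) (edge_op t k (block_edges k q l))"
  using assms by (intro averaging_edge_op edge_set_block_edges)

lemma funpow_ent_bounds:
  assumes "averaging P T" "P S"
    and "\<And>S. P S \<Longrightarrow> ent S - real (card S) \<le> T ent S"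
    and "\<And>S. P S \<Longrightarrow> T ent S \<le> ent S"
  shows "ent S - real m * real (card S) \<le> (T ^^ m) ent S" "(T ^^ m) ent S \<le> ent S"
proof -
  have step: "(T ^^ m) ent S - real (card S) \<le> (T ^^ Suc m) ent S \<and> (T ^^ Suc m) ent S \<le> (T ^^ m) ent S" for m
  proof -
    have Tm: "averaging P (T ^^ m)" by (rule averaging_funpow[OF assms(1)])
    have "(T ^^ m) ent S - real (card S) = (T ^^ m) (\<lambda>S. 1 * ent S + (-1) * real (card S)) S"
      unfolding averaging_linear[OF Tm] averaging_card[OF Tm assms(2)] by simp
    also have "\<dots> \<le> (T ^^ m) (T ent) S"
      using assms by (intro averaging_mono[OF Tm]) auto
    finally show ?thesis
      using averaging_mono[OF Tm, of "T ent" ent S] assms(2,4) by (simp add: funpow_swap1)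
  qed
  show "ent S - real m * real (card S) \<le> (T ^^ m) ent S"
  proof (induction m)
    case (Suc m)
    have "real (Suc m) * real (card S) = real m * real (card S) + real (card S)" by (simp add: algebra_simps)
    then show ?case using Suc step[of m] by linarith
  qed simp
  show "(T ^^ m) ent S \<le> ent S"
  proof (induction m)
    case (Suc m)
    then show ?case using step[of m] by linarith
  qed simp
qed

text \<open>
  For each \<open>t < T\<close> the hybrid argument is run after \<open>t\<close> pins, which lower the mean of
  \<open>ln |S|\<close> by at most \<open>T\<close>. Averaging over \<open>t\<close> makes the accumulated variance harmless.
\<close>
lemma interpolation_XORSAT:
  assumes k: "1 \<le> k" and q: "0 < q" and l: "0 < l" and n: "q * l \<le> n" and \<delta>: "0 < \<delta>" and T: "0 < T"
    and Y: "sol_class XORSAT n Y"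
  shows "(edge_op XORSAT k (all_edges k {..<q * l}) ^^ m) ent Y \<le> (edge_op XORSAT k (block_edges k q l) ^^ m) ent Y
     + (real T + real m * real k * (\<delta> + real q / (\<delta> * real T))) * real (card Y)"
proof -
  let ?A = "edge_op XORSAT k (all_edges k {..<q * l})" and ?B = "edge_op XORSAT k (block_edges k q l)"
    and ?P = "pin_op (q * l)" and ?C = "sol_class XORSAT n" and ?c = "real (card Y)"
  let ?e = "\<lambda>S. real k * (\<delta> * real (card S) + block_var q l S / \<delta>)"
  have v: "valid_arity XORSAT k" using k by (simp add: valid_arity_def)
  have A: "averaging ?C ?A" by (rule averaging_all_edges[OF v]) (use q l n in auto)
  have B: "averaging ?C ?B" by (rule averaging_block_edges[OF v q l n])
  have P: "averaging ?C ?P" by (rule averaging_pin_op) (use q l n in auto)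
  have Pt: "averaging ?C (?P ^^ t)" for t by (rule averaging_funpow[OF P])
  have At: "averaging ?C (?A ^^ t)" for t by (rule averaging_funpow[OF A])
  have Bt: "averaging ?C (?B ^^ t)" for t by (rule averaging_funpow[OF B])
  have AB: "?A (?B g) = ?B (?A g)" for g by (rule edge_op_commute)
  have AP: "?A (?P g) = ?P (?A g)" for g unfolding pin_op_def by (rule edge_op_commute)
  have BP: "?B (?P g) = ?P (?B g)" for g unfolding pin_op_def by (rule edge_op_commute)
  have pin: "ent S - real t * real (card S) \<le> (?P ^^ t) ent S" "(?P ^^ t) ent S \<le> ent S" if "?C S" for S t
  proof -
    have D: "edge_set n 1 (all_edges 1 {..<q * l})"
      using q l n by (intro edge_set_all_edges) (auto simp: lessThan_empty_iff)
    have "ent S - real (card S) \<le> ?P ent S" "?P ent S \<le> ent S" if "?C S" for S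
      unfolding pin_op_def by (rule edge_op_ent_bounds[OF _ D sol_class_finite[OF that]], simp add: valid_arity_def)+
    from funpow_ent_bounds[OF P that this]
    show "ent S - real t * real (card S) \<le> (?P ^^ t) ent S" "(?P ^^ t) ent S \<le> ent S" by auto
  qed
  have step: "(?A ^^ m) ((?P ^^ t) ent) Y \<le> (?B ^^ m) ((?P ^^ t) ent) Y
      + (\<Sum>i<m. (?A ^^ i) ((?B ^^ (m - 1 - i)) ((?P ^^ t) ?e)) Y)" for t
  proof (rule hybrid[OF A B AB _ Y])
    fix S assume S: "?C S"
    have "?A ((?P ^^ t) ent) S = (?P ^^ t) (?A ent) S"
      using funpow_commute_op[of ?P ?A t ent] AP by simp
    also have "\<dots> \<le> (?P ^^ t) (\<lambda>S. ?B ent S + ?e S) S"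
      using S by (intro averaging_mono[OF Pt] ent_interpolation_XORSAT[OF k q l n _ \<delta>])
    also have "\<dots> = (?P ^^ t) (?B ent) S + (?P ^^ t) ?e S" by (rule averaging_add[OF Pt])
    also have "(?P ^^ t) (?B ent) = ?B ((?P ^^ t) ent)"
      using funpow_commute_op[of ?P ?B t ent] BP by simp
    finally show "?A ((?P ^^ t) ent) S \<le> ?B ((?P ^^ t) ent) S + (?P ^^ t) ?e S" .
  qed
  have err: "(\<Sum>t<T. (?A ^^ i) ((?B ^^ j) ((?P ^^ t) ?e)) Y) \<le> real k * (\<delta> * real T + real q / \<delta>) * ?c" for i j
  proof -
    have K: "averaging ?C (?A ^^ i \<circ> ?B ^^ j)" by (intro averaging_comp At Bt)
    have "(\<Sum>t<T. (?A ^^ i \<circ> ?B ^^ j) ((?P ^^ t) ?e) Y) = (?A ^^ i \<circ> ?B ^^ j) (\<lambda>S. \<Sum>t<T. (?P ^^ t) ?e S) Y"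
      by (rule averaging_sum[OF K, symmetric])
    also have "\<dots> \<le> (?A ^^ i \<circ> ?B ^^ j) (\<lambda>S. real k * (\<delta> * real T + real q / \<delta>) * real (card S)) Y"
    proof (rule averaging_mono[OF K _ Y])
      fix S assume S: "?C S"
      have e: "?e = (\<lambda>S. (real k * \<delta>) * real (card S) + (real k / \<delta>) * block_var q l S)"
        by (simp add: fun_eq_iff distrib_left)
      have "(?P ^^ t) ?e S = (real k * \<delta>) * real (card S) + (real k / \<delta>) * (?P ^^ t) (block_var q l) S" for t
        unfolding e averaging_linear[OF Pt] averaging_card[OF Pt S] ..
      then have "(\<Sum>t<T. (?P ^^ t) ?e S) = real T * (real k * \<delta> * real (card S)) + (real k / \<delta>) * (\<Sum>t<T. (?P ^^ t) (block_var q l) S)"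
        by (simp add: sum.distrib sum_distrib_left)
      also have "\<dots> \<le> real T * (real k * \<delta> * real (card S)) + (real k / \<delta>) * (real q * real (card S))"
        using \<delta> by (intro add_left_mono mult_left_mono sum_pinned_block_var_le[OF q l n S]) auto
      finally show "(\<Sum>t<T. (?P ^^ t) ?e S) \<le> real k * (\<delta> * real T + real q / \<delta>) * real (card S)"
        by (simp add: algebra_simps)
    qed
    also have "\<dots> = real k * (\<delta> * real T + real q / \<delta>) * ?c"
      unfolding averaging_scale[OF K] averaging_card[OF K Y] ..
    finally show ?thesis by simp
  qed
  have low: "(?A ^^ m) ent Y - real T * ?c \<le> (?A ^^ m) ((?P ^^ t) ent) Y" if "t < T" for t
  proof -
    have "(?A ^^ m) ent Y - real T * ?c \<le> (?A ^^ m) (\<lambda>S. 1 * ent S + (- real t) * real (card S)) Y"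
      unfolding averaging_linear[OF At] averaging_card[OF At Y] using that by (simp add: mult_right_mono)
    also have "\<dots> \<le> (?A ^^ m) ((?P ^^ t) ent) Y"
      using pin(1) Y by (intro averaging_mono[OF At]) auto
    finally show ?thesis .
  qed
  have up: "(?B ^^ m) ((?P ^^ t) ent) Y \<le> (?B ^^ m) ent Y" for t
    using pin(2) Y by (intro averaging_mono[OF Bt]) auto
  have "real T * ((?A ^^ m) ent Y - real T * ?c) = (\<Sum>t<T. (?A ^^ m) ent Y - real T * ?c)" by simp
  also have "\<dots> \<le> (\<Sum>t<T. (?B ^^ m) ent Y + (\<Sum>i<m. (?A ^^ i) ((?B ^^ (m - 1 - i)) ((?P ^^ t) ?e)) Y))"
  proof (rule sum_mono)
    fix t assume "t \<in> {..<T}"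
    then show "(?A ^^ m) ent Y - real T * ?c \<le> (?B ^^ m) ent Y + (\<Sum>i<m. (?A ^^ i) ((?B ^^ (m - 1 - i)) ((?P ^^ t) ?e)) Y)"
      using low[of t] step[of t] up[of t] by simp
  qed
  also have "\<dots> = real T * (?B ^^ m) ent Y + (\<Sum>i<m. \<Sum>t<T. (?A ^^ i) ((?B ^^ (m - 1 - i)) ((?P ^^ t) ?e)) Y)"
    by (subst sum.swap) (simp add: sum.distrib)
  also have "\<dots> \<le> real T * (?B ^^ m) ent Y + (\<Sum>i<m. real k * (\<delta> * real T + real q / \<delta>) * ?c)"
    by (intro add_left_mono sum_mono err)
  also have "\<dots> = real T * ((?B ^^ m) ent Y + real m * real k * (\<delta> + real q / (\<delta> * real T)) * ?c)"
    using T \<delta> by (simp add: field_simps)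
  finally have "(?A ^^ m) ent Y - real T * ?c \<le> (?B ^^ m) ent Y + real m * real k * (\<delta> + real q / (\<delta> * real T)) * ?c"
    using T by simp
  then show ?thesis by (simp add: algebra_simps)
qed

lemma interpolation:
  assumes k: "valid_arity t k" and q: "0 < q" and l: "0 < l" and n: "q * l \<le> n" and \<delta>: "0 < \<delta>" and T: "0 < T"
    and Y: "sol_class t n Y"
  shows "(edge_op t k (all_edges k {..<q * l}) ^^ m) ent Y \<le> (edge_op t k (block_edges k q l) ^^ m) ent Y
     + (real T + real m * real k * (\<delta> + real q / (\<delta> * real T))) * real (card Y)"
proof (cases "t = XORSAT")
  case True
  then show ?thesis using assms interpolation_XORSAT[OF _ q l n \<delta> T] by (simp add: valid_arity_def)
next
  case False
  then have t: "t = SAT \<or> t = NAESAT" by (cases t) auto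
  have "(edge_op t k (all_edges k {..<q * l}) ^^ m) ent Y \<le> (edge_op t k (block_edges k q l) ^^ m) ent Y + real m * 0 * real (card Y)"
  proof (rule hybrid_const[OF averaging_all_edges[OF k] averaging_block_edges[OF k q l n] _ _ Y])
    show "edge_op t k (all_edges k {..<q * l}) (edge_op t k (block_edges k q l) g) = edge_op t k (block_edges k q l) (edge_op t k (all_edges k {..<q * l}) g)" for g
      by (rule edge_op_commute)
    show "edge_op t k (all_edges k {..<q * l}) ent S \<le> edge_op t k (block_edges k q l) ent S + 0 * real (card S)" if "sol_class t n S" for S
      using ent_interpolation_SAT_NAESAT[OF t k q l n that] by simp
  qed (use q l n in auto)
  moreover have "0 \<le> (real T + real m * real k * (\<delta> + real q / (\<delta> * real T))) * real (card Y)"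
    using \<delta> by simp
  ultimately show ?thesis by simp
qed




section \<open>Change of the edge distribution\<close>

text \<open>
  Each edge costs between \<open>0\<close> and \<open>|S|\<close> of entropy, so two edge distributions differ by at most their
  total variation distance.
\<close>
lemma edge_op_subset_close:
  assumes t: "valid_arity t k" and D2: "edge_set n k D2" and sub: "D1 \<subseteq> D2" "D1 \<noteq> {}" and S: "finite S"
  shows "\<bar>edge_op t k D1 ent S - edge_op t k D2 ent S\<bar>
    \<le> (1 - real (card D1) / real (card D2)) * real (card S)"
proof -
  let ?x = "\<lambda>js. ent S - edge_avg t k js ent S"
  let ?a = "\<Sum>js\<in>D1. ?x js" and ?b = "\<Sum>js\<in>D2 - D1. ?x js"
  let ?c = "real (card D1)" and ?d = "real (card (D2 - D1))" and ?s = "real (card S)"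
  have D1: "edge_set n k D1" by (rule edge_set_subset[OF D2 sub])
  have fin: "finite D2" "finite D1" using D1 D2 by (auto simp: edge_set_def)
  have c: "?c > 0" by (rule edge_set_card_pos[OF D1])
  have card: "real (card D2) = ?c + ?d"
    using card_Un_disjoint[of D1 "D2 - D1"] fin sub by (simp add: Un_absorb1)
  have x: "0 \<le> ?x js" "?x js \<le> ?s" if "js \<in> D2" for js
    using edge_avg_ent_upper[OF S _ t, of js] edge_avg_ent_lower[OF S _ t, of js] D2 that
    by (auto simp: edge_set_def)
  have op: "edge_op t k D ent S = ent S - (\<Sum>js\<in>D. ?x js) / real (card D)" if "edge_set n k D" for D
    using edge_set_card_pos[OF that] by (simp add: edge_op_def sum_subtractf diff_divide_distrib)
  have sum2: "(\<Sum>js\<in>D2. ?x js) = ?a + ?b"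
    using sum.subset_diff[OF sub(1) fin(1), of ?x] by simp
  have a: "0 \<le> ?a" "?a \<le> ?c * ?s"
    using sub(1) x sum_bounded_above[of D1 ?x ?s] by (auto intro!: sum_nonneg)
  have b: "0 \<le> ?b" "?b \<le> ?d * ?s"
    using x sum_bounded_above[of "D2 - D1" ?x ?s] by (auto intro!: sum_nonneg)
  have "edge_op t k D1 ent S - edge_op t k D2 ent S = (?a + ?b) / (?c + ?d) - ?a / ?c"
    unfolding op[OF D1] op[OF D2] sum2 card by simp
  also have "\<dots> = (?b * ?c - ?a * ?d) / (?c * (?c + ?d))"
    using c by (simp add: field_simps)
  finally have eq: "edge_op t k D1 ent S - edge_op t k D2 ent S = (?b * ?c - ?a * ?d) / (?c * (?c + ?d))" .
  have "?b * ?c \<le> ?d * ?s * ?c" "?a * ?d \<le> ?c * ?s * ?d" "0 \<le> ?b * ?c" "0 \<le> ?a * ?d"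
    using a b by (auto intro: mult_right_mono)
  then have "\<bar>?b * ?c - ?a * ?d\<bar> \<le> ?d * ?s * ?c" by (simp add: mult_ac)
  then have "\<bar>(?b * ?c - ?a * ?d) / (?c * (?c + ?d))\<bar> \<le> ?d * ?s * ?c / (?c * (?c + ?d))"
  proof -
    have r: "\<bar>x / y\<bar> \<le> z / y" if "\<bar>x\<bar> \<le> z" "y > 0" for x y z :: real
      using that by (metis abs_div_pos divide_right_mono less_imp_le)
    show ?thesis by (rule r[OF \<open>\<bar>?b * ?c - ?a * ?d\<bar> \<le> ?d * ?s * ?c\<close>]) (use c in simp)
  qed
  also have "\<dots> = (1 - ?c / (?c + ?d)) * ?s"
  proof -
    have "d * s * c / (c * (c + d)) = (1 - c / (c + d)) * s" if "c > 0" "d \<ge> 0" for c d s :: real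
    proof -
      have "1 - c / (c + d) = d / (c + d)" using that by (simp add: diff_divide_eq_iff)
      then show ?thesis using that by simp
    qed
    then show ?thesis using c by simp
  qed
  finally have "\<bar>edge_op t k D1 ent S - edge_op t k D2 ent S\<bar> \<le> (1 - ?c / (?c + ?d)) * ?s"
    unfolding eq .
  then show ?thesis unfolding card .
qed

definition sorted_edges :: "nat \<Rightarrow> nat \<Rightarrow> nat list set" where
  "sorted_edges n k = sorted_list_of_set ` {e. e \<subseteq> {..<n} \<and> card e = k}"

definition distinct_edges :: "nat \<Rightarrow> nat \<Rightarrow> nat list set" where
  "distinct_edges n k = {js \<in> all_edges k {..<n}. distinct js}"

definition permute_fun :: "nat \<Rightarrow> (nat \<Rightarrow> nat) \<Rightarrow> (bool list \<Rightarrow> bool) \<Rightarrow> bool list \<Rightarrow> bool" where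
  "permute_fun k p \<sigma> = (\<lambda>z\<in>cube k. \<sigma> (permute_list p z))"

lemma permute_list_in_cube [simp]: "permute_list p z \<in> cube k \<longleftrightarrow> z \<in> cube k"
  by (simp add: cube_def)

lemma permute_list_inverse:
  assumes "p permutes {..<k}" "z \<in> cube k"
  shows "permute_list p (permute_list (inv p) z) = z" "permute_list (inv p) (permute_list p z) = z"
proof -
  have ip: "inv p permutes {..<k}" by (rule permutes_inv[OF assms(1)])
  have k: "length z = k" using assms by (simp add: cube_def)
  show "permute_list p (permute_list (inv p) z) = z"
    using permute_list_compose[of p z "inv p"] assms(1) k permutes_inv_o(2)[OF assms(1)] by simp
  show "permute_list (inv p) (permute_list p z) = z"
    using permute_list_compose[of "inv p" z p] ip k permutes_inv_o(1)[OF assms(1)] by simp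
qed

lemma permute_list_eq_iff:
  assumes "p permutes {..<k}" "z \<in> cube k" "x \<in> cube k"
  shows "permute_list p z = x \<longleftrightarrow> z = permute_list (inv p) x"
  using permute_list_inverse[OF assms(1)] assms(2,3) by metis

lemma xor_list_permute:
  assumes "p permutes {..<length z}"
  shows "xor_list (permute_list p z) = xor_list z"
proof -
  have "sg (xor_list (permute_list p z)) = sg (xor_list z)"
    unfolding sg_xor_list prod_mset_prod_list[symmetric] using mset_permute_list[OF assms] by simp
  then show ?thesis by (simp add: sg_def split: if_splits)
qed

lemma permute_fun_clause_functions:
  assumes p: "p permutes {..<k}" and \<sigma>: "\<sigma> \<in> clause_functions t k"
  shows "permute_fun k p \<sigma> \<in> clause_functions t k"
proof (cases t)
  case SAT
  then obtain x where x: "x \<in> cube k" "\<sigma> = sat_fun k x"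
    using \<sigma> unfolding SAT clause_functions_image by blast
  have "permute_fun k p \<sigma> = sat_fun k (permute_list (inv p) x)"
    unfolding x(2) permute_fun_def sat_fun_def
    by (rule restrict_ext) (use x permute_list_eq_iff[OF p] in auto)
  then show ?thesis using x unfolding SAT clause_functions_image by simp
next
  case NAESAT
  then obtain x where x: "x \<in> cube k" "\<sigma> = nae_fun k x"
    using \<sigma> unfolding NAESAT clause_functions_image by blast
  have len: "length x = k" using x by (simp add: cube_def)
  have Not: "permute_list (inv p) (map Not x) = map Not (permute_list (inv p) x)"
    using permutes_inv[OF p] len by (simp add: permute_list_map)
  have "permute_fun k p \<sigma> = nae_fun k (permute_list (inv p) x)"
    unfolding x(2) permute_fun_def nae_fun_def
    by (rule restrict_ext) (use x permute_list_eq_iff[OF p] Not in auto)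
  then show ?thesis using x unfolding NAESAT clause_functions_image by simp
next
  case XORSAT
  then obtain b where b: "\<sigma> = xor_fun k b"
    using \<sigma> unfolding XORSAT clause_functions_image by blast
  have "permute_fun k p \<sigma> = xor_fun k b"
    unfolding b permute_fun_def xor_fun_def
    by (rule restrict_ext) (use p in \<open>auto simp: xor_list_permute cube_def\<close>)
  then show ?thesis unfolding XORSAT clause_functions_image by simp
qed

lemma clause_functions_extensional:
  assumes "\<sigma> \<in> clause_functions t k"
  shows "restrict \<sigma> (cube k) = \<sigma>"
  using assms by (cases t) auto

text \<open>
  Permuting the inputs of a clause function yields a clause function of the same type, so the
  order in which an edge is read is irrelevant after averaging over the clause functions.
\<close>
lemma edge_avg_permute:
  assumes p: "p permutes {..<k}" and js: "length js = k"
  shows "edge_avg t k (permute_list p js) g S = edge_avg t k js g S"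
proof -
  let ?X = "clause_functions t k"
  have ip: "inv p permutes {..<k}" by (rule permutes_inv[OF p])
  have inverse: "permute_fun k r (permute_fun k r' \<sigma>) = \<sigma>"
    if "\<sigma> \<in> ?X" and r: "\<And>z. z \<in> cube k \<Longrightarrow> permute_list r' (permute_list r z) = z" for \<sigma> r r'
  proof -
    have "permute_fun k r (permute_fun k r' \<sigma>) = restrict \<sigma> (cube k)"
      unfolding permute_fun_def by (rule restrict_ext) (simp add: r)
    then show ?thesis using clause_functions_extensional[OF that(1)] by simp
  qed
  have bij: "bij_betw (permute_fun k p) ?X ?X"
  proof (rule bij_betw_byWitness[where f' = "permute_fun k (inv p)"])
    show "\<forall>\<sigma>\<in>?X. permute_fun k (inv p) (permute_fun k p \<sigma>) = \<sigma>"
      using inverse permute_list_inverse[OF p] by blast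
    show "\<forall>\<sigma>\<in>?X. permute_fun k p (permute_fun k (inv p) \<sigma>) = \<sigma>"
      using inverse permute_list_inverse[OF p] by blast
  qed (use permute_fun_clause_functions p ip in blast)+
  have "(\<Sum>\<sigma>\<in>?X. g (S \<inter> clause_sols js (permute_fun k p \<sigma>))) = (\<Sum>\<sigma>\<in>?X. g (S \<inter> clause_sols js \<sigma>))"
    using sum.reindex_bij_betw[OF bij, of "\<lambda>\<sigma>. g (S \<inter> clause_sols js \<sigma>)"] .
  moreover have "clause_sols js (permute_fun k p \<sigma>) = clause_sols (permute_list p js) \<sigma>" for \<sigma>
    using p js by (auto simp: clause_sols_def permute_fun_def cube_def permute_list_map)
  ultimately show ?thesis by (simp add: edge_avg_def)
qed

lemma edge_avg_sorted:
  assumes "js \<in> distinct_edges n k"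
  shows "edge_avg t k js g S = edge_avg t k (sorted_list_of_set (set js)) g S"
proof -
  let ?s = "sorted_list_of_set (set js)"
  have js: "distinct js" "length js = k" using assms by (auto simp: distinct_edges_def all_edges_def)
  have "mset js = mset ?s" using set_eq_iff_mset_eq_distinct[OF js(1), of ?s] by simp
  then obtain p where p: "p permutes {..<length ?s}" "permute_list p ?s = js"
    by (rule mset_eq_permutation)
  have "length ?s = k" using js by (simp add: distinct_card)
  then show ?thesis using edge_avg_permute[of p k ?s t g S] p by simp
qed

lemma finite_k_subsets: "finite {e. e \<subseteq> {..<n::nat} \<and> card e = k}"
  by (rule finite_subset[of _ "Pow {..<n}"]) auto

lemma inj_sorted_list: "inj_on sorted_list_of_set {e. e \<subseteq> {..<n::nat} \<and> card e = k}"
  by (rule inj_onI) (metis (mono_tags, lifting) finite_lessThan finite_subset mem_Collect_eq set_sorted_list_of_set)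

lemma sum_sorted_edges: "(\<Sum>js\<in>sorted_edges n k. f js) = (\<Sum>e | e \<subseteq> {..<n} \<and> card e = k. f (sorted_list_of_set e) :: real)"
  unfolding sorted_edges_def by (subst sum.reindex[OF inj_sorted_list]) simp

lemma distinct_edges_fibre:
  "e \<subseteq> {..<n} \<Longrightarrow> card e = k \<Longrightarrow> {js \<in> distinct_edges n k. set js = e} = permutations_of_set e"
  by (auto simp: distinct_edges_def all_edges_def permutations_of_set_def distinct_card)

lemma finite_distinct_edges: "finite (distinct_edges n k)"
  unfolding distinct_edges_def by (rule finite_subset[OF _ finite_all_edges[of "{..<n}" k]]) auto

text \<open>
  Every set of \<open>k\<close> variables arises from \<open>k!\<close> lists without repetition.
\<close>
lemma sum_distinct_edges:
  assumes "\<And>js. js \<in> distinct_edges n k \<Longrightarrow> f js = f (sorted_list_of_set (set js))"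
  shows "(\<Sum>js\<in>distinct_edges n k. f js) = fact k * (\<Sum>js\<in>sorted_edges n k. f js :: real)"
proof -
  let ?E = "{e. e \<subseteq> {..<n} \<and> card e = k}"
  have img: "set ` distinct_edges n k \<subseteq> ?E" by (auto simp: distinct_edges_def all_edges_def distinct_card)
  have "(\<Sum>js\<in>distinct_edges n k. f js) = (\<Sum>js\<in>distinct_edges n k. f (sorted_list_of_set (set js)))"
    using assms by (intro sum.cong) auto
  also have "\<dots> = (\<Sum>e\<in>?E. \<Sum>js\<in>{js \<in> distinct_edges n k. set js = e}. f (sorted_list_of_set (set js)))"
    by (rule sum.group[OF finite_distinct_edges finite_k_subsets img, symmetric])
  also have "\<dots> = (\<Sum>e\<in>?E. fact k * f (sorted_list_of_set e))"
  proof (rule sum.cong)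
    fix e assume e: "e \<in> ?E"
    then have "finite e" using finite_subset by auto
    then have "card {js \<in> distinct_edges n k. set js = e} = fact k"
      using e by (simp add: distinct_edges_fibre)
    moreover have "(\<Sum>js\<in>{js \<in> distinct_edges n k. set js = e}. f (sorted_list_of_set (set js)))
      = (\<Sum>js\<in>{js \<in> distinct_edges n k. set js = e}. f (sorted_list_of_set e))" by (rule sum.cong) auto
    ultimately show "(\<Sum>js\<in>{js \<in> distinct_edges n k. set js = e}. f (sorted_list_of_set (set js))) = fact k * f (sorted_list_of_set e)"
      by simp
  qed simp
  finally show ?thesis by (simp add: sum_sorted_edges sum_distrib_left)
qed

lemma edge_op_distinct: "edge_op t k (distinct_edges n k) g S = edge_op t k (sorted_edges n k) g S"
proof -
  have "real (card (distinct_edges n k)) = fact k * real (card (sorted_edges n k))"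
    using sum_distinct_edges[of n k "\<lambda>_. 1"] by simp
  then show ?thesis unfolding edge_op_def
    using sum_distinct_edges[of n k "\<lambda>js. edge_avg t k js g S"] edge_avg_sorted by simp
qed

lemma edge_set_distinct:
  assumes "k \<le> n" shows "edge_set n k (distinct_edges n k)"
proof -
  have "[0..<k] \<in> distinct_edges n k" using assms by (auto simp: distinct_edges_def all_edges_def)
  then show ?thesis by (auto simp: edge_set_def finite_distinct_edges) (auto simp: distinct_edges_def all_edges_def)
qed

lemma card_distinct_edges_ge:
  assumes "k \<le> n" "0 < n"
  shows "1 - (real k)\<^sup>2 / real n \<le> real (card (distinct_edges n k)) / real n ^ k"
proof -
  have "distinct_edges n k = {xs. length xs = k \<and> distinct xs \<and> set xs \<subseteq> {..<n}}"
    by (auto simp: distinct_edges_def all_edges_def)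
  then have c: "card (distinct_edges n k) = \<Prod>{n - k + 1..n}"
    using card_lists_distinct_length_eq[of "{..<n}" k] assms by simp
  have "(\<Prod>i<k. real (n - i)) = real (\<Prod>{n - k + 1..n})"
  proof -
    have "{n - k + 1..n} = (\<lambda>i. n - i) ` {..<k}"
    proof (intro set_eqI iffI)
      fix x assume "x \<in> {n - k + 1..n}"
      then have "x = n - (n - x)" "n - x < k" using assms(1) by auto
      then show "x \<in> (\<lambda>i. n - i) ` {..<k}" by blast
    qed (use assms in auto)
    moreover have "inj_on (\<lambda>i. n - i) {..<k}" using assms by (auto simp: inj_on_def)
    ultimately show ?thesis by (simp add: prod.reindex)
  qed
  then have "real (card (distinct_edges n k)) / real n ^ k = (\<Prod>i<k. real (n - i) / real n)"
    by (simp add: c prod_dividef)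
  also have "\<dots> = (\<Prod>i<k. 1 - real i / real n)"
    using assms by (intro prod.cong) (auto simp: of_nat_diff diff_divide_distrib)
  finally have prod: "real (card (distinct_edges n k)) / real n ^ k = (\<Prod>i<k. 1 - real i / real n)" .
  have "(\<Sum>i<k. real i / real n) \<le> (\<Sum>i<k. real k / real n)"
    by (intro sum_mono divide_right_mono) auto
  moreover have "1 - (\<Sum>i<k. real i / real n) \<le> (\<Prod>i<k. 1 - real i / real n)"
    by (rule Weierstrass_prod_ineq) (use assms in auto)
  ultimately show ?thesis unfolding prod by (simp add: power2_eq_square)
qed

text \<open>
  Both sides are compared with the uniform distribution on all lists over \<open>{..<n}\<close>: few lists have a
  repetition, and few meet the variables outside \<open>{..<N}\<close>.
\<close>
lemma edge_op_sorted_close: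
  assumes t: "valid_arity t k" and n: "k \<le> n" "0 < N" "N \<le> n" and S: "finite S"
  shows "\<bar>edge_op t k (sorted_edges n k) ent S - edge_op t k (all_edges k {..<N}) ent S\<bar>
    \<le> ((real k)\<^sup>2 + real k * real (n - N)) / real n * real (card S)"
proof -
  let ?F = "all_edges k {..<n}" and ?s = "real (card S)"
  have n0: "0 < n" using n by simp
  have F: "edge_set n k ?F" using n0 by (intro edge_set_all_edges) (auto simp: lessThan_empty_iff)
  have cF: "real (card ?F) = real n ^ k" by (simp add: card_all_edges)
  have D: "distinct_edges n k \<subseteq> ?F" "distinct_edges n k \<noteq> {}"
    using edge_set_distinct[OF n(1)] by (auto simp: distinct_edges_def edge_set_def)
  have A: "all_edges k {..<N} \<subseteq> ?F" "all_edges k {..<N} \<noteq> {}"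
    using edge_set_all_edges[of "{..<N}" N k] n by (auto simp: all_edges_def edge_set_def lessThan_empty_iff)
  have 1: "\<bar>edge_op t k (distinct_edges n k) ent S - edge_op t k ?F ent S\<bar> \<le> (real k)\<^sup>2 / real n * ?s"
    using card_distinct_edges_ge[OF n(1) n0]
    by (intro order_trans[OF edge_op_subset_close[OF t F D S]] mult_right_mono) (auto simp: cF)
  have "1 + real k * (real N / real n - 1) \<le> (1 + (real N / real n - 1)) ^ k"
    by (rule Bernoulli_inequality) (use n0 in auto)
  then have "1 - real (card (all_edges k {..<N})) / real (card ?F) \<le> real k * (1 - real N / real n)"
    by (simp add: card_all_edges power_divide algebra_simps)
  also have "1 - real N / real n = real (n - N) / real n"
    using n n0 by (simp add: of_nat_diff diff_divide_distrib)
  finally have 2: "\<bar>edge_op t k (all_edges k {..<N}) ent S - edge_op t k ?F ent S\<bar> \<le> real k * (real (n - N) / real n) * ?s"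
    by (intro order_trans[OF edge_op_subset_close[OF t F A S]] mult_right_mono) auto
  have "\<bar>edge_op t k (distinct_edges n k) ent S - edge_op t k (all_edges k {..<N}) ent S\<bar>
     \<le> (real k)\<^sup>2 / real n * ?s + real k * (real (n - N) / real n) * ?s"
    using 1 2 by linarith
  also have "\<dots> = ((real k)\<^sup>2 + real k * real (n - N)) / real n * ?s"
    by (simp add: add_divide_distrib distrib_right)
  finally show ?thesis by (simp only: edge_op_distinct)
qed

text \<open>
  The mean of \<open>ln Z\<close> for \<open>m\<close> independent planted clauses with edges uniform in \<open>D\<close>.
\<close>
definition mean_ent :: "clause_type \<Rightarrow> nat \<Rightarrow> nat list set \<Rightarrow> nat \<Rightarrow> nat \<Rightarrow> real" where
  "mean_ent t k D n m = (edge_op t k D ^^ m) ent (cube n) / 2 ^ n"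

lemma edge_set_sorted: "k \<le> n \<Longrightarrow> edge_set n k (sorted_edges n k)"
proof -
  assume "k \<le> n"
  then have "{..<k} \<subseteq> {..<n}" "card {..<k} = k" by auto
  then have ne: "sorted_edges n k \<noteq> {}" unfolding sorted_edges_def by blast
  have "length js = k \<and> set js \<subseteq> {..<n}" if "js \<in> sorted_edges n k" for js
  proof -
    obtain e where e: "e \<subseteq> {..<n}" "card e = k" "js = sorted_list_of_set e"
      using \<open>js \<in> sorted_edges n k\<close> unfolding sorted_edges_def by blast
    have "finite e" by (rule finite_subset[OF e(1)]) simp
    then show ?thesis using e by simp
  qed
  then show ?thesis using ne unfolding edge_set_def by (simp add: sorted_edges_def finite_k_subsets)
qed

lemma mean_ent_sorted_close:
  assumes t: "valid_arity t k" and n: "k \<le> n" "0 < N" "N \<le> n"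
  shows "\<bar>mean_ent t k (sorted_edges n k) n m - mean_ent t k (all_edges k {..<N}) n m\<bar>
    \<le> real m * (((real k)\<^sup>2 + real k * real (n - N)) / real n)"
proof -
  let ?A = "edge_op t k (sorted_edges n k)" and ?B = "edge_op t k (all_edges k {..<N})"
  let ?c = "((real k)\<^sup>2 + real k * real (n - N)) / real n"
  have A: "averaging (sol_class t n) ?A" by (rule averaging_edge_op[OF t edge_set_sorted[OF n(1)]])
  have B: "averaging (sol_class t n) ?B" by (rule averaging_all_edges[OF t n(2,3)])
  have comm: "?A (?B g) = ?B (?A g)" for g
    by (rule edge_op_commute)
  have close: "\<bar>?A ent S - ?B ent S\<bar> \<le> ?c * real (card S)" if "sol_class t n S" for S
    by (rule edge_op_sorted_close[OF t n sol_class_finite[OF that]])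
  have "(?A ^^ m) ent (cube n) \<le> (?B ^^ m) ent (cube n) + real m * ?c * real (card (cube n))"
  proof (rule hybrid_const[OF A B comm _ sol_class_cube])
    show "?A ent S \<le> ?B ent S + ?c * real (card S)" if "sol_class t n S" for S
      using close[OF that] unfolding abs_le_iff by linarith
  qed
  moreover have "(?B ^^ m) ent (cube n) \<le> (?A ^^ m) ent (cube n) + real m * ?c * real (card (cube n))"
  proof (rule hybrid_const[OF B A comm[symmetric] _ sol_class_cube])
    show "?B ent S \<le> ?A ent S + ?c * real (card S)" if "sol_class t n S" for S
      using close[OF that] unfolding abs_le_iff by linarith
  qed
  ultimately have "\<bar>(?A ^^ m) ent (cube n) - (?B ^^ m) ent (cube n)\<bar> \<le> real m * ?c * 2 ^ n"
    by simp
  then show ?thesis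
    by (simp add: mean_ent_def divide_le_eq flip: diff_divide_distrib)
qed

lemma mean_ent_decreasing:
  assumes t: "valid_arity t k" and D: "edge_set n k D"
  shows "mean_ent t k D n (Suc m) \<le> mean_ent t k D n m" "mean_ent t k D n m - 1 \<le> mean_ent t k D n (Suc m)"
proof -
  have T: "averaging (sol_class t n) (edge_op t k D ^^ m)"
    by (intro averaging_funpow averaging_edge_op t D)
  let ?T = "edge_op t k D"
  have "(?T ^^ m) ent (cube n) - 2 ^ n = (?T ^^ m) (\<lambda>S. 1 * ent S + (-1) * real (card S)) (cube n)"
    unfolding averaging_linear[OF T] averaging_card[OF T sol_class_cube] by simp
  also have "\<dots> \<le> (?T ^^ m) (?T ent) (cube n)"
    using edge_op_ent_bounds(1)[OF t D] by (intro averaging_mono[OF T _ sol_class_cube]) (simp add: sol_class_finite)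
  finally have "((?T ^^ m) ent (cube n) - 2 ^ n) / 2 ^ n \<le> (?T ^^ Suc m) ent (cube n) / 2 ^ n"
    by (simp add: funpow_swap1 divide_right_mono)
  then show "mean_ent t k D n m - 1 \<le> mean_ent t k D n (Suc m)"
    by (simp add: mean_ent_def diff_divide_distrib)
  have "(?T ^^ m) (?T ent) (cube n) \<le> (?T ^^ m) ent (cube n)"
    using edge_op_ent_bounds(2)[OF t D] by (intro averaging_mono[OF T _ sol_class_cube]) (simp add: sol_class_finite)
  then show "mean_ent t k D n (Suc m) \<le> mean_ent t k D n m"
    by (simp add: mean_ent_def funpow_swap1 divide_right_mono)
qed

lemma mean_ent_Lipschitz:
  assumes t: "valid_arity t k" and D: "edge_set n k D"
  shows "\<bar>mean_ent t k D n i - mean_ent t k D n j\<bar> \<le> \<bar>real i - real j\<bar>"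
proof -
  have "0 \<le> mean_ent t k D n i - mean_ent t k D n (i + d) \<and> mean_ent t k D n i - mean_ent t k D n (i + d) \<le> real d" for i d
  proof (induction d)
    case (Suc d)
    then show ?case using mean_ent_decreasing[OF t D, of "i + d"] by simp
  qed simp
  from this[of i "j - i"] this[of j "i - j"] show ?thesis
    by (cases "i \<le> j") (auto simp: of_nat_diff)
qed




section \<open>Splitting into blocks\<close>

definition seg :: "nat \<Rightarrow> nat \<Rightarrow> bool list \<Rightarrow> bool list" where
  "seg l b y = take l (drop (b * l) y)"

lemma seg_in_cube: "y \<in> cube n \<Longrightarrow> Suc b * l \<le> n \<Longrightarrow> seg l b y \<in> cube l"
  by (simp add: seg_def cube_def)

lemma nth_seg: "y \<in> cube n \<Longrightarrow> Suc b * l \<le> n \<Longrightarrow> i < l \<Longrightarrow> seg l b y ! i = y ! (b * l + i)"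
  by (simp add: seg_def cube_def)

lemma card_le_prod_seg:
  assumes S: "S \<subseteq> cube (q * l + r)"
  shows "card S \<le> (\<Prod>b<q. card (seg l b ` S)) * 2 ^ r"
proof -
  let ?f = "\<lambda>y. (\<lambda>b\<in>{..<q}. seg l b y, drop (q * l) y)"
  let ?R = "(\<Pi>\<^sub>E b\<in>{..<q}. seg l b ` S) \<times> cube r"
  have fin: "finite S" by (rule finite_subset[OF S finite_cube])
  have "inj_on ?f S"
  proof (rule inj_onI)
    fix y z assume y: "y \<in> S" and z: "z \<in> S" and eq: "?f y = ?f z"
    have len: "length y = q * l + r" "length z = q * l + r" using y z S by (auto simp: cube_def)
    have segs: "seg l b y = seg l b z" if "b < q" for b
      using eq that by (metis (mono_tags, lifting) Pair_inject lessThan_iff restrict_apply')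
    have tl: "drop (q * l) y = drop (q * l) z" using eq by simp
    show "y = z"
    proof (rule nth_equalityI)
      fix i assume i: "i < length y"
      show "y ! i = z ! i"
      proof (cases "i < q * l")
        case True
        then have l: "0 < l" by (cases l) auto
        have b: "i div l < q" using True by (simp add: less_mult_imp_div_less)
        then have le: "Suc (i div l) * l \<le> q * l" by (intro mult_le_mono1) simp
        have "y ! i = seg l (i div l) y ! (i mod l)" "z ! i = seg l (i div l) z ! (i mod l)"
          using nth_seg[of y "q * l + r" "i div l" l "i mod l"] nth_seg[of z "q * l + r" "i div l" l "i mod l"]
            len l le by (simp_all add: cube_def)
        then show ?thesis using segs[OF b] by simp
      next
        case False
        then have "y ! i = drop (q * l) y ! (i - q * l)" "z ! i = drop (q * l) z ! (i - q * l)"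
          using i len by simp_all
        then show ?thesis using tl by simp
      qed
    qed (simp add: len)
  qed
  moreover have "?f ` S \<subseteq> ?R"
  proof (rule image_subsetI)
    fix y assume "y \<in> S"
    then show "?f y \<in> ?R" using S by (auto simp: restrict_PiE_iff cube_def)
  qed
  moreover have "finite ?R" using fin by (intro finite_cartesian_product finite_PiE) auto
  ultimately have "card S \<le> card ?R" by (rule card_inj_on_le)
  also have "card ?R = (\<Prod>b<q. card (seg l b ` S)) * 2 ^ r"
    by (simp add: card_cartesian_product card_PiE)
  finally show ?thesis .
qed

definition ent_seg :: "nat \<Rightarrow> nat \<Rightarrow> bool list set \<Rightarrow> real" where
  "ent_seg l b S = real (card S) * ln (real (card (seg l b ` S)))"

text \<open>
  A set of assignments embeds into the product of its restrictions to the blocks and to the \<open>r\<close>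
  remaining variables.
\<close>
lemma ent_le_sum_ent_seg:
  assumes S: "S \<subseteq> cube (q * l + r)"
  shows "ent S \<le> (\<Sum>b<q. ent_seg l b S) + real r * real (card S)"
proof (cases "S = {}")
  case True
  then show ?thesis by (simp add: ent_def ent_seg_def)
next
  case False
  have fin: "finite S" by (rule finite_subset[OF S finite_cube])
  have pos: "card (seg l b ` S) > 0" for b using False fin by (simp add: card_gt_0_iff)
  have "real (card S) \<le> real ((\<Prod>b<q. card (seg l b ` S)) * 2 ^ r)"
    using card_le_prod_seg[OF S] by (simp only: of_nat_le_iff)
  then have "ln (real (card S)) \<le> ln ((\<Prod>b<q. real (card (seg l b ` S))) * 2 ^ r)"
    using False fin by (intro ln_mono) (auto simp: card_gt_0_iff)
  also have "\<dots> = (\<Sum>b<q. ln (real (card (seg l b ` S)))) + real r * ln 2"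
    using pos by (subst ln_mult) (auto simp: ln_prod ln_realpow intro!: prod_pos)
  also have "\<dots> \<le> (\<Sum>b<q. ln (real (card (seg l b ` S)))) + real r * 1"
    using ln_2_less_1 by (intro add_left_mono mult_left_mono) auto
  finally have "real (card S) * ln (real (card S)) \<le> real (card S) * ((\<Sum>b<q. ln (real (card (seg l b ` S)))) + real r * 1)"
    by (intro mult_left_mono) auto
  then show ?thesis by (simp add: ent_def ent_seg_def distrib_left sum_distrib_left mult.commute)
qed

lemma edge_op_block_edges:
  assumes "1 \<le> k" "0 < l"
  shows "edge_op t k (block_edges k q l) g S = (\<Sum>b<q. edge_op t k (all_edges k (block l b)) g S) / real q"
  by (simp add: edge_op_def sum_block_edges[OF assms(1)] card_block_edges[OF assms(1)] card_all_edges
      flip: sum_divide_distrib)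

lemma edge_set_block:
  assumes "b < q" "0 < l" "q * l \<le> n"
  shows "edge_set n k (all_edges k (block l b))"
proof (rule edge_set_all_edges)
  show "block l b \<noteq> {}" using card_block[of l b] assms(2) by (metis card.empty less_irrefl)
qed (simp_all add: block_subset[OF assms(1,3)])

text \<open>
  For clauses outside the block \<open>b\<close> it suffices that they do not raise the entropy of the block.
\<close>
lemma edge_op_ent_seg_le:
  assumes "valid_arity t k" "edge_set n k D" "finite S"
  shows "edge_op t k D (ent_seg l b) S \<le> ent_seg l b S"
proof (rule edge_op_le[OF assms(2)])
  fix js assume "js \<in> D"
  then have js: "length js = k" using assms(2) by (simp add: edge_set_def)
  have "ln (real (card (seg l b ` A))) \<le> ln (real (card (seg l b ` B)))" if "A \<subseteq> B" "B \<subseteq> S" "A \<noteq> {}" for A B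
  proof -
    have "finite B" using that(2) assms(3) by (rule finite_subset)
    then have "card (seg l b ` A) \<le> card (seg l b ` B)" "0 < card (seg l b ` A)"
      using that(1,3) by (auto simp: card_gt_0_iff intro!: card_mono image_mono dest: finite_subset)
    then show ?thesis by simp
  qed
  from edge_avg_card_mult_le[OF assms(3) js assms(1) this]
  show "edge_avg t k js (ent_seg l b) S \<le> ent_seg l b S"
    unfolding ent_seg_def[abs_def] .
qed

text \<open>
  The mean of \<open>a\<close> under the binomial distribution with parameters \<open>m\<close> and \<open>x\<close>. The recursion is that of
  \<open>m\<close> clauses each of which falls into a given block with probability \<open>x\<close>.
\<close>
fun bin_avg :: "real \<Rightarrow> nat \<Rightarrow> (nat \<Rightarrow> real) \<Rightarrow> real" where
  "bin_avg x 0 a = a 0"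
| "bin_avg x (Suc m) a = x * bin_avg x m (\<lambda>j. a (Suc j)) + (1 - x) * bin_avg x m a"

lemma bin_avg_mono:
  assumes "0 \<le> x" "x \<le> 1" "\<And>j. a j \<le> c j"
  shows "bin_avg x m a \<le> bin_avg x m c"
  using assms(3)
proof (induction m arbitrary: a c)
  case (Suc m)
  then show ?case using assms(1,2) by (auto intro!: add_mono mult_left_mono)
qed simp

lemma bin_avg_linear: "bin_avg x m (\<lambda>j. u * a j + v * c j) = u * bin_avg x m a + v * bin_avg x m c"
  by (induction m arbitrary: a c) (auto simp: algebra_simps)

lemma bin_avg_const: "bin_avg x m (\<lambda>j. c) = c"
  by (induction m) (auto simp: algebra_simps)

text \<open>
  Variance plus squared distance of the mean from \<open>c\<close>.
\<close>
lemma bin_avg_square: "bin_avg x m (\<lambda>j. (real j - c)\<^sup>2) = real m * x * (1 - x) + (real m * x - c)\<^sup>2"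
proof (induction m arbitrary: c)
  case (Suc m)
  have "(\<lambda>j. (real (Suc j) - c)\<^sup>2) = (\<lambda>j. (real j - (c - 1))\<^sup>2)" by (simp add: fun_eq_iff algebra_simps)
  then have "bin_avg x (Suc m) (\<lambda>j. (real j - c)\<^sup>2) =
      x * bin_avg x m (\<lambda>j. (real j - (c - 1))\<^sup>2) + (1 - x) * bin_avg x m (\<lambda>j. (real j - c)\<^sup>2)"
    by (simp only: bin_avg.simps)
  also have "\<dots> = real (Suc m) * x * (1 - x) + (real (Suc m) * x - c)\<^sup>2"
    unfolding Suc by (simp add: power2_eq_square algebra_simps)
  finally show ?case .
qed simp

lemma abs_le_quadratic:
  fixes x s :: real
  assumes "0 < s"
  shows "\<bar>x\<bar> \<le> s + x\<^sup>2 / s"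
proof (cases "\<bar>x\<bar> \<le> s")
  case False
  then have "\<bar>x\<bar> * s \<le> \<bar>x\<bar> * \<bar>x\<bar>" by (intro mult_left_mono) auto
  then have "\<bar>x\<bar> \<le> x\<^sup>2 / s" using assms by (simp add: pos_le_divide_eq power2_eq_square)
  then show ?thesis using assms by linarith
qed (use assms in \<open>simp add: add_increasing2\<close>)

lemma bin_avg_Lipschitz:
  assumes "0 \<le> x" "x \<le> 1" "0 < s" "\<And>i j. \<bar>a i - a j\<bar> \<le> \<bar>real i - real j\<bar>"
  shows "bin_avg x m a \<le> a i + (s + (real m * x + (real m * x - real i)\<^sup>2) / s)"
proof -
  have "a j \<le> 1 * (a i + s) + (1 / s) * (real j - real i)\<^sup>2" for j
    using assms(4)[of j i] abs_le_quadratic[OF assms(3), of "real j - real i"] by simp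
  then have "bin_avg x m a \<le> bin_avg x m (\<lambda>j. 1 * (a i + s) + (1 / s) * (real j - real i)\<^sup>2)"
    by (rule bin_avg_mono[OF assms(1,2)])
  also have "\<dots> = a i + s + (real m * x * (1 - x) + (real m * x - real i)\<^sup>2) / s"
    unfolding bin_avg_linear bin_avg_const bin_avg_square by simp
  also have "\<dots> \<le> a i + s + (real m * x * 1 + (real m * x - real i)\<^sup>2) / s"
    using assms by (intro add_left_mono divide_right_mono add_right_mono mult_left_mono) auto
  finally show ?thesis by simp
qed

text \<open>
  If every application of \<open>T\<close> acts on \<open>g\<close> as \<open>B\<close> with probability \<open>x\<close> and otherwise does nothing, then \<open>B\<close> is
  applied a binomial number of times.
\<close>
lemma funpow_le_bin_avg:
  assumes T: "averaging P T" and B: "averaging P B" and comm: "\<And>g. T (B g) = B (T g)"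
    and x: "0 \<le> x" "x \<le> 1"
    and step: "\<And>S. P S \<Longrightarrow> T g S \<le> x * B g S + (1 - x) * g S"
    and S: "P S"
  shows "(T ^^ m) ((B ^^ i) g) S \<le> bin_avg x m (\<lambda>j. (B ^^ (j + i)) g S)"
  using S
proof (induction m arbitrary: i)
  case (Suc m)
  have Tm: "averaging P (T ^^ m)" and Bi: "averaging P (B ^^ i)" for i
    by (intro averaging_funpow T B)+
  have "(T ^^ Suc m) ((B ^^ i) g) S = (T ^^ m) (T ((B ^^ i) g)) S" by (simp add: funpow_swap1)
  also have "\<dots> \<le> (T ^^ m) (\<lambda>S. x * (B ^^ Suc i) g S + (1 - x) * (B ^^ i) g S) S"
  proof (rule averaging_mono[OF Tm _ Suc.prems])
    fix S assume S: "P S"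
    have "T ((B ^^ i) g) S = (B ^^ i) (T g) S"
      using funpow_commute_op[of B T i g] comm by simp
    also have "\<dots> \<le> (B ^^ i) (\<lambda>S. x * B g S + (1 - x) * g S) S"
      by (rule averaging_mono[OF Bi step S])
    also have "\<dots> = x * (B ^^ Suc i) g S + (1 - x) * (B ^^ i) g S"
      unfolding averaging_linear[OF Bi] by (simp add: funpow_swap1)
    finally show "T ((B ^^ i) g) S \<le> x * (B ^^ Suc i) g S + (1 - x) * (B ^^ i) g S" .
  qed
  also have "\<dots> = x * (T ^^ m) ((B ^^ Suc i) g) S + (1 - x) * (T ^^ m) ((B ^^ i) g) S"
    by (rule averaging_linear[OF Tm])
  also have "\<dots> \<le> x * bin_avg x m (\<lambda>j. (B ^^ (j + Suc i)) g S) + (1 - x) * bin_avg x m (\<lambda>j. (B ^^ (j + i)) g S)"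
    using x by (intro add_mono mult_left_mono Suc.IH Suc.prems) auto
  finally show ?case by simp
qed simp

text \<open>
  On cylinders over a block, clauses inside the block act as they do on \<open>l\<close> variables. So a block
  behaves like a formula of its own.
\<close>
definition cyl :: "nat \<Rightarrow> nat \<Rightarrow> nat \<Rightarrow> bool list set \<Rightarrow> bool list set" where
  "cyl n l b S = {y \<in> cube n. seg l b y \<in> S}"

lemma card_cyl:
  assumes "Suc b * l \<le> n" "S \<subseteq> cube l"
  shows "card (cyl n l b S) = 2 ^ (n - l) * card S" "seg l b ` cyl n l b S = S"
proof -
  let ?w = "n - Suc b * l"
  let ?A = "cube (b * l) \<times> S \<times> cube ?w"
  let ?f = "\<lambda>(u, s, w). u @ s @ w"
  have "bij_betw ?f ?A (cyl n l b S)"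
  proof (rule bij_betw_byWitness[where f' = "\<lambda>y. (take (b * l) y, seg l b y, drop (Suc b * l) y)"])
    show "\<forall>y\<in>cyl n l b S. ?f (take (b * l) y, seg l b y, drop (Suc b * l) y) = y"
    proof
      fix y
      have "seg l b y @ drop (Suc b * l) y = drop (b * l) y"
        by (simp add: seg_def add.commute[of l] flip: drop_drop) (metis append_take_drop_id drop_drop add.commute)
      then show "?f (take (b * l) y, seg l b y, drop (Suc b * l) y) = y" by simp
    qed
  qed (use assms in \<open>auto simp: cyl_def cube_def seg_def subset_iff\<close>)
  then have "card (cyl n l b S) = card ?A" by (simp add: bij_betw_same_card)
  also have "\<dots> = 2 ^ (b * l + ?w) * card S" by (simp add: card_cartesian_product power_add)
  also have "b * l + ?w = n - l" using assms(1) by simp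
  finally show "card (cyl n l b S) = 2 ^ (n - l) * card S" .
  show "seg l b ` cyl n l b S = S"
  proof (intro equalityI subsetI)
    fix s assume s: "s \<in> S"
    let ?y = "replicate (b * l) False @ s @ replicate ?w False"
    have len: "length s = l" using s assms(2) by (auto simp: cube_def)
    then have "seg l b ?y = s" by (simp add: seg_def)
    moreover have "?y \<in> cyl n l b S" using s len assms(1) \<open>seg l b ?y = s\<close> by (simp add: cyl_def cube_def)
    ultimately show "s \<in> seg l b ` cyl n l b S" by (metis imageI)
  qed (auto simp: cyl_def)
qed

lemma all_edges_block: "all_edges k (block l b) = map ((+) (b * l)) ` all_edges k {..<l}"
proof (intro equalityI subsetI)
  fix js assume js: "js \<in> all_edges k (block l b)"
  have "map ((+) (b * l)) (map (\<lambda>i. i - b * l) js) = js"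
    unfolding map_map by (rule map_idI) (use js in \<open>auto simp: all_edges_def block_def\<close>)
  moreover have "map (\<lambda>i. i - b * l) js \<in> all_edges k {..<l}"
    using js by (auto simp: all_edges_def block_def less_diff_conv2 subset_iff)
  ultimately show "js \<in> map ((+) (b * l)) ` all_edges k {..<l}" by (metis imageI)
next
  fix js assume "js \<in> map ((+) (b * l)) ` all_edges k {..<l}"
  then obtain hs where "hs \<in> all_edges k {..<l}" "js = map ((+) (b * l)) hs" by blast
  then show "js \<in> all_edges k (block l b)" by (auto simp: all_edges_def block_def subset_iff)
qed

lemma edge_op_cyl:
  assumes b: "Suc b * l \<le> n" and S: "S \<subseteq> cube l"
    and g: "\<And>S. S \<subseteq> cube l \<Longrightarrow> g (cyl n l b S) = c * g' S"
  shows "edge_op t k (all_edges k (block l b)) g (cyl n l b S) = c * edge_op t k (all_edges k {..<l}) g' S"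
proof -
  have "edge_avg t k (map ((+) (b * l)) js) g (cyl n l b S) = c * edge_avg t k js g' S" if "js \<in> all_edges k {..<l}" for js
  proof -
    have "cyl n l b S \<inter> clause_sols (map ((+) (b * l)) js) \<sigma> = cyl n l b (S \<inter> clause_sols js \<sigma>)" for \<sigma>
    proof -
      have "map ((!) y) (map ((+) (b * l)) js) = map ((!) (seg l b y)) js" if "y \<in> cube n" for y
        using \<open>js \<in> all_edges k {..<l}\<close> nth_seg[OF that b] by (auto simp: all_edges_def)
      then show ?thesis by (auto simp: cyl_def clause_sols_def simp del: map_map)
    qed
    moreover have "S \<inter> A \<subseteq> cube l" for A using S by blast
    ultimately show ?thesis by (simp add: edge_avg_def g sum_distrib_left[symmetric])
  qed
  moreover have "inj_on (map ((+) (b * l))) (all_edges k {..<l})" by (simp add: inj_on_def)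
  ultimately show ?thesis unfolding edge_op_def all_edges_block
    by (simp add: sum.reindex card_image sum_distrib_left[symmetric])
qed

lemma funpow_edge_op_cyl:
  assumes b: "Suc b * l \<le> n" and S: "S \<subseteq> cube l"
    and g: "\<And>S. S \<subseteq> cube l \<Longrightarrow> g (cyl n l b S) = c * g' S"
  shows "(edge_op t k (all_edges k (block l b)) ^^ j) g (cyl n l b S) = c * (edge_op t k (all_edges k {..<l}) ^^ j) g' S"
  using S
proof (induction j arbitrary: S)
  case (Suc j)
  then show ?case using edge_op_cyl[OF b Suc.prems, of "(edge_op t k (all_edges k (block l b)) ^^ j) g" c] by simp
qed (simp add: g)

lemma ent_seg_cyl:
  assumes "Suc b * l \<le> n" "S \<subseteq> cube l"
  shows "ent_seg l b (cyl n l b S) = 2 ^ (n - l) * ent S"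
  by (simp add: ent_seg_def ent_def card_cyl[OF assms])

text \<open>
  By subadditivity the blocks can be treated separately, and each block receives a binomial number
  of the \<open>m\<close> clauses.
\<close>
lemma mean_ent_blocks_le:
  fixes r :: nat
  assumes t: "valid_arity t k" and q: "0 < q" and l: "0 < l"
  defines "n \<equiv> q * l + r"
  shows "mean_ent t k (block_edges k q l) n m
    \<le> real q * bin_avg (1 / real q) m (mean_ent t k (all_edges k {..<l}) l) + real r"
proof -
  let ?T = "edge_op t k (block_edges k q l)" and ?B = "\<lambda>b. edge_op t k (all_edges k (block l b))"
  let ?C = "sol_class t n"
  have k: "1 \<le> k" using t by (simp add: valid_arity_def)
  have n: "q * l \<le> n" by (simp add: n_def)
  have T: "averaging ?C ?T" by (rule averaging_block_edges[OF t q l n])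
  have Tm: "averaging ?C (?T ^^ m)" by (rule averaging_funpow[OF T])
  have B: "averaging ?C (?B b)" if "b < q" for b
    by (rule averaging_edge_op[OF t edge_set_block[OF that l n]])
  have part: "(?T ^^ m) (ent_seg l b) (cube n) \<le> 2 ^ n * bin_avg (1 / real q) m (mean_ent t k (all_edges k {..<l}) l)"
    if b: "b < q" for b
  proof -
    have "Suc b * l \<le> q * l" using b by (intro mult_le_mono1) simp
    then have bl: "Suc b * l \<le> n" using n by simp
    have step: "?T (ent_seg l b) S \<le> (1 / real q) * ?B b (ent_seg l b) S + (1 - 1 / real q) * ent_seg l b S"
      if S: "?C S" for S
    proof -
      have "(\<Sum>b'<q. ?B b' (ent_seg l b) S) = ?B b (ent_seg l b) S + (\<Sum>b'\<in>{..<q} - {b}. ?B b' (ent_seg l b) S)"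
        using b by (subst sum.remove[of _ b]) auto
      also have "(\<Sum>b'\<in>{..<q} - {b}. ?B b' (ent_seg l b) S) \<le> (\<Sum>b'\<in>{..<q} - {b}. ent_seg l b S)"
        using edge_op_ent_seg_le[OF t edge_set_block[OF _ l n] sol_class_finite[OF S]] by (intro sum_mono) auto
      also have "\<dots> = (real q - 1) * ent_seg l b S" using b by (simp add: of_nat_diff)
      finally have "(\<Sum>b'<q. ?B b' (ent_seg l b) S) \<le> ?B b (ent_seg l b) S + (real q - 1) * ent_seg l b S" by simp
      then have "(\<Sum>b'<q. ?B b' (ent_seg l b) S) / real q \<le> (?B b (ent_seg l b) S + (real q - 1) * ent_seg l b S) / real q"
        by (intro divide_right_mono) auto
      then show ?thesis unfolding edge_op_block_edges[OF k l]
        using q by (simp add: add_divide_distrib left_diff_distrib diff_divide_distrib)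
    qed
    have comm: "?T (?B b g) = ?B b (?T g)" for g
      by (rule edge_op_commute)
    have "(?T ^^ m) ((?B b ^^ 0) (ent_seg l b)) (cube n) \<le> bin_avg (1 / real q) m (\<lambda>j. (?B b ^^ (j + 0)) (ent_seg l b) (cube n))"
      by (rule funpow_le_bin_avg[OF T B[OF b] comm _ _ step sol_class_cube]) (use q in auto)
    moreover have "(?B b ^^ j) (ent_seg l b) (cube n) = 2 ^ n * mean_ent t k (all_edges k {..<l}) l j" for j
    proof -
      have "cyl n l b (cube l) = cube n" using seg_in_cube[OF _ bl] by (auto simp: cyl_def)
      moreover have "(2::real) ^ n = 2 ^ (n - l) * 2 ^ l"
        using bl by (simp flip: power_add)
      ultimately show ?thesis
        using funpow_edge_op_cyl[where g = "ent_seg l b" and c = "2 ^ (n - l)" and g' = ent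
            and t = t and k = k and j = j, OF bl order_refl ent_seg_cyl[OF bl]]
        by (simp add: mean_ent_def)
    qed
    ultimately show ?thesis
      using bin_avg_linear[of "1 / real q" m "2 ^ n" "mean_ent t k (all_edges k {..<l}) l" 0] by simp
  qed
  have "(?T ^^ m) ent (cube n) \<le> (?T ^^ m) (\<lambda>S. 1 * (\<Sum>b<q. ent_seg l b S) + real r * real (card S)) (cube n)"
    by (rule averaging_mono[OF Tm _ sol_class_cube])
      (use ent_le_sum_ent_seg in \<open>auto simp: sol_class_def n_def\<close>)
  also have "\<dots> = (\<Sum>b<q. (?T ^^ m) (ent_seg l b) (cube n)) + real r * 2 ^ n"
    unfolding averaging_linear[OF Tm] averaging_card[OF Tm sol_class_cube] averaging_sum[OF Tm] by simp
  also have "\<dots> \<le> (\<Sum>b<q. 2 ^ n * bin_avg (1 / real q) m (mean_ent t k (all_edges k {..<l}) l)) + real r * 2 ^ n"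
    using part by (intro add_right_mono sum_mono) auto
  also have "\<dots> = 2 ^ n * (real q * bin_avg (1 / real q) m (mean_ent t k (all_edges k {..<l}) l) + real r)"
    by (simp add: algebra_simps)
  finally show ?thesis unfolding mean_ent_def by (simp add: divide_le_eq mult.commute)
qed

text \<open>
  Subadditivity of the mean entropy with explicit errors, which come in this order from repeated
  entries in the edges of a block, from the fluctuation of the number of clauses per block, from
  the \<open>r\<close> variables outside all blocks, from edges on all variables that have repeated entries or
  meet these \<open>r\<close> variables, and from pinning.
\<close>
lemma mean_ent_comparison:
  fixes r :: nat
  assumes t: "valid_arity t k" and q: "0 < q" and l: "0 < l" "k \<le> l" and \<delta>: "0 < \<delta>" and T: "0 < T" and s: "0 < s"
  defines "n \<equiv> q * l + r"
  shows "mean_ent t k (sorted_edges n k) n m \<le> real q * (mean_ent t k (sorted_edges l k) l i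
      + real i * ((real k)\<^sup>2 / real l) + (s + (real m / real q + (real m / real q - real i)\<^sup>2) / s))
    + real r + real m * (((real k)\<^sup>2 + real k * real r) / real n)
    + (real T + real m * real k * (\<delta> + real q / (\<delta> * real T)))"
proof -
  have "k \<le> q * l" by (rule order_trans[OF l(2)]) (use q in simp)
  then have n: "k \<le> n" "0 < q * l" "q * l \<le> n" using l q by (simp_all add: n_def)
  have L: "edge_set l k (all_edges k {..<l})"
    using l by (intro edge_set_all_edges) (auto simp: lessThan_empty_iff)
  have 1: "mean_ent t k (sorted_edges n k) n m \<le> mean_ent t k (all_edges k {..<q * l}) n m
     + real m * (((real k)\<^sup>2 + real k * real r) / real n)"
    using mean_ent_sorted_close[OF t n, of m] by (simp add: n_def)
  have 2: "mean_ent t k (all_edges k {..<q * l}) n m \<le> mean_ent t k (block_edges k q l) n m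
     + (real T + real m * real k * (\<delta> + real q / (\<delta> * real T)))"
    using interpolation[OF t q l(1) n(3) \<delta> T sol_class_cube, of m]
    by (simp add: mean_ent_def divide_le_eq distrib_right)
  have 3: "mean_ent t k (block_edges k q l) n m
    \<le> real q * bin_avg (1 / real q) m (mean_ent t k (all_edges k {..<l}) l) + real r"
    unfolding n_def by (rule mean_ent_blocks_le[OF t q l(1)])
  have 4: "bin_avg (1 / real q) m (mean_ent t k (all_edges k {..<l}) l) \<le> mean_ent t k (all_edges k {..<l}) l i
      + (s + (real m / real q + (real m / real q - real i)\<^sup>2) / s)"
    using bin_avg_Lipschitz[OF _ _ s mean_ent_Lipschitz[OF t L], of "1 / real q" m i] q by simp
  have 5: "mean_ent t k (all_edges k {..<l}) l i \<le> mean_ent t k (sorted_edges l k) l i + real i * ((real k)\<^sup>2 / real l)"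
    using mean_ent_sorted_close[OF t l(2,1) order_refl, of i] by simp
  have "real q * bin_avg (1 / real q) m (mean_ent t k (all_edges k {..<l}) l)
    \<le> real q * (mean_ent t k (sorted_edges l k) l i
      + real i * ((real k)\<^sup>2 / real l) + (s + (real m / real q + (real m / real q - real i)\<^sup>2) / s))"
    using 4 5 by (intro mult_left_mono) auto
  with 1 2 3 show ?thesis by linarith
qed




section \<open>Poissonization\<close>

text \<open>
  The mean of \<open>f\<close> at a random subset of \<open>C\<close> that contains each element independently with
  probability \<open>p\<close>.
\<close>
definition bern :: "real \<Rightarrow> 'a set \<Rightarrow> ('a set \<Rightarrow> real) \<Rightarrow> real" where
  "bern p C f = (\<Sum>F\<in>Pow C. p ^ card F * (1 - p) ^ card (C - F) * f F)"

lemma sum_Pow_power: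
  fixes x :: real
  assumes "finite A"
  shows "(\<Sum>F\<in>Pow A. x ^ card F) = (1 + x) ^ card A"
  using prod_add[OF assms, of "\<lambda>_. x" "\<lambda>_. 1"] by (simp add: add.commute)

definition onto_lists :: "nat \<Rightarrow> 'a set \<Rightarrow> 'a list set" where
  "onto_lists m F = {cs. set cs = F \<and> length cs = m}"

lemma sum_lists_by_set:
  assumes "finite C"
  shows "(\<Sum>cs | set cs \<subseteq> C \<and> length cs = m. h (set cs)) = (\<Sum>F\<in>Pow C. real (card (onto_lists m F)) * h F)"
proof -
  let ?L = "{cs. set cs \<subseteq> C \<and> length cs = m}"
  have "(\<Sum>cs\<in>?L. h (set cs)) = (\<Sum>F\<in>Pow C. \<Sum>cs\<in>{cs \<in> ?L. set cs = F}. h (set cs))"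
    by (rule sum.group[symmetric]) (use assms in \<open>auto simp: finite_lists_length_eq\<close>)
  also have "\<dots> = (\<Sum>F\<in>Pow C. \<Sum>cs\<in>onto_lists m F. h F)"
    by (intro sum.cong) (auto simp: onto_lists_def)
  finally show ?thesis by simp
qed

text \<open>
  All lists over \<open>F\<close> together have the exponential generating function \<open>exp (s |F|)\<close>, which is the sum
  of the claimed functions over the subsets of \<open>F\<close>. Induction on \<open>F\<close> removes the proper subsets.
\<close>
lemma onto_lists_sums:
  assumes "finite F"
  shows "(\<lambda>m. s ^ m / fact m * real (card (onto_lists m F))) sums (exp s - 1) ^ card F"
  using assms
proof (induction F rule: finite_psubset_induct)
  case (psubset F)
  let ?P = "Pow F - {F}"
  have fin: "finite (Pow F)" using psubset by simp
  have split: "(\<Sum>G\<in>Pow F. u G) = u F + (\<Sum>G\<in>?P. u G)" for u :: "_ \<Rightarrow> real"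
    using fin by (subst sum.remove[of _ F]) auto
  have cF: "real (card F) ^ m = (\<Sum>G\<in>Pow F. real (card (onto_lists m G)))" for m
    using sum_lists_by_set[OF psubset(1), where m = m and h = "\<lambda>_. 1"] card_lists_length_eq[OF psubset(1), of m] by simp
  have eq: "s ^ m / fact m * real (card (onto_lists m F)) =
     (s * real (card F)) ^ m /\<^sub>R fact m - (\<Sum>G\<in>?P. s ^ m / fact m * real (card (onto_lists m G)))" for m
  proof -
    have "(s * real (card F)) ^ m /\<^sub>R fact m = s ^ m / fact m * real (card F) ^ m"
      by (simp add: power_mult_distrib divide_inverse mult_ac)
    also have "\<dots> = s ^ m / fact m * (real (card (onto_lists m F)) + (\<Sum>G\<in>?P. real (card (onto_lists m G))))"
      unfolding cF split ..
    finally show ?thesis unfolding sum_distrib_left[symmetric] by (simp only: distrib_left add_diff_cancel_right')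
  qed
  have "(\<lambda>m. \<Sum>G\<in>?P. s ^ m / fact m * real (card (onto_lists m G))) sums (\<Sum>G\<in>?P. (exp s - 1) ^ card G)"
    by (intro sums_sum psubset.IH) auto
  then have "(\<lambda>m. s ^ m / fact m * real (card (onto_lists m F))) sums
     (exp (s * real (card F)) - (\<Sum>G\<in>?P. (exp s - 1) ^ card G))"
    unfolding eq by (intro sums_diff exp_converges)
  moreover have "exp (s * real (card F)) = (\<Sum>G\<in>Pow F. (exp s - 1) ^ card G)"
    using sum_Pow_power[OF psubset(1), of "exp s - 1"] by (simp add: exp_of_nat_mult mult.commute flip: exp_of_nat_mult)
  ultimately show ?case by (simp add: split)
qed

text \<open>
  A Poisson number of independent uniform elements of \<open>C\<close> hits each element independently. This
  turns independent inclusion of clauses into a sequence of independent clauses.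
\<close>
lemma poissonized_lists_sums:
  fixes s :: real
  assumes "finite C"
  shows "(\<lambda>m. s ^ m / fact m * (\<Sum>cs | set cs \<subseteq> C \<and> length cs = m. h (set cs)))
    sums (\<Sum>F\<in>Pow C. (exp s - 1) ^ card F * h F)"
proof -
  have "(\<lambda>m. \<Sum>F\<in>Pow C. s ^ m / fact m * real (card (onto_lists m F)) * h F)
    sums (\<Sum>F\<in>Pow C. (exp s - 1) ^ card F * h F)"
    by (intro sums_sum sums_mult2 onto_lists_sums) (use assms finite_subset in auto)
  then show ?thesis
    by (simp add: sum_lists_by_set[OF assms] sum_distrib_left mult.assoc)
qed

definition sols :: "nat \<Rightarrow> clause set \<Rightarrow> bool list set" where
  "sols n F = {y \<in> cube n. satisfies y F}"

text \<open>
  The number of clauses satisfied by an assignment, see \<open>card_satisfied_clauses\<close>.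
\<close>
definition num_satisfied :: "clause_type \<Rightarrow> nat \<Rightarrow> nat \<Rightarrow> nat" where
  "num_satisfied t k n = (n choose k) * (card (clause_functions t k) - 1)"

lemma nths_conv_sorted_list:
  assumes "e \<subseteq> {..<length y}"
  shows "nths y e = map ((!) y) (sorted_list_of_set e)"
proof -
  have "sorted_list_of_set e = filter (\<lambda>i. i \<in> e) [0..<length y]"
  proof -
    have "set (filter (\<lambda>i. i \<in> e) [0..<length y]) = e" using assms by auto
    moreover have "sorted (filter (\<lambda>i. i \<in> e) [0..<length y])" by (simp add: sorted_wrt_filter)
    ultimately show ?thesis
      by (metis distinct_filter distinct_upt sorted_list_of_set.idem_if_sorted_distinct sorted_list_of_set_unique finite_set distinct_card)
  qed
  moreover have "nths y e = map ((!) y) (filter (\<lambda>i. i \<in> e) [0..<length y])"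
  proof -
    have "zip y [0..<length y] = map (\<lambda>i. (y ! i, i)) [0..<length y]"
      by (rule nth_equalityI) auto
    then show ?thesis by (simp add: nths_def filter_map o_def)
  qed
  ultimately show ?thesis by simp
qed

lemma satisfies_clause_conv:
  assumes "y \<in> cube n" "e \<subseteq> {..<n}"
  shows "satisfies_clause y (e, \<sigma>) \<longleftrightarrow> y \<in> clause_sols (sorted_list_of_set e) \<sigma>"
  using assms nths_conv_sorted_list[of e y]
  by (simp add: satisfies_clause_def clause_sols_def cube_def)

lemma finite_clauses [simp]: "finite (clauses t k n)"
  unfolding clauses_def using finite_k_subsets by simp

lemma edge_op_sorted_eq:
  assumes "S \<subseteq> cube n" "k \<le> n"
  shows "edge_op t k (sorted_edges n k) g S = (\<Sum>c\<in>clauses t k n. g (S \<inter> {y. satisfies_clause y c})) /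
     (real (n choose k) * (real (card (clause_functions t k)) - 1))"
proof -
  let ?E = "{e. e \<subseteq> {..<n} \<and> card e = k}" and ?X = "clause_functions t k"
  have card: "card (sorted_edges n k) = n choose k"
    unfolding sorted_edges_def by (subst card_image[OF inj_sorted_list]) (simp add: n_subsets)
  have "(\<Sum>c\<in>clauses t k n. g (S \<inter> {y. satisfies_clause y c})) =
      (\<Sum>e\<in>?E. \<Sum>\<sigma>\<in>?X. g (S \<inter> {y. satisfies_clause y (e, \<sigma>)}))"
    unfolding clauses_def by (simp add: sum.cartesian_product)
  also have "\<dots> = (\<Sum>e\<in>?E. \<Sum>\<sigma>\<in>?X. g (S \<inter> clause_sols (sorted_list_of_set e) \<sigma>))"
  proof (intro sum.cong refl)
    fix e \<sigma> assume "e \<in> ?E"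
    then have "S \<inter> {y. satisfies_clause y (e, \<sigma>)} = S \<inter> clause_sols (sorted_list_of_set e) \<sigma>"
      using assms satisfies_clause_conv[of _ n e \<sigma>] by blast
    then show "g (S \<inter> {y. satisfies_clause y (e, \<sigma>)}) = g (S \<inter> clause_sols (sorted_list_of_set e) \<sigma>)" by simp
  qed
  finally show ?thesis
    unfolding edge_op_def edge_avg_def sum_sorted_edges card
    by (simp add: sum_divide_distrib[symmetric] mult.commute)
qed

lemma card_satisfied_clauses:
  assumes "y \<in> cube n" "1 \<le> k"
  shows "card {c \<in> clauses t k n. satisfies_clause y c} = num_satisfied t k n"
proof -
  let ?E = "{e. e \<subseteq> {..<n} \<and> card e = k}" and ?X = "clause_functions t k"
  have "{c \<in> clauses t k n. satisfies_clause y c} = (SIGMA e:?E. {\<sigma>\<in>?X. \<sigma> (nths y e)})"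
    by (auto simp: clauses_def satisfies_clause_def)
  moreover have "card {\<sigma>\<in>?X. \<sigma> (nths y e)} = card ?X - 1" if "e \<in> ?E" for e
  proof -
    have fe: "finite e" using that finite_subset by auto
    have "nths y e \<in> cube k"
      using that assms fe nths_conv_sorted_list[of e y] by (simp add: cube_def)
    then have "card {\<sigma>\<in>?X. \<not> \<sigma> (nths y e)} = 1" by (rule card_violated[OF _ assms(2)])
    moreover have "{\<sigma>\<in>?X. \<sigma> (nths y e)} = ?X - {\<sigma>\<in>?X. \<not> \<sigma> (nths y e)}" by blast
    ultimately show ?thesis by (simp add: card_Diff_subset)
  qed
  ultimately show ?thesis
    by (simp add: finite_k_subsets n_subsets num_satisfied_def)
qed

lemma sols_insert: "sols n (insert c F) = sols n F \<inter> {y. satisfies_clause y c}"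
  by (auto simp: sols_def satisfies_def)

lemma funpow_edge_op_sorted:
  assumes "k \<le> n" "S \<subseteq> cube n"
  shows "(edge_op t k (sorted_edges n k) ^^ m) g S =
    (\<Sum>cs | set cs \<subseteq> clauses t k n \<and> length cs = m. g (S \<inter> sols n (set cs))) /
     (real (n choose k) * (real (card (clause_functions t k)) - 1)) ^ m"
  using assms(2)
proof (induction m arbitrary: S)
  case 0
  have "{cs. set cs \<subseteq> clauses t k n \<and> length cs = 0} = {[]}" by auto
  moreover have "S \<inter> sols n {} = S" using 0 by (auto simp: sols_def satisfies_def)
  ultimately show ?case by simp
next
  case (Suc m)
  let ?C = "clauses t k n" and ?M = "real (n choose k) * (real (card (clause_functions t k)) - 1)"
  let ?L = "{cs. set cs \<subseteq> ?C \<and> length cs = m}"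
  have eq: "{cs. set cs \<subseteq> ?C \<and> length cs = Suc m} = (\<lambda>(c, cs). c # cs) ` (?C \<times> ?L)"
    by (auto simp: length_Suc_conv image_iff)
  have "(edge_op t k (sorted_edges n k) ^^ Suc m) g S =
     (\<Sum>c\<in>?C. (edge_op t k (sorted_edges n k) ^^ m) g (S \<inter> {y. satisfies_clause y c})) / ?M"
    using edge_op_sorted_eq[OF Suc.prems assms(1)] by simp
  also have "\<dots> = (\<Sum>c\<in>?C. (\<Sum>cs\<in>?L. g (S \<inter> {y. satisfies_clause y c} \<inter> sols n (set cs))) / ?M ^ m) / ?M"
    using Suc by (intro arg_cong2[where f = "(/)"] sum.cong refl Suc.IH) auto
  also have "\<dots> = (\<Sum>c\<in>?C. \<Sum>cs\<in>?L. g (S \<inter> sols n (set (c # cs)))) / ?M ^ Suc m"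
    by (simp add: sols_insert sum_divide_distrib[symmetric] Int_assoc Int_commute Int_left_commute mult.commute)
  also have "(\<Sum>c\<in>?C. \<Sum>cs\<in>?L. g (S \<inter> sols n (set (c # cs)))) =
     (\<Sum>cs | set cs \<subseteq> ?C \<and> length cs = Suc m. g (S \<inter> sols n (set cs)))"
    unfolding eq by (subst sum.reindex) (auto simp: inj_on_def sum.cartesian_product case_prod_unfold)
  finally show ?case .
qed

section \<open>The mean of the logarithm of the number of solutions\<close>

definition planted_mean :: "clause_type \<Rightarrow> nat \<Rightarrow> nat \<Rightarrow> real \<Rightarrow> (clause set \<Rightarrow> real) \<Rightarrow> real" where
  "planted_mean t k n p f =
     (\<Sum>v\<in>cube n. bern p {c \<in> clauses t k n. satisfies_clause v c} f) / 2 ^ n"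

text \<open>
  Summing over the hidden assignment first weights a formula by its number of solutions. All
  hidden assignments enter alike, because they satisfy the same number of clauses.
\<close>
lemma planted_mean_eq:
  assumes "1 \<le> k" "p < 1"
  shows "planted_mean t k n p f = (1 - p) ^ num_satisfied t k n / 2 ^ n *
    (\<Sum>F\<in>Pow (clauses t k n). (p / (1 - p)) ^ card F * (real (card (sols n F)) * f F))"
proof -
  let ?C = "clauses t k n" and ?M = "num_satisfied t k n" and ?r = "p / (1 - p)"
  let ?Cv = "\<lambda>v. {c \<in> ?C. satisfies_clause v c}"
  have "bern p (?Cv v) f = (\<Sum>F\<in>Pow ?C. if v \<in> sols n F then (1 - p) ^ ?M * (?r ^ card F * f F) else 0)"
    if v: "v \<in> cube n" for v
  proof -
    have P: "Pow (?Cv v) = Pow ?C \<inter> {F. v \<in> sols n F}"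
      using v by (auto simp: sols_def satisfies_def)
    have "bern p (?Cv v) f = (\<Sum>F\<in>Pow (?Cv v). (1 - p) ^ ?M * (?r ^ card F * f F))"
      unfolding bern_def
    proof (rule sum.cong)
      fix F assume "F \<in> Pow (?Cv v)"
      then have F: "F \<subseteq> ?Cv v" by simp
      have fin: "finite (?Cv v)" by simp
      have le: "card F \<le> ?M" "card (?Cv v - F) = ?M - card F"
        using card_mono[OF fin F] card_Diff_subset[OF finite_subset[OF F fin] F] card_satisfied_clauses[OF v assms(1), of t]
        by auto
      have "(1 - p) ^ ?M = (1 - p) ^ card F * (1 - p) ^ (?M - card F)"
        using le(1) by (simp flip: power_add)
      then have "(1 - p) ^ ?M * ?r ^ card F = p ^ card F * (1 - p) ^ card (?Cv v - F)"
        using assms(2) le(2) by (simp add: power_divide)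
      then show "p ^ card F * (1 - p) ^ card (?Cv v - F) * f F = (1 - p) ^ ?M * (?r ^ card F * f F)"
        by (simp add: mult.assoc)
    qed simp
    then show ?thesis by (simp add: P sum.inter_restrict)
  qed
  then have "(\<Sum>v\<in>cube n. bern p (?Cv v) f) =
     (\<Sum>v\<in>cube n. \<Sum>F\<in>Pow ?C. if v \<in> sols n F then (1 - p) ^ ?M * (?r ^ card F * f F) else 0)" by simp
  also have "\<dots> = (\<Sum>F\<in>Pow ?C. \<Sum>v\<in>cube n. if v \<in> sols n F then (1 - p) ^ ?M * (?r ^ card F * f F) else 0)"
    by (rule sum.swap)
  also have "\<dots> = (\<Sum>F\<in>Pow ?C. real (card (sols n F)) * ((1 - p) ^ ?M * (?r ^ card F * f F)))"
  proof (rule sum.cong)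
    fix F
    have "cube n \<inter> {v. v \<in> sols n F} = sols n F" by (auto simp: sols_def)
    then show "(\<Sum>v\<in>cube n. if v \<in> sols n F then (1 - p) ^ ?M * (?r ^ card F * f F) else 0)
       = real (card (sols n F)) * ((1 - p) ^ ?M * (?r ^ card F * f F))" by (simp add: sum.If_cases)
  qed simp
  also have "\<dots> = (1 - p) ^ ?M * (\<Sum>F\<in>Pow ?C. ?r ^ card F * (real (card (sols n F)) * f F))"
    by (simp add: sum_distrib_left mult_ac)
  finally show ?thesis by (simp add: planted_mean_def)
qed

definition planted_ent :: "clause_type \<Rightarrow> nat \<Rightarrow> nat \<Rightarrow> real \<Rightarrow> real" where
  "planted_ent t k n p = planted_mean t k n p (\<lambda>F. ln (real (card (sols n F))))"

lemma real_num_satisfied: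
  assumes "valid_arity t k"
  shows "real (num_satisfied t k n) = real (n choose k) * (real (card (clause_functions t k)) - 1)"
  using card_clause_functions_ge_2[OF assms] by (simp add: num_satisfied_def of_nat_diff)

text \<open>
  With \<open>exp (- s) = 1 - p\<close>, a clause is hit by a Poisson number of mean \<open>s\<close> with probability \<open>p\<close>. So
  the planted formula is a Poissonized sequence of independent clauses, and this holds exactly.
\<close>
lemma planted_ent_sums:
  assumes t: "valid_arity t k" and n: "k \<le> n" and p: "0 \<le> p" "p < 1"
  defines "u \<equiv> - ln (1 - p) * real (num_satisfied t k n)"
  shows "(\<lambda>m. exp (- u) * u ^ m / fact m * mean_ent t k (sorted_edges n k) n m) sums planted_ent t k n p"
proof -
  let ?C = "clauses t k n" and ?M = "num_satisfied t k n"
  define s where "s = - ln (1 - p)"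
  have s: "exp s - 1 = p / (1 - p)" "exp (- s) = 1 - p"
    using p by (simp_all add: s_def exp_minus field_simps)
  have u: "u = s * real ?M" by (simp add: u_def s_def)
  have M: "real ?M > 0"
    using card_clause_functions_ge_2[OF t] n by (simp add: num_satisfied_def)
  have k: "1 \<le> k" using t by (simp add: valid_arity_def)
  have exp: "exp (- u) = (1 - p) ^ ?M" using s(2) by (metis exp_of_nat2_mult mult_minus_left u)
  have iter: "mean_ent t k (sorted_edges n k) n m = (\<Sum>cs | set cs \<subseteq> ?C \<and> length cs = m. ent (sols n (set cs))) / real ?M ^ m / 2 ^ n" for m
  proof -
    have "cube n \<inter> sols n F = sols n F" for F by (auto simp: sols_def)
    then show ?thesis
      unfolding mean_ent_def funpow_edge_op_sorted[OF n order_refl] real_num_satisfied[OF t] by simp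
  qed
  have "(\<lambda>m. exp (- u) / 2 ^ n * (s ^ m / fact m * (\<Sum>cs | set cs \<subseteq> ?C \<and> length cs = m. ent (sols n (set cs)))))
     sums (exp (- u) / 2 ^ n * (\<Sum>F\<in>Pow ?C. (exp s - 1) ^ card F * ent (sols n F)))"
    by (intro sums_mult poissonized_lists_sums) simp
  moreover have "exp (- u) / 2 ^ n * (s ^ m / fact m * (\<Sum>cs | set cs \<subseteq> ?C \<and> length cs = m. ent (sols n (set cs))))
     = exp (- u) * u ^ m / fact m * mean_ent t k (sorted_edges n k) n m" for m
    unfolding iter u power_mult_distrib using M by simp
  moreover have "exp (- u) / 2 ^ n * (\<Sum>F\<in>Pow ?C. (exp s - 1) ^ card F * ent (sols n F)) = planted_ent t k n p"
    unfolding planted_ent_def planted_mean_eq[OF k p(2)] exp s(1) ent_def by (simp add: mult.assoc)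
  ultimately show ?thesis by simp
qed

text \<open>
  The second moment about \<open>c\<close> of a Poisson variable of mean \<open>u\<close>, without the factor \<open>exp (- u)\<close>.
\<close>
lemma poisson_second_moment:
  fixes u c :: real
  shows "(\<lambda>m. u ^ m / fact m * (real m - c)\<^sup>2) sums (exp u * (u + (u - c)\<^sup>2))"
proof -
  let ?w = "\<lambda>m. u ^ m / fact m"
  have w0: "?w sums exp u" using exp_converges[of u] by (simp add: divide_inverse mult.commute)
  have shift: "real (Suc m) * ?w (Suc m) = u * ?w m" for m
    by (simp add: fact_Suc del: of_nat_Suc)
  have w1: "(\<lambda>m. real m * ?w m) sums (u * exp u)"
  proof -
    have "(\<lambda>m. real (Suc m) * ?w (Suc m)) sums (u * exp u)"
      unfolding shift by (rule sums_mult[OF w0])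
    then show ?thesis by (subst (asm) sums_Suc_iff) simp
  qed
  have w2: "(\<lambda>m. real m * (real m * ?w m)) sums (u * (u * exp u + exp u))"
  proof -
    have "(1 + a) * (u * W) = u * (a * W + W)" for a W by algebra
    then have "real (Suc m) * (real (Suc m) * ?w (Suc m)) = u * (real m * ?w m + ?w m)" for m
      unfolding shift by (simp only: of_nat_Suc)
    then have "(\<lambda>m. real (Suc m) * (real (Suc m) * ?w (Suc m))) sums (u * (u * exp u + exp u))"
      using sums_mult[OF sums_add[OF w1 w0], of u] by simp
    then show ?thesis by (subst (asm) sums_Suc_iff) simp
  qed
  have "(\<lambda>m. real m * (real m * ?w m) - 2 * c * (real m * ?w m) + c\<^sup>2 * ?w m) sums
      (u * (u * exp u + exp u) - 2 * c * (u * exp u) + c\<^sup>2 * exp u)"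
    by (intro sums_add sums_diff sums_mult w0 w1 w2)
  then show ?thesis by (simp add: power2_eq_square algebra_simps)
qed

text \<open>
  The mean entropy is 1-Lipschitz in the number of clauses, which has variance \<open>u\<close>. The parameter \<open>s\<close>
  serves to bound a distance by its square.
\<close>
lemma planted_ent_close:
  assumes t: "valid_arity t k" and n: "k \<le> n" and p: "0 \<le> p" "p < 1" and s: "0 < s"
  defines "u \<equiv> - ln (1 - p) * real (num_satisfied t k n)"
  shows "\<bar>planted_ent t k n p - mean_ent t k (sorted_edges n k) n i\<bar> \<le> s + (u + (u - real i)\<^sup>2) / s"
proof -
  let ?a = "mean_ent t k (sorted_edges n k) n" and ?w = "\<lambda>m. exp (- u) * u ^ m / fact m"
  have "ln (1 - p) \<le> 0" using p by simp
  then have u: "0 \<le> u" unfolding u_def by (intro mult_nonneg_nonneg) auto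
  have w: "0 \<le> ?w m" for m using u by simp
  have Lip: "\<bar>?a m - ?a i\<bar> \<le> s + (real m - real i)\<^sup>2 / s" for m
    using mean_ent_Lipschitz[OF t edge_set_sorted[OF n], of m i] abs_le_quadratic[OF s, of "real m - real i"] by linarith
  have sums: "(\<lambda>m. ?w m * ?a m) sums planted_ent t k n p"
    using planted_ent_sums[OF t n p] by (simp add: u_def)
  have "(\<lambda>m. exp (- u) * (c * (u ^ m /\<^sub>R fact m) + e * (u ^ m / fact m * (real m - real i)\<^sup>2)))
      sums (exp (- u) * (c * exp u + e * (exp u * (u + (u - real i)\<^sup>2))))" for c e
    by (intro sums_mult sums_add exp_converges poisson_second_moment)
  moreover have "exp (- u) * (c * (u ^ m /\<^sub>R fact m) + e * (u ^ m / fact m * (real m - real i)\<^sup>2))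
     = ?w m * (c + e * (real m - real i)\<^sup>2)" for c e m
    by (simp add: field_simps)
  moreover have "exp (- u) * (c * exp u + e * (exp u * (u + (u - real i)\<^sup>2))) = c + e * (u + (u - real i)\<^sup>2)" for c e
    by (simp add: exp_minus field_simps)
  ultimately have quad: "(\<lambda>m. ?w m * (c + e * (real m - real i)\<^sup>2)) sums (c + e * (u + (u - real i)\<^sup>2))" for c e
    by simp
  have "planted_ent t k n p \<le> (?a i + s) + (1 / s) * (u + (u - real i)\<^sup>2)"
  proof (rule sums_le[OF _ sums quad])
    fix m show "?w m * ?a m \<le> ?w m * ((?a i + s) + (1 / s) * (real m - real i)\<^sup>2)"
      using Lip[of m] by (intro mult_left_mono w) (simp add: abs_le_iff)
  qed
  moreover have "(?a i - s) + (- 1 / s) * (u + (u - real i)\<^sup>2) \<le> planted_ent t k n p"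
  proof (rule sums_le[OF _ quad sums])
    fix m show "?w m * ((?a i - s) + (- 1 / s) * (real m - real i)\<^sup>2) \<le> ?w m * ?a m"
      using Lip[of m] by (intro mult_left_mono w) (simp add: abs_le_iff)
  qed
  ultimately show ?thesis by (simp add: abs_le_iff)
qed




section \<open>The Efron-Stein inequality\<close>

lemma bern_insert:
  assumes "finite C" "a \<notin> C"
  shows "bern p (insert a C) f = p * bern p C (\<lambda>F. f (insert a F)) + (1 - p) * bern p C f"
proof -
  let ?w = "\<lambda>D F. p ^ card F * (1 - p) ^ card (D - F)"
  have "bern p (insert a C) f = (\<Sum>F\<in>Pow C. ?w (insert a C) F * f F) + (\<Sum>F\<in>insert a ` Pow C. ?w (insert a C) F * f F)"
    unfolding bern_def Pow_insert by (rule sum.union_disjoint) (use assms in auto)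
  also have "(\<Sum>F\<in>insert a ` Pow C. ?w (insert a C) F * f F) = (\<Sum>F\<in>Pow C. ?w (insert a C) (insert a F) * f (insert a F))"
    by (subst sum.reindex) (use assms in \<open>auto simp: inj_on_def\<close>)
  also have "\<dots> = p * bern p C (\<lambda>F. f (insert a F))"
    unfolding bern_def sum_distrib_left
  proof (rule sum.cong)
    fix F assume "F \<in> Pow C"
    then have F: "F \<subseteq> C" "a \<notin> F" "finite F" using assms finite_subset by auto
    have "insert a C - insert a F = C - F" using assms(2) by auto
    then show "?w (insert a C) (insert a F) * f (insert a F) = p * (?w C F * f (insert a F))"
      using F by simp
  qed simp
  also have "(\<Sum>F\<in>Pow C. ?w (insert a C) F * f F) = (1 - p) * bern p C f"
    unfolding bern_def sum_distrib_left
  proof (rule sum.cong)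
    fix F assume "F \<in> Pow C"
    then have F: "F \<subseteq> C" "a \<notin> F" "finite F" using assms finite_subset by auto
    have "insert a C - F = insert a (C - F)" using F by auto
    then have "card (insert a C - F) = Suc (card (C - F))" using assms by simp
    then show "?w (insert a C) F * f F = (1 - p) * (?w C F * f F)" by simp
  qed simp
  finally show ?thesis by simp
qed

lemma bern_linear: "bern p C (\<lambda>F. u * f F + v * g F) = u * bern p C f + v * bern p C g"
  by (simp add: bern_def sum.distrib sum_distrib_left algebra_simps)

lemma bern_mono:
  assumes "0 \<le> p" "p \<le> 1" "\<And>F. F \<subseteq> C \<Longrightarrow> f F \<le> g F"
  shows "bern p C f \<le> bern p C g"
  unfolding bern_def by (intro sum_mono mult_left_mono assms(3)) (use assms(1,2) in auto)

lemma bern_const: "finite C \<Longrightarrow> bern p C (\<lambda>F. c) = c"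
proof (induction C rule: finite_induct)
  case empty
  then show ?case by (simp add: bern_def)
next
  case (insert a C)
  then show ?case by (simp add: bern_insert algebra_simps)
qed

text \<open>
  Resample one element at a time. In the induction, \<open>g\<close> is the conditional mean of \<open>f\<close> given all
  elements but \<open>a\<close>; the increments of \<open>g\<close> are means of increments of \<open>f\<close>, and the square is convex.
\<close>
lemma bern_variance_le:
  assumes p: "0 \<le> p" "p \<le> 1" and "finite C"
  shows "bern p C (\<lambda>F. (f F)\<^sup>2) - (bern p C f)\<^sup>2
     \<le> p * (1 - p) * (\<Sum>c\<in>C. bern p (C - {c}) (\<lambda>F. (f (insert c F) - f F)\<^sup>2))"
  using assms(3)
proof (induction C arbitrary: f rule: finite_induct)
  case empty
  then show ?case by (simp add: bern_def)
next
  case (insert a C)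
  define g where "g = (\<lambda>F. p * f (insert a F) + (1 - p) * f F)"
  let ?d = "\<lambda>c F. (f (insert c F) - f F)\<^sup>2"
  have m1: "bern p (insert a C) f = bern p C g"
    unfolding bern_insert[OF insert(1,2)] g_def bern_linear ..
  have "p * x\<^sup>2 + (1 - p) * y\<^sup>2 = 1 * (p * x + (1 - p) * y)\<^sup>2 + p * (1 - p) * (x - y)\<^sup>2" for x y
    by (simp add: power2_eq_square algebra_simps)
  then have "(\<lambda>F. p * (f (insert a F))\<^sup>2 + (1 - p) * (f F)\<^sup>2) = (\<lambda>F. 1 * (g F)\<^sup>2 + p * (1 - p) * ?d a F)"
    unfolding g_def by blast
  then have "bern p C (\<lambda>F. p * (f (insert a F))\<^sup>2 + (1 - p) * (f F)\<^sup>2) = bern p C (\<lambda>F. 1 * (g F)\<^sup>2 + p * (1 - p) * ?d a F)"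
    by (rule arg_cong)
  then have m2: "bern p (insert a C) (\<lambda>F. (f F)\<^sup>2) = bern p C (\<lambda>F. (g F)\<^sup>2) + p * (1 - p) * bern p C (?d a)"
    unfolding bern_insert[OF insert(1,2)] bern_linear by simp
  have conv: "(p * x + (1 - p) * y)\<^sup>2 \<le> p * x\<^sup>2 + (1 - p) * y\<^sup>2" for x y
  proof -
    have "0 \<le> p * (1 - p) * (x - y)\<^sup>2" using p by simp
    also have "\<dots> = p * x\<^sup>2 + (1 - p) * y\<^sup>2 - (p * x + (1 - p) * y)\<^sup>2"
      by (simp add: power2_eq_square algebra_simps)
    finally show ?thesis by simp
  qed
  have step: "bern p (C - {c}) (\<lambda>F. (g (insert c F) - g F)\<^sup>2) \<le> bern p (insert a C - {c}) (?d c)" if c: "c \<in> C" for c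
  proof -
    have D: "insert a C - {c} = insert a (C - {c})" and nin: "a \<notin> C - {c}" and fin: "finite (C - {c})"
      using c insert by auto
    have eq: "bern p (insert a C - {c}) (?d c) = bern p (C - {c}) (\<lambda>F. p * ?d c (insert a F) + (1 - p) * ?d c F)"
      unfolding D bern_insert[OF fin nin] bern_linear ..
    show ?thesis unfolding eq
    proof (rule bern_mono[OF p])
      fix F
      have "g (insert c F) - g F = p * (f (insert c (insert a F)) - f (insert a F)) + (1 - p) * (f (insert c F) - f F)"
        unfolding g_def by (simp add: insert_commute[of a c] algebra_simps)
      then show "(g (insert c F) - g F)\<^sup>2 \<le> p * ?d c (insert a F) + (1 - p) * ?d c F"
        using conv by simp
    qed
  qed
  have "bern p C (\<lambda>F. (g F)\<^sup>2) - (bern p C g)\<^sup>2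
     \<le> p * (1 - p) * (\<Sum>c\<in>C. bern p (C - {c}) (\<lambda>F. (g (insert c F) - g F)\<^sup>2))"
    by (rule insert.IH)
  also have "\<dots> \<le> p * (1 - p) * (\<Sum>c\<in>C. bern p (insert a C - {c}) (?d c))"
    using p step by (intro mult_left_mono sum_mono) auto
  finally have "bern p (insert a C) (\<lambda>F. (f F)\<^sup>2) - (bern p (insert a C) f)\<^sup>2
     \<le> p * (1 - p) * (bern p C (?d a) + (\<Sum>c\<in>C. bern p (insert a C - {c}) (?d c)))"
    unfolding m1 m2 by (simp add: distrib_left)
  also have "bern p C (?d a) + (\<Sum>c\<in>C. bern p (insert a C - {c}) (?d c)) = (\<Sum>c\<in>insert a C. bern p (insert a C - {c}) (?d c))"
    using insert(1,2) by simp
  finally show ?case .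
qed

section \<open>Gauge symmetry\<close>

definition xorl :: "bool list \<Rightarrow> bool list \<Rightarrow> bool list" where
  "xorl u y = map2 (\<noteq>) u y"

lemma xorl_in_cube [simp]: "u \<in> cube n \<Longrightarrow> y \<in> cube n \<Longrightarrow> xorl u y \<in> cube n"
  by (simp add: xorl_def cube_def)

lemma nth_xorl: "u \<in> cube n \<Longrightarrow> y \<in> cube n \<Longrightarrow> i < n \<Longrightarrow> xorl u y ! i = (u ! i \<noteq> y ! i)"
  by (simp add: xorl_def cube_def)

lemma cube_eqI: "y \<in> cube n \<Longrightarrow> z \<in> cube n \<Longrightarrow> (\<And>i. i < n \<Longrightarrow> y ! i = z ! i) \<Longrightarrow> y = z"
  by (auto simp: cube_def intro: nth_equalityI)

lemma xorl_xorl: "u \<in> cube n \<Longrightarrow> y \<in> cube n \<Longrightarrow> xorl u (xorl u y) = y"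
  by (rule cube_eqI[of _ n]) (auto simp: nth_xorl)

lemma xorl_commute_cancel: "v \<in> cube n \<Longrightarrow> w \<in> cube n \<Longrightarrow> xorl (xorl v w) v = w"
  by (rule cube_eqI[of _ n]) (auto simp: nth_xorl[where n = n])

lemma xorl_eq_iff: "a \<in> cube k \<Longrightarrow> z \<in> cube k \<Longrightarrow> x \<in> cube k \<Longrightarrow> xorl a z = x \<longleftrightarrow> z = xorl a x"
  using xorl_xorl by metis

lemma xorl_Not: "a \<in> cube k \<Longrightarrow> x \<in> cube k \<Longrightarrow> xorl a (map Not x) = map Not (xorl a x)"
  by (rule cube_eqI[of _ k]) (auto simp: nth_xorl cube_def xorl_def)

lemma xor_list_xorl: "length a = length z \<Longrightarrow> xor_list (xorl a z) = (xor_list a \<noteq> xor_list z)"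
  by (induction a z rule: list_induct2) (auto simp: xorl_def)

definition flip_fun :: "nat \<Rightarrow> bool list \<Rightarrow> (bool list \<Rightarrow> bool) \<Rightarrow> bool list \<Rightarrow> bool" where
  "flip_fun k a \<sigma> = (\<lambda>z\<in>cube k. \<sigma> (xorl a z))"

lemma flip_fun_clause_functions:
  assumes a: "a \<in> cube k" and \<sigma>: "\<sigma> \<in> clause_functions t k"
  shows "flip_fun k a \<sigma> \<in> clause_functions t k"
proof (cases t)
  case SAT
  then obtain x where x: "x \<in> cube k" "\<sigma> = sat_fun k x"
    using \<sigma> unfolding SAT clause_functions_image by blast
  have "flip_fun k a \<sigma> = sat_fun k (xorl a x)"
    unfolding x(2) flip_fun_def sat_fun_def
    by (rule restrict_ext) (use a x xorl_eq_iff[OF a] in auto)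
  then show ?thesis using a x unfolding SAT clause_functions_image by simp
next
  case NAESAT
  then obtain x where x: "x \<in> cube k" "\<sigma> = nae_fun k x"
    using \<sigma> unfolding NAESAT clause_functions_image by blast
  have key: "xorl a z \<notin> {x, map Not x} \<longleftrightarrow> z \<notin> {xorl a x, map Not (xorl a x)}" if "z \<in> cube k" for z
  proof -
    have "xorl a z = x \<longleftrightarrow> z = xorl a x" by (rule xorl_eq_iff[OF a that x(1)])
    moreover have "xorl a z = map Not x \<longleftrightarrow> z = map Not (xorl a x)"
      unfolding xorl_Not[OF a x(1), symmetric] by (rule xorl_eq_iff[OF a that]) (simp add: x(1))
    ultimately show ?thesis by blast
  qed
  have "flip_fun k a \<sigma> = nae_fun k (xorl a x)"
    unfolding x(2) flip_fun_def nae_fun_def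
    by (rule restrict_ext) (simp only: restrict_apply xorl_in_cube[OF a] if_True key)
  then show ?thesis using a x unfolding NAESAT clause_functions_image by simp
next
  case XORSAT
  then obtain b where b: "\<sigma> = xor_fun k b"
    using \<sigma> unfolding XORSAT clause_functions_image by blast
  have "flip_fun k a \<sigma> = xor_fun k (b \<noteq> xor_list a)"
    unfolding b flip_fun_def xor_fun_def
    by (rule restrict_ext) (use a in \<open>auto simp: xor_list_xorl cube_def xorl_def[symmetric]\<close>, auto simp: xorl_def cube_def)
  then show ?thesis unfolding XORSAT clause_functions_image by simp
qed

lemma flip_fun_flip_fun:
  assumes "a \<in> cube k" "\<sigma> \<in> clause_functions t k"
  shows "flip_fun k a (flip_fun k a \<sigma>) = \<sigma>"
proof -
  have "flip_fun k a (flip_fun k a \<sigma>) = restrict \<sigma> (cube k)"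
    unfolding flip_fun_def by (rule restrict_ext) (simp add: assms(1) xorl_xorl[OF assms(1)])
  then show ?thesis using clause_functions_extensional[OF assms(2)] by simp
qed

text \<open>
  Adding \<open>u\<close> to all assignments amounts to adding the restriction of \<open>u\<close> to the inputs of every clause.
  This symmetry of the set of clauses moves the hidden assignment to any other one.
\<close>
definition flip_clause :: "nat \<Rightarrow> bool list \<Rightarrow> clause \<Rightarrow> clause" where
  "flip_clause k u c = (fst c, flip_fun k (nths u (fst c)) (snd c))"

lemma nths_in_cube:
  assumes "y \<in> cube n" "e \<subseteq> {..<n}" "card e = k"
  shows "nths y e \<in> cube k"
proof -
  have "finite e" by (rule finite_subset[OF assms(2)]) simp
  then show ?thesis using assms nths_conv_sorted_list[of e y] by (simp add: cube_def)
qed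

lemma nths_xorl:
  assumes "u \<in> cube n" "y \<in> cube n" "e \<subseteq> {..<n}"
  shows "nths (xorl u y) e = xorl (nths u e) (nths y e)"
proof -
  have fin: "finite e" by (rule finite_subset[OF assms(3)]) simp
  have "xorl u y \<in> cube n" using assms by simp
  then have "nths (xorl u y) e = map ((!) (xorl u y)) (sorted_list_of_set e)"
    using assms(3) by (intro nths_conv_sorted_list) (simp add: cube_def)
  also have "\<dots> = map (\<lambda>i. u ! i \<noteq> y ! i) (sorted_list_of_set e)"
    using fin assms by (intro map_cong refl nth_xorl) auto
  also have "\<dots> = xorl (map ((!) u) (sorted_list_of_set e)) (map ((!) y) (sorted_list_of_set e))"
    by (rule nth_equalityI) (auto simp: xorl_def)
  finally show ?thesis using assms nths_conv_sorted_list[of e u] nths_conv_sorted_list[of e y] by (simp add: cube_def)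
qed

lemma flip_clause_in_clauses:
  assumes "u \<in> cube n" "c \<in> clauses t k n"
  shows "flip_clause k u c \<in> clauses t k n" "flip_clause k u (flip_clause k u c) = c"
  using assms nths_in_cube[of u n "fst c" k]
  by (auto simp: clauses_def flip_clause_def flip_fun_clause_functions flip_fun_flip_fun simp del: clause_functions.simps)

lemma satisfies_flip_clause:
  assumes "u \<in> cube n" "y \<in> cube n" "c \<in> clauses t k n"
  shows "satisfies_clause (xorl u y) (flip_clause k u c) \<longleftrightarrow> satisfies_clause y c"
proof -
  obtain e \<sigma> where c: "c = (e, \<sigma>)" "e \<subseteq> {..<n}" "card e = k" using assms(3) by (auto simp: clauses_def)
  then show ?thesis
    using assms nths_in_cube[OF assms(1) c(2,3)] nths_in_cube[OF assms(2) c(2,3)]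
    by (simp add: satisfies_clause_def flip_clause_def flip_fun_def nths_xorl xorl_xorl)
qed

lemma card_sols_flip:
  assumes u: "u \<in> cube n" and F: "F \<subseteq> clauses t k n"
  shows "card (sols n (flip_clause k u ` F)) = card (sols n F)"
proof -
  have iff: "satisfies (xorl u y) (flip_clause k u ` F) \<longleftrightarrow> satisfies y F" if "y \<in> cube n" for y
    unfolding satisfies_def using satisfies_flip_clause[OF u that] F by blast
  have "bij_betw (xorl u) (sols n F) (sols n (flip_clause k u ` F))"
  proof (rule bij_betw_byWitness[where f' = "xorl u"])
    show "xorl u ` sols n F \<subseteq> sols n (flip_clause k u ` F)"
      using u iff by (auto simp: sols_def)
    show "xorl u ` sols n (flip_clause k u ` F) \<subseteq> sols n F"
    proof
      fix z assume "z \<in> xorl u ` sols n (flip_clause k u ` F)"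
      then obtain y where y: "y \<in> cube n" "satisfies y (flip_clause k u ` F)" "z = xorl u y"
        by (auto simp: sols_def)
      then show "z \<in> sols n F" using u iff[of z] by (simp add: sols_def xorl_xorl)
    qed
  qed (use u in \<open>auto simp: sols_def xorl_xorl\<close>)
  then show ?thesis by (simp add: bij_betw_same_card)
qed

lemma bern_image:
  assumes "inj_on h C" "finite C"
  shows "bern p (h ` C) f = bern p C (\<lambda>F. f (h ` F))"
proof -
  have "Pow (h ` C) = (`) h ` Pow C" by (rule image_Pow_surj[OF refl, symmetric])
  moreover have "inj_on ((`) h) (Pow C)" by (rule inj_on_image_Pow[OF assms(1)])
  moreover have "card (h ` F) = card F" "card (h ` C - h ` F) = card (C - F)" if "F \<in> Pow C" for F
  proof -
    show "card (h ` F) = card F" using assms(1) that by (intro card_image) (auto intro: inj_on_subset)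
    have "h ` C - h ` F = h ` (C - F)" using inj_on_image_set_diff[OF assms(1), of C F] that by simp
    then show "card (h ` C - h ` F) = card (C - F)"
      using card_image[OF inj_on_subset[OF assms(1), of "C - F"]] by simp
  qed
  ultimately show ?thesis unfolding bern_def by (simp add: sum.reindex)
qed

text \<open>
  The number of solutions has the same distribution for every hidden assignment. So its
  variance can be computed conditionally on the hidden assignment, given which the
  clauses are independent.
\<close>
lemma bern_gauge:
  assumes v: "v \<in> cube n" and w: "w \<in> cube n"
  shows "bern p {c \<in> clauses t k n. satisfies_clause v c} (\<lambda>F. h (card (sols n F)))
    = bern p {c \<in> clauses t k n. satisfies_clause w c} (\<lambda>F. h (card (sols n F)))"
proof -
  let ?C = "\<lambda>v. {c \<in> clauses t k n. satisfies_clause v c}"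
  define u where "u = xorl v w"
  have u: "u \<in> cube n" using v w by (simp add: u_def)
  have uv: "xorl u v = w" unfolding u_def by (rule xorl_commute_cancel[OF v w])
  have uw: "xorl u w = v" using uv xorl_xorl[OF u v] by simp
  have flip: "flip_clause k u c \<in> clauses t k n" "flip_clause k u (flip_clause k u c) = c"
    if "c \<in> clauses t k n" for c
    using flip_clause_in_clauses[OF u that] by simp_all
  have inj: "inj_on (flip_clause k u) (?C v)" by (rule inj_on_inverseI[where g = "flip_clause k u"]) (simp add: flip)
  have "flip_clause k u ` ?C v = ?C w"
  proof (intro equalityI subsetI)
    fix c assume "c \<in> flip_clause k u ` ?C v"
    then show "c \<in> ?C w" using satisfies_flip_clause[OF u v] flip(1) by (auto simp: uv)
  next
    fix c assume c: "c \<in> ?C w"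
    then have "flip_clause k u c \<in> ?C v" using satisfies_flip_clause[OF u w, of c t k] flip(1)[of c] by (simp add: uw)
    then have "flip_clause k u (flip_clause k u c) \<in> flip_clause k u ` ?C v" by (rule imageI)
    then show "c \<in> flip_clause k u ` ?C v" using c by (simp add: flip(2))
  qed
  then have "bern p (?C w) (\<lambda>F. h (card (sols n F))) = bern p (?C v) (\<lambda>F. h (card (sols n (flip_clause k u ` F))))"
    using bern_image[OF inj, of p "\<lambda>F. h (card (sols n F))"] by simp
  also have "\<dots> = bern p (?C v) (\<lambda>F. h (card (sols n F)))"
    unfolding bern_def
  proof (rule sum.cong)
    fix F assume "F \<in> Pow (?C v)"
    then have "F \<subseteq> clauses t k n" by auto
    then show "p ^ card F * (1 - p) ^ card (?C v - F) * h (card (sols n (flip_clause k u ` F)))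
      = p ^ card F * (1 - p) ^ card (?C v - F) * h (card (sols n F))"
      by (simp add: card_sols_flip[OF u])
  qed simp
  finally show ?thesis by simp
qed

section \<open>Concentration\<close>

text \<open>
  A clause that keeps a fraction \<open>x = a / b\<close> of the solutions changes \<open>ln Z\<close> by \<open>ln x\<close>, which may be of
  order \<open>n\<close>. But it is present only if the hidden assignment is among the solutions kept, and
  \<open>x (ln x)^2\<close> is bounded.
\<close>
lemma mult_ln_square_le:
  fixes a b :: real
  assumes "0 < a" "a \<le> b"
  shows "a * (ln a - ln b)\<^sup>2 \<le> 2 * b"
proof -
  define x where "x = ln (b / a)"
  have x: "0 \<le> x" "exp x = b / a" using assms by (simp_all add: x_def)
  have "x\<^sup>2 / 2 \<le> exp x" using exp_lower_Taylor_quadratic[OF x(1)] x(1) by linarith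
  then have "x\<^sup>2 \<le> 2 * (b / a)" unfolding x(2) by linarith
  then have "a * x\<^sup>2 \<le> a * (2 * (b / a))" using assms(1) by (intro mult_left_mono) auto
  also have "\<dots> = 2 * b" using assms by simp
  also have "x\<^sup>2 = (ln a - ln b)\<^sup>2" using assms by (simp add: x_def ln_div power2_commute)
  finally show ?thesis .
qed

lemma planted_mean_linear: "planted_mean t k n p (\<lambda>F. u * f F + v * g F) = u * planted_mean t k n p f + v * planted_mean t k n p g"
  by (simp add: planted_mean_def bern_linear sum.distrib sum_distrib_left[symmetric] add_divide_distrib)

lemma planted_mean_const: "planted_mean t k n p (\<lambda>F. c) = c"
  by (simp add: planted_mean_def bern_const)

lemma planted_mean_mono:
  assumes "0 \<le> p" "p \<le> 1" "\<And>F. F \<subseteq> clauses t k n \<Longrightarrow> sols n F \<noteq> {} \<Longrightarrow> f F \<le> g F"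
  shows "planted_mean t k n p f \<le> planted_mean t k n p g"
  unfolding planted_mean_def
proof (intro divide_right_mono sum_mono bern_mono assms(1,2))
  fix v F assume v: "v \<in> cube n" and F: "F \<subseteq> {c \<in> clauses t k n. satisfies_clause v c}"
  then have "v \<in> sols n F" by (auto simp: sols_def satisfies_def)
  then show "f F \<le> g F" using assms(3) F by blast
qed simp

lemma sols_mono: "F \<subseteq> G \<Longrightarrow> sols n G \<subseteq> sols n F"
  by (auto simp: sols_def satisfies_def)

lemma finite_sols [simp]: "finite (sols n F)"
  unfolding sols_def by simp

text \<open>
  Exchange the sums, so that for a given formula \<open>F\<close> and a given further clause the hidden assignment
  ranges over the solutions of both. This produces the factor that tames the logarithm.
\<close>
lemma sum_bern_increments:
  fixes n :: nat
  assumes k: "1 \<le> k" and p: "0 \<le> p" "p < 1"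
  defines "f \<equiv> \<lambda>F. ln (real (card (sols n F)))"
  shows "(\<Sum>v\<in>cube n. p * (1 - p) * (\<Sum>c\<in>{c \<in> clauses t k n. satisfies_clause v c}.
       bern p ({c \<in> clauses t k n. satisfies_clause v c} - {c}) (\<lambda>F. (f (insert c F) - f F)\<^sup>2)))
     \<le> 2 * p * real (card (clauses t k n)) * 2 ^ n"
proof -
  let ?C = "clauses t k n" and ?M = "num_satisfied t k n" and ?r = "p / (1 - p)"
  let ?Cv = "\<lambda>v. {c \<in> ?C. satisfies_clause v c}" and ?d = "\<lambda>c F. (f (insert c F) - f F)\<^sup>2"
  let ?w = "\<lambda>F. p * ((1 - p) ^ ?M * ?r ^ card F)"
  have r: "0 \<le> ?r" using p by simp
  have w: "0 \<le> ?w F" for F :: "clause set" using p r by simp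
  have nn: "0 \<le> (if b then ?w F * ?d c F else 0)" for b c F
    using mult_nonneg_nonneg[OF w zero_le_power2, of F "f (insert c F) - f F"] by (cases b) (simp_all only: if_True if_False order_refl)
  have one: "p * (1 - p) * bern p (?Cv v - {c}) (?d c) \<le> (\<Sum>F\<in>Pow ?C. if v \<in> sols n (insert c F) then ?w F * ?d c F else 0)"
    if v: "v \<in> cube n" and c: "c \<in> ?Cv v" for v c
  proof -
    let ?D = "?Cv v - {c}"
    have M: "card (?Cv v) = ?M" by (rule card_satisfied_clauses[OF v k])
    have fin: "finite ?D" by simp
    have "finite (?Cv v)" by simp
    from card_Suc_Diff1[OF this c] have D: "Suc (card ?D) = ?M" unfolding M .
    have "p * (1 - p) * bern p ?D (?d c) = (\<Sum>F\<in>Pow ?D. ?w F * ?d c F)"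
      unfolding bern_def sum_distrib_left
    proof (rule sum.cong)
      fix F assume "F \<in> Pow ?D"
      then have F: "F \<subseteq> ?D" by simp
      have cF: "card (?D - F) = card ?D - card F" "card F \<le> card ?D"
        using card_Diff_subset[OF finite_subset[OF F fin] F] card_mono[OF fin F] by auto
      \<comment> \<open>Rewrite the Bernoulli weight such that it no longer refers to the hidden assignment.\<close>
    have "(1 - p) ^ ?M = (1 - p) ^ card F * ((1 - p) * (1 - p) ^ card (?D - F))"
        unfolding D[symmetric] cF(1) using cF(2) by (simp flip: power_add power_Suc)
      then have "(1 - p) ^ ?M * ?r ^ card F = p ^ card F * ((1 - p) * (1 - p) ^ card (?D - F))"
        using p by (simp add: power_divide)
      then show "p * (1 - p) * (p ^ card F * (1 - p) ^ card (?D - F) * ?d c F) = ?w F * ?d c F"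
        by (simp add: mult_ac)
    qed simp
    also have "\<dots> = (\<Sum>F\<in>Pow ?D. if v \<in> sols n (insert c F) then ?w F * ?d c F else 0)"
      using v c by (intro sum.cong) (auto simp: sols_def satisfies_def)
    also have "\<dots> \<le> (\<Sum>F\<in>Pow ?C. if v \<in> sols n (insert c F) then ?w F * ?d c F else 0)"
    proof (rule sum_mono2)
      show "0 \<le> (if v \<in> sols n (insert c F) then ?w F * ?d c F else 0)" for F
        by (rule nn)
    qed auto
    finally show ?thesis .
  qed
  have "(\<Sum>v\<in>cube n. p * (1 - p) * (\<Sum>c\<in>?Cv v. bern p (?Cv v - {c}) (?d c)))
     \<le> (\<Sum>v\<in>cube n. \<Sum>c\<in>?Cv v. \<Sum>F\<in>Pow ?C. if v \<in> sols n (insert c F) then ?w F * ?d c F else 0)"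
    unfolding sum_distrib_left by (intro sum_mono one)
  also have "\<dots> \<le> (\<Sum>v\<in>cube n. \<Sum>c\<in>?C. \<Sum>F\<in>Pow ?C. if v \<in> sols n (insert c F) then ?w F * ?d c F else 0)"
  proof (rule sum_mono)
    fix v
    show "(\<Sum>c\<in>?Cv v. \<Sum>F\<in>Pow ?C. if v \<in> sols n (insert c F) then ?w F * ?d c F else 0)
      \<le> (\<Sum>c\<in>?C. \<Sum>F\<in>Pow ?C. if v \<in> sols n (insert c F) then ?w F * ?d c F else 0)"
    proof (rule sum_mono2)
      show "0 \<le> (\<Sum>F\<in>Pow ?C. if v \<in> sols n (insert c F) then ?w F * ?d c F else 0)" for c
        by (rule sum_nonneg) (rule nn)
    qed auto
  qed
  also have "\<dots> = (\<Sum>c\<in>?C. \<Sum>v\<in>cube n. \<Sum>F\<in>Pow ?C. if v \<in> sols n (insert c F) then ?w F * ?d c F else 0)"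
    by (rule sum.swap)
  also have "\<dots> = (\<Sum>c\<in>?C. \<Sum>F\<in>Pow ?C. \<Sum>v\<in>cube n. if v \<in> sols n (insert c F) then ?w F * ?d c F else 0)"
    by (intro sum.cong refl sum.swap)
  also have "\<dots> \<le> (\<Sum>c\<in>?C. \<Sum>F\<in>Pow ?C. ?w F * (2 * real (card (sols n F))))"
  proof (intro sum_mono)
    fix c F
    have "cube n \<inter> {v. v \<in> sols n (insert c F)} = sols n (insert c F)" by (auto simp: sols_def)
    then have "(\<Sum>v\<in>cube n. if v \<in> sols n (insert c F) then ?w F * ?d c F else 0) = ?w F * (real (card (sols n (insert c F))) * ?d c F)"
      by (simp add: sum.If_cases)
    also have "real (card (sols n (insert c F))) * ?d c F \<le> 2 * real (card (sols n F))"
    proof (cases "sols n (insert c F) = {}")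
      case False
      then have "0 < card (sols n (insert c F))" by (simp add: card_gt_0_iff)
      moreover have "card (sols n (insert c F)) \<le> card (sols n F)"
        by (intro card_mono finite_sols sols_mono) auto
      ultimately show ?thesis unfolding f_def by (intro mult_ln_square_le) auto
    qed simp
    finally show "(\<Sum>v\<in>cube n. if v \<in> sols n (insert c F) then ?w F * ?d c F else 0) \<le> ?w F * (2 * real (card (sols n F)))"
      using w[of F] by (simp add: mult_left_mono)
  qed
  also have "\<dots> = 2 * p * real (card ?C) * ((1 - p) ^ ?M * (\<Sum>F\<in>Pow ?C. ?r ^ card F * real (card (sols n F))))"
    by (simp add: sum_distrib_left mult_ac)
  also have "(1 - p) ^ ?M * (\<Sum>F\<in>Pow ?C. ?r ^ card F * real (card (sols n F))) = 2 ^ n"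
    using planted_mean_eq[OF k p(2), of t n "\<lambda>_. 1"] by (simp add: planted_mean_const)
  finally show ?thesis .
qed

text \<open>
  About \<open>p |C|\<close> clauses are present, and each contributes a bounded amount to the variance.
\<close>
lemma planted_variance_le:
  assumes k: "1 \<le> k" and p: "0 \<le> p" "p < 1"
  shows "planted_mean t k n p (\<lambda>F. (ln (real (card (sols n F))) - planted_ent t k n p)\<^sup>2)
    \<le> 2 * p * real (card (clauses t k n))"
proof -
  let ?f = "\<lambda>F. ln (real (card (sols n F)))" and ?Cv = "\<lambda>v. {c \<in> clauses t k n. satisfies_clause v c}"
    and ?h = "planted_ent t k n p"
  have mean: "bern p (?Cv v) ?f = ?h" if v: "v \<in> cube n" for v
  proof -
    have "(\<Sum>w\<in>cube n. bern p (?Cv w) ?f) = (\<Sum>w\<in>cube n. bern p (?Cv v) ?f)"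
      using bern_gauge[OF _ v, where h = "\<lambda>x. ln (real x)"] by (intro sum.cong) auto
    then show ?thesis by (simp add: planted_ent_def planted_mean_def)
  qed
  have var: "bern p (?Cv v) (\<lambda>F. (?f F - ?h)\<^sup>2) \<le> p * (1 - p) * (\<Sum>c\<in>?Cv v. bern p (?Cv v - {c}) (\<lambda>F. (?f (insert c F) - ?f F)\<^sup>2))"
    if v: "v \<in> cube n" for v
  proof -
    have eq: "(\<lambda>F. (?f F - ?h)\<^sup>2) = (\<lambda>F. 1 * (?f F)\<^sup>2 + 1 * ((- 2 * ?h) * ?f F + ?h\<^sup>2 * 1))"
      by (simp add: fun_eq_iff power2_eq_square algebra_simps)
    have "bern p (?Cv v) (\<lambda>F. (?f F - ?h)\<^sup>2) = bern p (?Cv v) (\<lambda>F. (?f F)\<^sup>2) + ((- 2 * ?h) * ?h + ?h\<^sup>2)"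
      unfolding eq bern_linear mean[OF v] by (simp add: bern_const)
    also have "\<dots> = bern p (?Cv v) (\<lambda>F. (?f F)\<^sup>2) - (bern p (?Cv v) ?f)\<^sup>2"
      unfolding mean[OF v] by (simp add: power2_eq_square)
    also have "\<dots> \<le> p * (1 - p) * (\<Sum>c\<in>?Cv v. bern p (?Cv v - {c}) (\<lambda>F. (?f (insert c F) - ?f F)\<^sup>2))"
      by (rule bern_variance_le) (use p in auto)
    finally show ?thesis .
  qed
  have "(\<Sum>v\<in>cube n. bern p (?Cv v) (\<lambda>F. (?f F - ?h)\<^sup>2)) \<le> 2 * p * real (card (clauses t k n)) * 2 ^ n"
    by (rule order_trans[OF sum_mono sum_bern_increments[OF k p]]) (rule var)
  then show ?thesis by (simp add: planted_mean_def divide_le_eq)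
qed

lemma planted_Chebyshev:
  assumes k: "1 \<le> k" and p: "0 \<le> p" "p < 1" and e: "0 < e"
    and A: "\<And>F. F \<in> A \<Longrightarrow> sols n F \<noteq> {} \<Longrightarrow> e \<le> \<bar>ln (real (card (sols n F))) - planted_ent t k n p\<bar>"
  shows "planted_mean t k n p (indicator A) \<le> 2 * p * real (card (clauses t k n)) / e\<^sup>2"
proof -
  let ?g = "\<lambda>F. (ln (real (card (sols n F))) - planted_ent t k n p)\<^sup>2"
  have "planted_mean t k n p (indicator A) \<le> planted_mean t k n p (\<lambda>F. (1 / e\<^sup>2) * ?g F + 0 * 0)"
  proof (rule planted_mean_mono)
    fix F assume "sols n F \<noteq> {}"
    show "indicator A F \<le> (1 / e\<^sup>2) * ?g F + 0 * 0"
    proof (cases "F \<in> A")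
      case True
      then have "e\<^sup>2 \<le> ?g F" using power_mono[OF A[OF True \<open>sols n F \<noteq> {}\<close>], of 2] e by simp
      then show ?thesis using True e by simp
    qed simp
  qed (use p in auto)
  also have "\<dots> = planted_mean t k n p ?g / e\<^sup>2" unfolding planted_mean_linear by simp
  also have "\<dots> \<le> 2 * p * real (card (clauses t k n)) / e\<^sup>2"
    by (intro divide_right_mono planted_variance_le[OF k p]) simp
  finally show ?thesis .
qed




section \<open>The law of the planted formula\<close>

lemma pmf_bernoulli_set:
  assumes "finite C" and p: "0 \<le> p" "p \<le> 1"
  shows "pmf (map_pmf Collect (Pi_pmf C False (\<lambda>_. bernoulli_pmf p))) F =
    (if F \<subseteq> C then p ^ card F * (1 - p) ^ card (C - F) else 0)"
proof -
  have inj: "inj Collect" by (rule injI) (simp add: set_eq_iff fun_eq_iff)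
  have "pmf (map_pmf Collect (Pi_pmf C False (\<lambda>_. bernoulli_pmf p))) (Collect (\<lambda>c. c \<in> F)) =
     pmf (Pi_pmf C False (\<lambda>_. bernoulli_pmf p)) (\<lambda>c. c \<in> F)"
    by (rule pmf_map_inj'[OF inj])
  also have "\<dots> = (if F \<subseteq> C then \<Prod>c\<in>C. pmf (bernoulli_pmf p) (c \<in> F) else 0)"
    using assms(1) by (auto simp: pmf_Pi)
  also have "(\<Prod>c\<in>C. pmf (bernoulli_pmf p) (c \<in> F)) = (\<Prod>c\<in>C. if c \<in> F then p else 1 - p)"
    by (rule prod.cong) (auto simp: p)
  also have "\<dots> = p ^ card (C \<inter> F) * (1 - p) ^ card (C - F)"
    using assms(1) by (simp add: prod.If_cases Diff_eq)
  finally show ?thesis by (auto simp: Int_absorb1)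
qed

lemma prob_planted_formula:
  fixes \<alpha> :: real and t :: clause_type and k n :: nat
  defines "p \<equiv> \<alpha> * real n / real (card (clauses t k n))"
  assumes p: "0 \<le> p" "p \<le> 1"
  shows "measure_pmf.prob (planted_formula t k n \<alpha>) A = planted_mean t k n p (indicator A)"
proof -
  let ?C = "clauses t k n" and ?p = p and ?M = "planted_formula t k n \<alpha>"
  let ?Cv = "\<lambda>v. {c \<in> ?C. satisfies_clause v c}"
  let ?B = "\<lambda>v. map_pmf Collect (Pi_pmf (?Cv v) False (\<lambda>_. bernoulli_pmf ?p))"
  have M: "?M = bind_pmf (pmf_of_set (cube n)) ?B"
    by (simp add: planted_formula_def map_pmf_def p_def)
  have pmf: "pmf ?M F = (\<Sum>v\<in>cube n. if F \<subseteq> ?Cv v then ?p ^ card F * (1 - ?p) ^ card (?Cv v - F) else 0) / 2 ^ n" for F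
    unfolding M by (subst pmf_bind_pmf_of_set) (auto simp: pmf_bernoulli_set p)
  have "F \<subseteq> ?C" if "F \<in> set_pmf ?M" for F
  proof -
    have "pmf ?M F \<noteq> 0" using that by (simp add: set_pmf_iff)
    have "\<exists>v. F \<subseteq> ?Cv v"
    proof (rule ccontr)
      assume "\<nexists>v. F \<subseteq> ?Cv v"
      then have "pmf ?M F = 0" unfolding pmf by simp
      with \<open>pmf ?M F \<noteq> 0\<close> show False by blast
    qed
    then show ?thesis by blast
  qed
  then have "A \<inter> set_pmf ?M = (A \<inter> Pow ?C) \<inter> set_pmf ?M" by blast
  then have "measure_pmf.prob ?M A = measure_pmf.prob ?M (A \<inter> Pow ?C)"
    using measure_Int_set_pmf[of ?M A] measure_Int_set_pmf[of ?M "A \<inter> Pow ?C"] by simp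
  also have "\<dots> = (\<Sum>F\<in>A \<inter> Pow ?C. pmf ?M F)" by (rule measure_measure_pmf_finite) simp
  also have "\<dots> = (\<Sum>F\<in>A \<inter> Pow ?C. \<Sum>v\<in>cube n. if F \<subseteq> ?Cv v then ?p ^ card F * (1 - ?p) ^ card (?Cv v - F) else 0) / 2 ^ n"
    unfolding pmf by (simp only: sum_divide_distrib)
  also have "\<dots> = (\<Sum>v\<in>cube n. \<Sum>F\<in>A \<inter> Pow ?C. if F \<subseteq> ?Cv v then ?p ^ card F * (1 - ?p) ^ card (?Cv v - F) else 0) / 2 ^ n"
    by (subst sum.swap) simp
  also have "\<dots> = planted_mean t k n ?p (indicator A)"
    unfolding planted_mean_def bern_def
  proof (rule arg_cong2[where f = "(/)", OF sum.cong[OF refl] refl])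
    fix v
    let ?w = "\<lambda>F. ?p ^ card F * (1 - ?p) ^ card (?Cv v - F)"
    have "(\<Sum>F\<in>A \<inter> Pow ?C. if F \<subseteq> ?Cv v then ?w F else 0) = (\<Sum>F\<in>(A \<inter> Pow ?C) \<inter> {F. F \<subseteq> ?Cv v}. ?w F)"
      by (subst sum.inter_restrict) simp_all
    also have "(A \<inter> Pow ?C) \<inter> {F. F \<subseteq> ?Cv v} = Pow (?Cv v) \<inter> A" by blast
    also have "(\<Sum>F\<in>Pow (?Cv v) \<inter> A. ?w F) = (\<Sum>F\<in>Pow (?Cv v). ?w F * indicator A F)"
      by (simp add: sum.inter_restrict indicator_def of_bool_def if_distrib cong: if_cong)
    finally show "(\<Sum>F\<in>A \<inter> Pow ?C. if F \<subseteq> ?Cv v then ?w F else 0) = (\<Sum>F\<in>Pow (?Cv v). ?w F * indicator A F)" .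
  qed
  finally show ?thesis .
qed

section \<open>Existence of the limit\<close>

text \<open>
  The limit is the infimum of \<open>a l + e l\<close>: no late term exceeds such a number, and no term is below
  the infimum by more than \<open>e\<close>.
\<close>
lemma almost_subadditive_convergent:
  fixes a e :: "nat \<Rightarrow> real"
  assumes e: "e \<longlonglongrightarrow> 0" "\<And>l. 0 \<le> e l" and a: "\<And>n. 0 \<le> a n"
    and le: "\<And>l n. start \<le> l \<Longrightarrow> l\<^sup>2 \<le> n \<Longrightarrow> a n \<le> a l + e l"
  shows "convergent a"
proof -
  define L where "L = (INF l\<in>{start..}. a l + e l)"
  have bdd: "bdd_below ((\<lambda>l. a l + e l) ` {start..})"
    by (rule bdd_belowI2[of _ 0]) (simp add: a e)
  have "a \<longlonglongrightarrow> L"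
  proof (rule LIMSEQ_I)
    fix r :: real assume r: "0 < r"
    have "\<exists>l\<in>{start..}. a l + e l < L + r"
      using r cINF_less_iff[OF _ bdd, of "L + r"] by (simp add: L_def)
    then obtain l where l: "start \<le> l" "a l + e l < L + r" by auto
    from LIMSEQ_D[OF e(1) r] obtain n0 where n0: "\<And>n. n0 \<le> n \<Longrightarrow> norm (e n - 0) < r" by blast
    have "norm (a n - L) < r" if n: "max (l\<^sup>2) (max start n0) \<le> n" for n
    proof -
      have "a n < L + r" using le[OF l(1), of n] l(2) n by simp
      moreover have "L \<le> a n + e n" unfolding L_def by (rule cINF_lower[OF bdd]) (use n in simp)
      moreover have "e n < r" using n0[of n] n by simp
      ultimately show ?thesis by (simp add: abs_less_iff)
    qed
    then show "\<exists>no. \<forall>n\<ge>no. norm (a n - L) < r" by blast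
  qed
  then show ?thesis by (rule convergentI)
qed

lemma mean_ent_bounds:
  assumes t: "valid_arity t k" and D: "edge_set n k D"
  shows "0 \<le> mean_ent t k D n m" "mean_ent t k D n m \<le> real n * ln 2"
proof -
  have T: "averaging (sol_class t n) (edge_op t k D ^^ m)"
    by (intro averaging_funpow averaging_edge_op t D)
  have "0 \<le> ent S" for S :: "bool list set"
  proof (cases "card S = 0")
    case False
    then show ?thesis by (simp add: ent_def)
  qed (simp add: ent_def)
  then have "(edge_op t k D ^^ m) (\<lambda>S. 0) (cube n) \<le> (edge_op t k D ^^ m) ent (cube n)"
    by (intro averaging_mono[OF T _ sol_class_cube])
  then show "0 \<le> mean_ent t k D n m" by (simp add: averaging_zero[OF T] mean_ent_def)
  have "mean_ent t k D n m \<le> mean_ent t k D n 0"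
    by (induction m) (auto intro: order_trans[OF mean_ent_decreasing(1)[OF t D]])
  also have "\<dots> = real n * ln 2" by (simp add: mean_ent_def ent_def ln_realpow)
  finally show "mean_ent t k D n m \<le> real n * ln 2" .
qed

definition ent_rate :: "clause_type \<Rightarrow> nat \<Rightarrow> real \<Rightarrow> nat \<Rightarrow> real" where
  "ent_rate t k \<beta> n = mean_ent t k (sorted_edges n k) n (nat \<lfloor>\<beta> * real n\<rfloor>) / real n"

text \<open>
  Insert into \<open>mean_ent_comparison\<close> the following parameters: \<open>s = sqrt l\<close>, about \<open>sqrt l\<close> pins per block,
  and \<open>\<delta> = 1 / sqrt s\<close>. Then every error per variable is of order \<open>1 / sqrt s\<close>. The assumption \<open>l^2 \<le> n\<close>
  leaves at least \<open>l\<close> blocks, so that the fewer than \<open>l\<close> remaining variables are negligible.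
\<close>
lemma ent_rate_comparison:
  assumes t: "valid_arity t k" and \<beta>: "0 \<le> \<beta>" and l: "k \<le> l" and n: "l\<^sup>2 \<le> n"
  shows "ent_rate t k \<beta> n \<le> ent_rate t k \<beta> l
     + (2 * \<beta> * (real k)\<^sup>2 + 3 * \<beta> * real k + 2 * \<beta> + (\<beta> + 2)\<^sup>2 + 4) / sqrt (sqrt (real l))"
proof -
  have k: "1 \<le> k" using t by (simp add: valid_arity_def)
  with l have l1: "1 \<le> l" by simp
  define q r where "q = n div l" and "r = n mod l"
  have nq: "n = q * l + r" by (simp add: q_def r_def)
  have r: "r < l" using l1 by (simp add: r_def)
  have "l * l div l \<le> n div l" using n by (intro div_le_mono) (simp add: power2_eq_square)
  then have q: "l \<le> q" using l1 by (simp add: q_def)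
  define m i where "m = nat \<lfloor>\<beta> * real n\<rfloor>" and "i = nat \<lfloor>\<beta> * real l\<rfloor>"
  have floor: "real (nat \<lfloor>x\<rfloor>) \<le> x" "x - 1 \<le> real (nat \<lfloor>x\<rfloor>)" if "0 \<le> x" for x
    using that by (simp_all add: of_nat_nat)
  have m: "real m \<le> \<beta> * real n" "\<beta> * real n - 1 \<le> real m"
    and i: "real i \<le> \<beta> * real l" "\<beta> * real l - 1 \<le> real i"
    unfolding m_def i_def by (intro floor mult_nonneg_nonneg \<beta> of_nat_0_le_iff)+
  let ?l = "real l" and ?n = "real n" and ?q = "real q" and ?r = "real r" and ?k = "real k"
  have l0: "1 \<le> ?l" using l1 by simp
  have q0: "?l \<le> ?q" "0 < ?q" using q l1 by simp_all
  have "1 * 1 \<le> l * l" "l * l \<le> n" "q * l \<le> n"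
    using nq n l1 by (intro mult_le_mono, simp_all add: power2_eq_square)
  then have n0: "?n = ?q * ?l + ?r" "0 < ?n" "?q * ?l \<le> ?n" "?l * ?l \<le> ?n"
    unfolding of_nat_mult[symmetric] of_nat_add[symmetric] of_nat_le_iff of_nat_eq_iff
    using nq by linarith+
  define s where "s = sqrt ?l"
  define d where "d = 1 / sqrt s"
  have s: "1 \<le> s" "s * s = ?l" using l0 by (simp_all add: s_def)
  have ss: "1 \<le> sqrt s" "sqrt s * sqrt s = s" using s by simp_all
  have d: "0 < d" "d \<le> 1" "d * d = 1 / s"
    using ss s by (simp_all add: d_def)
  have sd: "1 / s \<le> d" using mult_left_mono[OF d(2), of d] d by simp
  have "1 / ?l = (1 / s) * (1 / s)" using s by simp
  also have "\<dots> \<le> (1 / s) * 1" using s by (intro mult_left_mono) auto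
  finally have "1 / ?l \<le> 1 / s" by simp
  with sd have ld: "1 / ?l \<le> d" by linarith
  define T0 where "T0 = nat \<lceil>s\<rceil>"
  have T0: "s \<le> real T0" "real T0 \<le> s + 1" "0 < T0"
    using s by (auto simp: T0_def)
  have cmp: "mean_ent t k (sorted_edges n k) n m \<le> ?q * (mean_ent t k (sorted_edges l k) l i
      + real i * (?k\<^sup>2 / ?l) + (s + (real m / ?q + (real m / ?q - real i)\<^sup>2) / s))
    + ?r + real m * ((?k\<^sup>2 + ?k * ?r) / ?n)
    + (real (q * T0) + real m * ?k * (d + ?q / (d * real (q * T0))))"
    unfolding nq by (rule mean_ent_comparison[OF t]) (use q l1 l d s T0 in auto)
  have a0: "0 \<le> mean_ent t k (sorted_edges l k) l i" by (rule mean_ent_bounds(1)[OF t edge_set_sorted[OF l]])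
  have rq: "?r / ?q \<le> 1" using r q by simp
  have mq: "real m / ?q \<le> \<beta> * ?l + \<beta> * (?r / ?q)"
    using m(1) q0 unfolding n0(1) by (simp add: divide_le_eq algebra_simps)
  \<comment> \<open>The number of clauses per block differs from the number \<open>i\<close> used on \<open>l\<close> variables by a bounded amount.\<close>
  have mq1: "\<beta> * ?l - 1 \<le> real m / ?q"
  proof -
    have "(\<beta> * ?l - 1) * ?q \<le> \<beta> * ?n - 1"
    proof -
      have "1 \<le> ?q" "0 \<le> \<beta> * ?r" using q0 l0 \<beta> by auto
      then show ?thesis unfolding n0(1) by (simp add: algebra_simps)
    qed
    then show ?thesis using m(2) q0 by (simp add: le_divide_eq)
  qed
  have br: "\<beta> * (?r / ?q) \<le> \<beta>" using mult_left_mono[OF rq \<beta>] by simp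
  have x1: "real i * (?k\<^sup>2 / ?l) \<le> \<beta> * ?k\<^sup>2"
    using mult_right_mono[OF i(1), of "?k\<^sup>2 / ?l"] l0 by simp
  have x2: "real m / ?q \<le> 2 * \<beta> * ?l"
    using mq br \<beta> l0 mult_left_mono[OF l0 \<beta>] by linarith
  have x3: "(real m / ?q - real i)\<^sup>2 \<le> (\<beta> + 2)\<^sup>2"
  proof (rule power2_le_iff_abs_le[THEN iffD2])
    show "\<bar>real m / ?q - real i\<bar> \<le> \<beta> + 2"
      using mq mq1 br i \<beta> by linarith
  qed (use \<beta> in simp)
  define X where "X = mean_ent t k (sorted_edges l k) l i + real i * (?k\<^sup>2 / ?l) + (s + (real m / ?q + (real m / ?q - real i)\<^sup>2) / s)"
  define Y where "Y = mean_ent t k (sorted_edges l k) l i + \<beta> * ?k\<^sup>2 + (s + (2 * \<beta> * ?l + (\<beta> + 2)\<^sup>2) / s)"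
  have XY: "X \<le> Y" unfolding X_def Y_def using x1 x2 x3 s(1)
    by (intro add_mono divide_right_mono order_refl) auto
  have Y0: "0 \<le> Y" unfolding Y_def using a0 \<beta> s(1) by (intro add_nonneg_nonneg divide_nonneg_nonneg mult_nonneg_nonneg) auto
  have "?q * X / ?n \<le> ?q * Y / ?n" using XY n0(2) by (intro divide_right_mono mult_left_mono) auto
  also have "\<dots> \<le> Y / ?l"
    using mult_left_mono[OF n0(3) Y0] n0(2) l0 by (simp add: field_simps)
  also have "Y / ?l = mean_ent t k (sorted_edges l k) l i / ?l + \<beta> * ?k\<^sup>2 * (1 / ?l) + (s / ?l + (2 * \<beta> * ?l / s / ?l + (\<beta> + 2)\<^sup>2 / s / ?l))"
    unfolding Y_def by (simp add: add_divide_distrib)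
  also have "s / ?l = 1 / s" using s l0 by (simp add: divide_simps)
  also have "2 * \<beta> * ?l / s / ?l = 2 * \<beta> * (1 / s)" using l0 by simp
  also have "(\<beta> + 2)\<^sup>2 / s / ?l = ((\<beta> + 2)\<^sup>2 * (1 / s)) * (1 / ?l)" by simp
  also have "mean_ent t k (sorted_edges l k) l i / ?l + \<beta> * ?k\<^sup>2 * (1 / ?l) + (1 / s + (2 * \<beta> * (1 / s) + ((\<beta> + 2)\<^sup>2 * (1 / s)) * (1 / ?l)))
     \<le> mean_ent t k (sorted_edges l k) l i / ?l + \<beta> * ?k\<^sup>2 * d + (d + (2 * \<beta> * d + ((\<beta> + 2)\<^sup>2 * d) * 1))"
    using ld sd \<beta> l0 s d by (intro add_mono mult_mono order_refl) auto
  finally have A: "?q * X / ?n \<le> mean_ent t k (sorted_edges l k) l i / ?l + d * (\<beta> * ?k\<^sup>2 + 1 + 2 * \<beta> + (\<beta> + 2)\<^sup>2)"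
    by (simp add: algebra_simps)
  have mn: "real m / ?n \<le> \<beta>" using m(1) n0(2) by (simp add: divide_le_eq)
  have nl: "1 / ?n \<le> 1 / ?l * (1 / ?l)" using n0(4) l0 by (simp add: divide_simps)
  also have "\<dots> \<le> 1 / ?l * 1" using l0 by (intro mult_left_mono) auto
  finally have nl': "1 / ?n \<le> 1 / ?l" by simp
  have "?r * (1 / ?n) \<le> ?l * (1 / ?l * (1 / ?l))" using r nl l0 by (intro mult_mono) auto
  then have rn: "?r * (1 / ?n) \<le> 1 / ?l" using l0 by simp
  have "real m * ((?k\<^sup>2 + ?k * ?r) / ?n) / ?n = (real m / ?n) * (?k\<^sup>2 * (1 / ?n) + ?k * (?r * (1 / ?n)))"
    by (simp add: add_divide_distrib)
  also have "\<dots> \<le> \<beta> * (?k\<^sup>2 * d + ?k * d)"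
    using mn nl' rn ld \<beta> n0(2) by (intro mult_mono add_mono) auto
  finally have B: "(?r + real m * ((?k\<^sup>2 + ?k * ?r) / ?n)) / ?n \<le> d + \<beta> * (?k\<^sup>2 * d + ?k * d)"
    using rn ld by (simp add: add_divide_distrib)
  have "real (q * T0) / ?n \<le> real T0 / ?l"
    using mult_left_mono[OF n0(3), of "real T0"] n0(2) l0 by (simp add: field_simps)
  also have "\<dots> \<le> (s + 1) / ?l" using T0(2) l0 by (intro divide_right_mono) auto
  also have "\<dots> = 1 / s + 1 / ?l" using \<open>s / ?l = 1 / s\<close> by (simp add: add_divide_distrib)
  finally have C1: "real (q * T0) / ?n \<le> 2 * d" using sd ld by linarith
  have "1 / (d * real T0) \<le> 1 / (d * s)" using T0 d s by (intro divide_left_mono mult_left_mono mult_pos_pos) auto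
  also have "\<dots> = d" using d s by (simp add: field_simps)
  finally have dT: "?q / (d * real (q * T0)) \<le> d" using q0(2) by simp
  have "real m * ?k * (d + ?q / (d * real (q * T0))) / ?n = (real m / ?n) * (?k * (d + ?q / (d * real (q * T0))))"
    by simp
  also have "\<dots> \<le> \<beta> * (?k * (d + d))"
    using mn dT \<beta> d by (intro mult_mono add_mono mult_nonneg_nonneg add_nonneg_nonneg divide_nonneg_nonneg) auto
  finally have C: "(real (q * T0) + real m * ?k * (d + ?q / (d * real (q * T0)))) / ?n \<le> 2 * d + \<beta> * (?k * (d + d))"
    using C1 by (simp add: add_divide_distrib)
  have "mean_ent t k (sorted_edges n k) n m / ?n \<le> (?q * X + ?r + real m * ((?k\<^sup>2 + ?k * ?r) / ?n)
    + (real (q * T0) + real m * ?k * (d + ?q / (d * real (q * T0))))) / ?n"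
    using cmp unfolding X_def[symmetric] by (intro divide_right_mono) auto
  also have "\<dots> = ?q * X / ?n + (?r + real m * ((?k\<^sup>2 + ?k * ?r) / ?n)) / ?n
    + (real (q * T0) + real m * ?k * (d + ?q / (d * real (q * T0)))) / ?n"
    by (simp only: add_divide_distrib)
  also have "\<dots> \<le> mean_ent t k (sorted_edges l k) l i / ?l + (2 * \<beta> * ?k\<^sup>2 + 3 * \<beta> * ?k + 2 * \<beta> + (\<beta> + 2)\<^sup>2 + 4) * d"
    using A B C by (simp add: algebra_simps)
  finally show ?thesis by (simp add: ent_rate_def m_def i_def d_def s_def)
qed

lemma ent_rate_convergent:
  assumes t: "valid_arity t k" and \<beta>: "0 \<le> \<beta>"
  shows "convergent (ent_rate t k \<beta>)"
proof -
  define K where "K = 2 * \<beta> * (real k)\<^sup>2 + 3 * \<beta> * real k + 2 * \<beta> + (\<beta> + 2)\<^sup>2 + 4"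
  \<comment> \<open>For \<open>n < k\<close> there are no edges and the rate has no meaning; the maximum makes it nonnegative.\<close>
  let ?a = "\<lambda>n. max 0 (ent_rate t k \<beta> n)"
  have K: "0 \<le> K" unfolding K_def using \<beta> by (intro add_nonneg_nonneg mult_nonneg_nonneg) auto
  have pos: "0 \<le> ent_rate t k \<beta> n" if "k \<le> n" for n
    unfolding ent_rate_def using mean_ent_bounds(1)[OF t edge_set_sorted[OF that]] by simp
  have "convergent ?a"
  proof (rule almost_subadditive_convergent[where start = k and e = "\<lambda>l. K / sqrt (sqrt (real l))"])
    have "(\<lambda>l. 1 / sqrt (sqrt (real l))) \<longlonglongrightarrow> 0" by real_asymp
    from tendsto_mult_right_zero[OF this, of K]
    show "(\<lambda>l. K / sqrt (sqrt (real l))) \<longlonglongrightarrow> 0" by simp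
    fix l n assume l: "k \<le> l" "l\<^sup>2 \<le> n"
    have "l \<le> l\<^sup>2" by (cases l) (auto simp: power2_eq_square)
    then have "l \<le> n" using l(2) by (rule le_trans)
    then show "?a n \<le> ?a l + K / sqrt (sqrt (real l))"
      using ent_rate_comparison[OF t \<beta> l] pos[of n] pos[OF l(1)] l(1) by (simp add: K_def)
  qed (use K in auto)
  then obtain L where "?a \<longlonglongrightarrow> L" by (auto simp: convergent_def)
  moreover have "eventually (\<lambda>n. ?a n = ent_rate t k \<beta> n) sequentially"
    using eventually_ge_at_top[of k] by eventually_elim (simp add: pos)
  ultimately have "ent_rate t k \<beta> \<longlonglongrightarrow> L" by (rule Lim_transform_eventually)
  then show ?thesis by (rule convergentI)
qed

lemma card_clauses: "card (clauses t k n) = (n choose k) * card (clause_functions t k)"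
  by (simp add: clauses_def card_cartesian_product n_subsets)

text \<open>
  The planted formula has about \<open>\<beta> n\<close> clauses, where \<open>\<beta>\<close> is \<open>\<alpha>\<close> times the fraction of clause
  functions satisfied by a given input. The Poisson mean \<open>u\<close> differs from \<open>\<beta> n\<close> by a bounded amount,
  since \<open>p\<close> is of order \<open>1 / n\<close>; here \<open>2 \<le> k\<close> is used.
\<close>
lemma planted_rate_limit:
  fixes t :: clause_type
  assumes k: "2 \<le> k" and \<alpha>: "0 \<le> \<alpha>"
  defines "p \<equiv> \<lambda>n. \<alpha> * real n / real (card (clauses t k n))"
  shows "\<exists>L. 0 \<le> L \<and> L \<le> ln 2 \<and> (\<lambda>n. planted_ent t k n (p n) / real n) \<longlonglongrightarrow> L"
    and "eventually (\<lambda>n. 0 \<le> p n \<and> p n < 1 \<and> p n * real (card (clauses t k n)) = \<alpha> * real n) sequentially"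
proof -
  have t: "valid_arity t k" using k by (simp add: valid_arity_def)
  let ?X = "real (card (clause_functions t k))"
  have X: "2 \<le> ?X" using card_clause_functions_ge_2[OF t] by simp
  define \<beta> where "\<beta> = \<alpha> * (?X - 1) / ?X"
  have \<beta>: "0 \<le> \<beta>" using \<alpha> X by (simp add: \<beta>_def)
  define c where "c = \<alpha> * (real k)\<^sup>2"
  define K where "K = 2 * \<beta> * c"
  have c0: "0 \<le> c" using \<alpha> by (simp add: c_def)
  have K0: "0 \<le> K" using c0 \<beta> by (simp add: K_def)
  have large: "0 \<le> p n \<and> p n \<le> 1 / 2 \<and> p n * real (card (clauses t k n)) = \<alpha> * real n \<and> p n \<le> c / real n"
    if n: "k \<le> n" "2 * c \<le> real n" for n
  proof -
    have n0: "0 < real n" using n(1) k by simp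
    \<comment> \<open>There are at least of order \<open>n^2\<close> clauses.\<close>
    have "(real n / real k)\<^sup>2 \<le> (real n / real k) ^ k"
      by (rule power_increasing) (use n k in \<open>auto simp: le_divide_eq\<close>)
    also have "\<dots> \<le> real (n choose k)" using binomial_ge_n_over_k_pow_k[OF n(1)] by simp
    also have "\<dots> = real (n choose k) * 1" by simp
    also have "\<dots> \<le> real (n choose k) * ?X" using X by (intro mult_left_mono) auto
    finally have N: "(real n / real k)\<^sup>2 \<le> real (card (clauses t k n))" by (simp add: card_clauses)
    have N0: "0 < (real n / real k)\<^sup>2" using n0 k by simp
    with N have N1: "0 < real (card (clauses t k n))" by linarith
    have "p n \<le> \<alpha> * real n / (real n / real k)\<^sup>2"
      unfolding p_def using \<alpha> n0 by (intro divide_left_mono N mult_nonneg_nonneg mult_pos_pos[OF N1 N0]) auto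
    also have "\<dots> = c / real n" using n0 k by (simp add: c_def field_simps power2_eq_square)
    finally have "p n \<le> c / real n" .
    moreover have "c / real n \<le> 1 / 2" using n(2) n0 by (simp add: divide_le_eq)
    moreover have "0 \<le> p n" using \<alpha> by (simp add: p_def)
    moreover have "p n * real (card (clauses t k n)) = \<alpha> * real n" 
    proof -
      have "x / y * y = x" if "0 < y" for x y :: real using that by simp
      from this[OF N1] show ?thesis unfolding p_def .
    qed
    ultimately show ?thesis by linarith
  qed
  have ev: "eventually (\<lambda>n. k \<le> n \<and> 2 * c \<le> real n) sequentially"
    by (intro eventually_conj eventually_ge_at_top) real_asymp
  show "eventually (\<lambda>n. 0 \<le> p n \<and> p n < 1 \<and> p n * real (card (clauses t k n)) = \<alpha> * real n) sequentially"
    using ev by eventually_elim (use large in fastforce)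
  have close: "\<bar>planted_ent t k n (p n) / real n - ent_rate t k \<beta> n\<bar> \<le> (1 + \<beta>) * (1 / sqrt (real n)) + (K + (K + 1)\<^sup>2) * (1 / (real n * sqrt (real n)))"
    if n: "k \<le> n" "2 * c \<le> real n" for n
  proof -
    have n0: "0 < real n" using n(1) k by simp
    have p: "0 \<le> p n" "p n \<le> 1 / 2" "p n \<le> c / real n" "p n * real (card (clauses t k n)) = \<alpha> * real n"
      using large[OF n] by auto
    let ?M = "real (num_satisfied t k n)" and ?i = "nat \<lfloor>\<beta> * real n\<rfloor>"
    define u where "u = - ln (1 - p n) * ?M"
    have M: "p n * ?M = \<beta> * real n"
    proof -
      have "?M = real (card (clauses t k n)) * ((?X - 1) / ?X)"
      proof -
        have "b * (x - 1) = b * x * ((x - 1) / x)" if "2 \<le> x" for b x :: real using that by simp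
        from this[OF X] show ?thesis unfolding real_num_satisfied[OF t] card_clauses of_nat_mult .
      qed
      then have "p n * ?M = (p n * real (card (clauses t k n))) * ((?X - 1) / ?X)" by simp
      then show ?thesis by (simp add: p(4) \<beta>_def)
    qed
    have "ln (1 - p n) \<le> - p n" using ln_le_minus_one[of "1 - p n"] p(2) by simp
    then have "p n * ?M \<le> u" unfolding u_def by (intro mult_right_mono) auto
    then have u1: "\<beta> * real n \<le> u" using M by simp
    have "ln (1 / (1 - p n)) \<le> 1 / (1 - p n) - 1" by (rule ln_le_minus_one) (use p(2) in simp)
    then have "- ln (1 - p n) \<le> 1 / (1 - p n) - 1" using p(2) by (simp add: ln_div)
    also have "\<dots> \<le> p n + p n * (2 * p n)"
    proof -
      have "0 \<le> p n * p n * (1 - 2 * p n)" using p by simp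
      then have "1 \<le> (1 + (p n + p n * (2 * p n))) * (1 - p n)" by (simp add: algebra_simps)
      moreover have "0 < 1 - p n" using p(2) by simp
      ultimately have "1 / (1 - p n) \<le> 1 + (p n + p n * (2 * p n))" by (simp only: pos_divide_le_eq)
      then show ?thesis by linarith
    qed
    also have "\<dots> = p n * (1 + 2 * p n)" by (simp add: algebra_simps)
    finally have "u \<le> p n * (1 + 2 * p n) * ?M" unfolding u_def by (intro mult_right_mono) auto
    also have "\<dots> = \<beta> * real n + 2 * \<beta> * (real n * p n)"
      using M by (simp add: algebra_simps)
    also have "2 * \<beta> * (real n * p n) \<le> 2 * \<beta> * c"
      using p(3) n0 \<beta> by (intro mult_left_mono) (auto simp: le_divide_eq mult.commute)
    finally have u2: "u \<le> \<beta> * real n + K" by (simp add: K_def)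
    have i: "real ?i \<le> \<beta> * real n" "\<beta> * real n - 1 \<le> real ?i"
    proof -
      have "0 \<le> \<beta> * real n" using \<beta> by simp
      then have "real ?i = of_int \<lfloor>\<beta> * real n\<rfloor>" by (intro of_nat_nat) simp
      then show "real ?i \<le> \<beta> * real n" "\<beta> * real n - 1 \<le> real ?i" by linarith+
    qed
    have "\<bar>u - real ?i\<bar> \<le> \<bar>K + 1\<bar>" using u1 u2 i K0 by linarith
    then have sq: "(u - real ?i)\<^sup>2 \<le> (K + 1)\<^sup>2" by (simp only: abs_le_square_iff)
    have s: "0 < sqrt (real n)" using n0 by simp
    have "\<bar>planted_ent t k n (p n) - mean_ent t k (sorted_edges n k) n ?i\<bar> \<le> sqrt (real n) + (u + (u - real ?i)\<^sup>2) / sqrt (real n)"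
      unfolding u_def by (rule planted_ent_close[OF t n(1) p(1) _ s]) (use p(2) in simp)
    also have "\<dots> \<le> sqrt (real n) + (\<beta> * real n + K + (K + 1)\<^sup>2) / sqrt (real n)"
      using u2 sq s by (intro add_left_mono divide_right_mono add_mono) auto
    finally have "\<bar>planted_ent t k n (p n) - mean_ent t k (sorted_edges n k) n ?i\<bar> / real n
       \<le> (sqrt (real n) + (\<beta> * real n + K + (K + 1)\<^sup>2) / sqrt (real n)) / real n"
      using n0 by (intro divide_right_mono) auto
    also have "\<dots> = (1 + \<beta>) * (1 / sqrt (real n)) + (K + (K + 1)\<^sup>2) * (1 / (real n * sqrt (real n)))"
    proof -
      have "sqrt (real n) / real n = 1 / sqrt (real n)" using n0 by (simp add: real_div_sqrt field_simps)
      then show ?thesis using n0 by (simp add: add_divide_distrib distrib_right mult.commute)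
    qed
    finally show ?thesis unfolding ent_rate_def using n0
      by (simp flip: diff_divide_distrib)
  qed
  obtain L where L: "ent_rate t k \<beta> \<longlonglongrightarrow> L"
    using ent_rate_convergent[OF t \<beta>] by (auto simp: convergent_def)
  have err: "(\<lambda>n. (1 + \<beta>) * (1 / sqrt (real n)) + (K + (K + 1)\<^sup>2) * (1 / (real n * sqrt (real n)))) \<longlonglongrightarrow> 0"
  proof -
    have "(\<lambda>n. 1 / sqrt (real n)) \<longlonglongrightarrow> 0" "(\<lambda>n. 1 / (real n * sqrt (real n))) \<longlonglongrightarrow> 0"
      by real_asymp+
    from tendsto_add[OF tendsto_mult_right_zero[OF this(1), of "1 + \<beta>"] tendsto_mult_right_zero[OF this(2), of "K + (K + 1)\<^sup>2"]]
    show ?thesis by simp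
  qed
  have "(\<lambda>n. planted_ent t k n (p n) / real n - ent_rate t k \<beta> n) \<longlonglongrightarrow> 0"
  proof (rule Lim_null_comparison[OF _ err])
    show "eventually (\<lambda>n. norm (planted_ent t k n (p n) / real n - ent_rate t k \<beta> n) \<le>
      (1 + \<beta>) * (1 / sqrt (real n)) + (K + (K + 1)\<^sup>2) * (1 / (real n * sqrt (real n)))) sequentially"
      using ev by eventually_elim (use close in simp)
  qed
  from tendsto_add[OF this L] have lim: "(\<lambda>n. planted_ent t k n (p n) / real n) \<longlonglongrightarrow> L" by simp
  have bounds: "eventually (\<lambda>n. 0 \<le> ent_rate t k \<beta> n \<and> ent_rate t k \<beta> n \<le> ln 2) sequentially"
    using eventually_ge_at_top[of "max 1 k"]
  proof eventually_elim
    case (elim n)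
    then have "k \<le> n" "0 < real n" by simp_all
    then show ?case
      using mean_ent_bounds[OF t edge_set_sorted[OF \<open>k \<le> n\<close>], of "nat \<lfloor>\<beta> * real n\<rfloor>"]
      by (simp add: ent_rate_def divide_le_eq mult.commute)
  qed
  have "0 \<le> L" by (rule tendsto_lowerbound[OF L]) (use bounds in \<open>auto elim: eventually_mono\<close>)
  moreover have "L \<le> ln 2" by (rule tendsto_upperbound[OF L]) (use bounds in \<open>auto elim: eventually_mono\<close>)
  ultimately show "\<exists>L. 0 \<le> L \<and> L \<le> ln 2 \<and> (\<lambda>n. planted_ent t k n (p n) / real n) \<longlonglongrightarrow> L"
    using lim by blast
qed

text \<open>
  The scale \<open>e\<close> is half of \<open>\<epsilon>\<close> in natural units: for large \<open>n\<close> the mean of \<open>ln Z\<close> is within \<open>e n\<close> of \<open>L n\<close>, and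
  the event in question needs a deviation of \<open>2 e n\<close> from \<open>L n\<close>. Chebyshev's inequality bounds its
  probability by a multiple of \<open>1 / n\<close>.
\<close>
lemma Q_limits:
  assumes k: "2 \<le> k" and \<alpha>: "0 \<le> \<alpha>" and \<epsilon>: "0 < \<epsilon>"
    and L: "(\<lambda>n. planted_ent t k n (\<alpha> * real n / real (card (clauses t k n))) / real n) \<longlonglongrightarrow> L"
  shows "(\<lambda>n. Q t k n \<alpha> (L / ln 2 - \<epsilon>)) \<longlonglongrightarrow> 0" "(\<lambda>n. Q t k n \<alpha> (L / ln 2 + \<epsilon>)) \<longlonglongrightarrow> 1"
proof -
  define p where "p n = \<alpha> * real n / real (card (clauses t k n))" for n
  define e where "e = \<epsilon> * ln 2 / 2"
  have e: "0 < e" using \<epsilon> by (simp add: e_def)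
  let ?h = "\<lambda>n. planted_ent t k n (p n)"
  have k1: "1 \<le> k" using k by simp
  have ev: "eventually (\<lambda>n. 0 < n \<and> (0 \<le> p n \<and> p n < 1 \<and> p n * real (card (clauses t k n)) = \<alpha> * real n)
     \<and> \<bar>?h n / real n - L\<bar> < e) sequentially"
    using eventually_gt_at_top[of 0] planted_rate_limit(2)[OF k \<alpha>, of t] tendstoD[OF L e]
    by eventually_elim (simp add: p_def dist_real_def)
  have bound: "planted_mean t k n (p n) (indicator A) \<le> 2 * \<alpha> / e\<^sup>2 * (1 / real n)"
    if n: "0 < n \<and> (0 \<le> p n \<and> p n < 1 \<and> p n * real (card (clauses t k n)) = \<alpha> * real n) \<and> \<bar>?h n / real n - L\<bar> < e"
      and A: "\<And>F. F \<in> A \<Longrightarrow> sols n F \<noteq> {} \<Longrightarrow> 2 * e * real n \<le> \<bar>ln (real (card (sols n F))) - L * real n\<bar>"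
    for n A
  proof -
    have n0: "0 < real n" using n by simp
    have "?h n - L * real n = (?h n / real n - L) * real n" using n0 by (simp add: left_diff_distrib)
    then have "\<bar>?h n - L * real n\<bar> = \<bar>?h n / real n - L\<bar> * real n" by (simp add: abs_mult)
    also have "\<dots> \<le> e * real n" using n n0 by (intro mult_right_mono) auto
    finally have h: "\<bar>?h n - L * real n\<bar> \<le> e * real n" .
    have "planted_mean t k n (p n) (indicator A) \<le> 2 * p n * real (card (clauses t k n)) / (e * real n)\<^sup>2"
    proof (rule planted_Chebyshev[OF k1])
      fix F assume "F \<in> A" "sols n F \<noteq> {}"
      from A[OF this] h show "e * real n \<le> \<bar>ln (real (card (sols n F))) - ?h n\<bar>" by linarith
    qed (use n e in auto)
    also have "2 * p n * real (card (clauses t k n)) = 2 * \<alpha> * real n" using n by simp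
    finally show ?thesis using n0 by (simp add: power2_eq_square)
  qed
  have small: "(\<lambda>n. 2 * \<alpha> / e\<^sup>2 * (1 / real n)) \<longlonglongrightarrow> 0"
  proof -
    have "(\<lambda>n. 1 / real n) \<longlonglongrightarrow> 0" by real_asymp
    from tendsto_mult_right_zero[OF this] show ?thesis .
  qed
  have lnZ: "real (num_solutions n F) < 2 powr (real n * \<phi>) \<longleftrightarrow> ln (real (card (sols n F))) < real n * \<phi> * ln 2"
    if "sols n F \<noteq> {}" for n F \<phi>
  proof -
    have pos: "0 < real (card (sols n F))" using that by (simp add: card_gt_0_iff)
    have "real (num_solutions n F) < 2 powr (real n * \<phi>) \<longleftrightarrow> ln (real (card (sols n F))) < ln (2 powr (real n * \<phi>))"
      using pos by (subst ln_less_cancel_iff) (auto simp: num_solutions_def sols_def)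
    then show ?thesis by (simp add: ln_powr)
  qed
  have Qeq: "Q t k n \<alpha> \<phi> = planted_mean t k n (p n) (indicator {F. real (num_solutions n F) < 2 powr (real n * \<phi>)})"
    if "0 \<le> p n" "p n < 1" for n \<phi>
    unfolding Q_def p_def by (rule prob_planted_formula) (use that in \<open>auto simp: p_def\<close>)
  have Q0: "0 \<le> Q t k n \<alpha> \<phi>" "Q t k n \<alpha> \<phi> \<le> 1" for n \<phi>
    by (simp_all add: Q_def)
  show "(\<lambda>n. Q t k n \<alpha> (L / ln 2 - \<epsilon>)) \<longlonglongrightarrow> 0"
  proof (rule Lim_null_comparison[OF _ small])
    show "eventually (\<lambda>n. norm (Q t k n \<alpha> (L / ln 2 - \<epsilon>)) \<le> 2 * \<alpha> / e\<^sup>2 * (1 / real n)) sequentially"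
      using ev
    proof eventually_elim
      case (elim n)
      have "planted_mean t k n (p n) (indicator {F. real (num_solutions n F) < 2 powr (real n * (L / ln 2 - \<epsilon>))}) \<le> 2 * \<alpha> / e\<^sup>2 * (1 / real n)"
      proof (rule bound[OF elim])
        fix F assume F: "F \<in> {F. real (num_solutions n F) < 2 powr (real n * (L / ln 2 - \<epsilon>))}" "sols n F \<noteq> {}"
        then have "ln (real (card (sols n F))) < real n * (L / ln 2 - \<epsilon>) * ln 2" using lnZ[OF F(2)] by simp
        also have "\<dots> = L * real n - 2 * e * real n" by (simp add: e_def field_simps)
        finally show "2 * e * real n \<le> \<bar>ln (real (card (sols n F))) - L * real n\<bar>" by linarith
      qed
      moreover have "Q t k n \<alpha> (L / ln 2 - \<epsilon>) =
          planted_mean t k n (p n) (indicator {F. real (num_solutions n F) < 2 powr (real n * (L / ln 2 - \<epsilon>))})"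
        using Qeq elim by blast
      ultimately show ?case using Q0(1)[of n "L / ln 2 - \<epsilon>"] by simp
    qed
  qed
  have "(\<lambda>n. 1 - Q t k n \<alpha> (L / ln 2 + \<epsilon>)) \<longlonglongrightarrow> 0"
  proof (rule Lim_null_comparison[OF _ small])
    show "eventually (\<lambda>n. norm (1 - Q t k n \<alpha> (L / ln 2 + \<epsilon>)) \<le> 2 * \<alpha> / e\<^sup>2 * (1 / real n)) sequentially"
      using ev
    proof eventually_elim
      case (elim n)
      let ?A = "{F. real (num_solutions n F) < 2 powr (real n * (L / ln 2 + \<epsilon>))}"
      have "planted_mean t k n (p n) (indicator (- ?A)) \<le> 2 * \<alpha> / e\<^sup>2 * (1 / real n)"
      proof (rule bound[OF elim])
        fix F assume F: "F \<in> - ?A" "sols n F \<noteq> {}"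
        have "L * real n + 2 * e * real n = real n * (L / ln 2 + \<epsilon>) * ln 2" by (simp add: e_def field_simps)
        also have "\<dots> \<le> ln (real (card (sols n F)))" using F lnZ[OF F(2)] by simp
        finally show "2 * e * real n \<le> \<bar>ln (real (card (sols n F))) - L * real n\<bar>" by linarith
      qed
      moreover have "indicator (- ?A) = (\<lambda>F. 1 * 1 + (-1) * indicator ?A F :: real)"
        by (auto simp: fun_eq_iff indicator_def)
      then have "planted_mean t k n (p n) (indicator (- ?A)) = 1 - planted_mean t k n (p n) (indicator ?A)"
        by (simp only: planted_mean_linear planted_mean_const)
      moreover have "Q t k n \<alpha> (L / ln 2 + \<epsilon>) = planted_mean t k n (p n) (indicator ?A)"
        using Qeq elim by blast
      ultimately show ?case using Q0(2)[of n "L / ln 2 + \<epsilon>"] by simp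
    qed
  qed
  from tendsto_diff[OF tendsto_const[of 1] this] show "(\<lambda>n. Q t k n \<alpha> (L / ln 2 + \<epsilon>)) \<longlonglongrightarrow> 1" by simp
qed

theorem theorem1:
  fixes t :: clause_type and k :: nat
  assumes "k \<ge> 2"
  shows "\<exists>(D :: real set) (\<phi>\<^sub>s :: real \<Rightarrow> real).
           countable D \<and> \<phi>\<^sub>s \<in> {0..} \<rightarrow> {0..1} \<and>
           (\<forall>\<alpha> \<in> {0..} - D. \<forall>\<epsilon>>0.
              (\<lambda>n. Q t k n \<alpha> (\<phi>\<^sub>s \<alpha> - \<epsilon>)) \<longlonglongrightarrow> 0 \<and>
              (\<lambda>n. Q t k n \<alpha> (\<phi>\<^sub>s \<alpha> + \<epsilon>)) \<longlonglongrightarrow> 1)"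
proof -
  let ?h = "\<lambda>\<alpha> n. planted_ent t k n (\<alpha> * real n / real (card (clauses t k n))) / real n"
  have "\<forall>\<alpha>\<in>{0..}. \<exists>L. 0 \<le> L \<and> L \<le> ln 2 \<and> ?h \<alpha> \<longlonglongrightarrow> L"
    using planted_rate_limit(1)[OF assms] by simp
  from bchoice[OF this] obtain L where L: "\<forall>\<alpha>\<in>{0..}. 0 \<le> L \<alpha> \<and> L \<alpha> \<le> ln 2 \<and> ?h \<alpha> \<longlonglongrightarrow> L \<alpha>"
    by blast
  have "(\<lambda>\<alpha>. L \<alpha> / ln 2) \<in> {0..} \<rightarrow> {0..1}" using L by auto
  moreover have "(\<lambda>n. Q t k n \<alpha> (L \<alpha> / ln 2 - \<epsilon>)) \<longlonglongrightarrow> 0 \<and> (\<lambda>n. Q t k n \<alpha> (L \<alpha> / ln 2 + \<epsilon>)) \<longlonglongrightarrow> 1"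
    if "\<alpha> \<in> {0..} - {}" "\<epsilon> > 0" for \<alpha> \<epsilon>
    using Q_limits[OF assms _ that(2), of \<alpha> t "L \<alpha>"] L that(1) by simp
  ultimately show ?thesis by (intro exI[of _ "{}"] exI[of _ "\<lambda>\<alpha>. L \<alpha> / ln 2"]) auto
qed


end
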